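(* Let $m\geq 1$ be an integer and let $\Omega$ be a domain (in some finite-dimensional complex space $\mathbb{C}^N$) which is Carathéodory hyperbolic, $\gamma$-hyperbolic and $c^*$-finitely compact. Then the following are equivalent. (1) $\Omega\subset\mathbb{C}^m$ and there is a set of test functions $\Psi=\{\psi_j:1\leq j\leq m\}\subset\mathscr{S}(\Omega)$ consisting of $m$ functions, all vanishing at a common point $w_0\in\Omega$, such that $\mathscr{SA}_\Psi=\mathscr{S}(\Omega)$. (2) $m=1$ or $m=2$, and $\Omega$ is biholomorphic to $\mathbb{D}^m$.
   Context: $\mathbb{D}$ is the open unit disc in $\mathbb{C}$. A domain $\Omega$ in a finite-dimensional complex space is Carathéodory hyperbolic if the bounded holomorphic functions on $\Omega$ separate the points of $\Omega$. The Schur class $\mathscr{S}(\Omega)$ is the closed unit ball, for the supremum norm, of the Banach algebra of bounded holomorphic functions $\Omega\to\mathbb{C}$. For $a,b\in\mathbb{D}$ put $m(a,b)=\left|\frac{a-b}{1-a\overline{b}}\right|$ (this function $m(\cdot,\cdot)$ is not to be confused with the integer $m$). The Carathéodory pseudodistance on $\Omega$ is $c^*_\Omega(z_1,z_2)=\sup\{m(f(z_1),f(z_2)): f\in\mathscr{S}(\Omega),\ f(\Omega)\subset\mathbb{D}\}$. The domain $\Omega$ is $c^*$-finitely compact if for each $z_1\in\Omega$ and $r\in(0,1)$ the set $\{z_2\in\Omega: c^*_\Omega(z_1,z_2)<r\}$ is relatively compact in $\Omega$. The domain $\Omega\subset\mathbb{C}^N$ is $\gamma$-hyperbolic if its Carathéodory–Reiffen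 pseudometric $\gamma_\Omega(z;X)=\sup\{|f'(z)X|: f:\Omega\to\mathbb{D}\text{ holomorphic},\ f(z)=0\}$ is nondegenerate, i.e. $\gamma_\Omega(z;X)>0$ for all $z\in\Omega$ and all $X\in\mathbb{C}^N\setminus\{0\}$. A collection $\Psi$ of $\mathbb{C}$-valued functions on $\Omega$ is a set of test functions if (i) $\sup\{|\psi(z)|:\psi\in\Psi\}<1$ for each $z\in\Omega$; and (ii) for each finite subset $F\subset\Omega$, the restrictions $\{\psi|_F:\psi\in\Psi\}$ together with the constant function generate the algebra of all $\mathbb{C}$-valued functions on $F$. For a function $G:\Omega\times\Omega\to\mathbb{C}$, the notation $(G(z,w))_{z,w\in\Omega}\ge\mathbf{0}$ means $G$ is positive semidefinite: for each finite list $z_1,\dots,z_n\in\Omega$ the matrix $(G(z_i,z_j))_{i,j}$ is positive semidefinite. The set $\mathcal{K}_\Psi$ of $\Psi$-admissible kernels consists of all positive semidefinite functions $k:\Omega\times\Omega\to\mathbb{C}$ such that $\big((1-\psi(z)\overline{\psi(w)})k(z,w)\big)_{z,w\in\Omega}\ge\mathbf{0}$ for all $\psi\in\Psi$. The $\Psi$-Schur-Agler class $\mathscr{SA}_\Psi$ is the set of all functions $f:\Omega\to\mathbb{C}$ such that $\big((1-f(z)\overline{f(w)})k(z,w)\big)_{z,w\in\Omega}\ge\mathbf{0}$ for all $k\in\mathcal{K}_\Psi$. *)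

theory Defs
  imports "HOL-Analysis.Analysis"
begin

text \<open>A function on \<open>\<Omega>\<close> with values in \<open>\<complex>\<close> is represented by an element of
  \<open>\<Omega> \<rightarrow>\<^sub>E UNIV\<close>, so that two such functions are equal iff they agree on \<open>\<Omega>\<close>.\<close>

abbreviation unit_disc :: "complex set" where
  "unit_disc \<equiv> ball 0 1"

definition polydisc :: "(complex ^ 'n) set" where
  "polydisc = {z. \<forall>i. z $ i \<in> unit_disc}"

definition complex_domain :: "(complex ^ 'n) set \<Rightarrow> bool" where
  "complex_domain \<Omega> \<longleftrightarrow> open \<Omega> \<and> connected \<Omega> \<and> \<Omega> \<noteq> {}"

text \<open>Holomorphy in several variables: the real Frechet derivative exists at every point and is
  complex-linear. It is used for open sets only.\<close>

definition mholomorphic_on :: "(complex ^ 'n \<Rightarrow> complex) \<Rightarrow> (complex ^ 'n) set \<Rightarrow> bool"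
    (infixl \<open>mholomorphic'_on\<close> 50) where
  "f mholomorphic_on \<Omega> \<longleftrightarrow>
     (\<forall>z\<in>\<Omega>. \<exists>f'. (f has_derivative f') (at z) \<and> (\<forall>c X. f' (c *s X) = c * f' X))"

definition biholomorphic :: "(complex ^ 'n) set \<Rightarrow> (complex ^ 'm) set \<Rightarrow> bool" where
  "biholomorphic U V \<longleftrightarrow>
     (\<exists>F G. F ` U = V \<and> G ` V = U \<and> (\<forall>z\<in>U. G (F z) = z) \<and> (\<forall>w\<in>V. F (G w) = w) \<and>
        (\<forall>i. (\<lambda>z. F z $ i) mholomorphic_on U) \<and> (\<forall>i. (\<lambda>w. G w $ i) mholomorphic_on V))"

definition caratheodory_hyperbolic :: "(complex ^ 'n) set \<Rightarrow> bool" where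
  "caratheodory_hyperbolic \<Omega> \<longleftrightarrow>
     (\<forall>z\<in>\<Omega>. \<forall>w\<in>\<Omega>. z \<noteq> w \<longrightarrow>
        (\<exists>f. f mholomorphic_on \<Omega> \<and> bounded (f ` \<Omega>) \<and> f z \<noteq> f w))"

definition schur_class :: "(complex ^ 'n) set \<Rightarrow> (complex ^ 'n \<Rightarrow> complex) set" where
  "schur_class \<Omega> = {f \<in> \<Omega> \<rightarrow>\<^sub>E UNIV. f mholomorphic_on \<Omega> \<and> (\<forall>z\<in>\<Omega>. cmod (f z) \<le> 1)}"

definition pseudohyperbolic_dist :: "complex \<Rightarrow> complex \<Rightarrow> real" where
  "pseudohyperbolic_dist a b = cmod ((a - b) / (1 - a * cnj b))"

definition caratheodory_dist ::
    "(complex ^ 'n) set \<Rightarrow> complex ^ 'n \<Rightarrow> complex ^ 'n \<Rightarrow> real" where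
  "caratheodory_dist \<Omega> z w =
     (SUP f\<in>{f \<in> schur_class \<Omega>. f ` \<Omega> \<subseteq> unit_disc}. pseudohyperbolic_dist (f z) (f w))"

definition caratheodory_finitely_compact :: "(complex ^ 'n) set \<Rightarrow> bool" where
  "caratheodory_finitely_compact \<Omega> \<longleftrightarrow>
     (\<forall>z\<in>\<Omega>. \<forall>r\<in>{0<..<1}.
        (let B = {w\<in>\<Omega>. caratheodory_dist \<Omega> z w < r} in compact (closure B) \<and> closure B \<subseteq> \<Omega>))"

text \<open>The supremum is taken in \<open>[0,\<infinity>]\<close>, so that its meaning does not depend on a boundedness
  argument (the Cauchy estimates).\<close>

definition caratheodory_reiffen ::
    "(complex ^ 'n) set \<Rightarrow> complex ^ 'n \<Rightarrow> complex ^ 'n \<Rightarrow> ennreal" where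
  "caratheodory_reiffen \<Omega> z X =
     (SUP f\<in>{f. f mholomorphic_on \<Omega> \<and> f ` \<Omega> \<subseteq> unit_disc \<and> f z = 0}.
        ennreal (cmod (frechet_derivative f (at z) X)))"

definition gamma_hyperbolic :: "(complex ^ 'n) set \<Rightarrow> bool" where
  "gamma_hyperbolic \<Omega> \<longleftrightarrow> (\<forall>z\<in>\<Omega>. \<forall>X. X \<noteq> 0 \<longrightarrow> caratheodory_reiffen \<Omega> z X > 0)"

text \<open>The unital algebra of functions on \<open>F\<close> generated by the restrictions to \<open>F\<close> of the members
  of \<open>\<Psi>\<close>.\<close>

inductive_set generated_algebra :: "'a set \<Rightarrow> ('a \<Rightarrow> complex) set \<Rightarrow> ('a \<Rightarrow> complex) set"
  for F :: "'a set" and \<Psi> :: "('a \<Rightarrow> complex) set" where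
  const: "(\<lambda>z\<in>F. 1) \<in> generated_algebra F \<Psi>"
| gen: "\<psi> \<in> \<Psi> \<Longrightarrow> restrict \<psi> F \<in> generated_algebra F \<Psi>"
| scale: "f \<in> generated_algebra F \<Psi> \<Longrightarrow> (\<lambda>z\<in>F. c * f z) \<in> generated_algebra F \<Psi>"
| add: "f \<in> generated_algebra F \<Psi> \<Longrightarrow> g \<in> generated_algebra F \<Psi> \<Longrightarrow>
    (\<lambda>z\<in>F. f z + g z) \<in> generated_algebra F \<Psi>"
| mult: "f \<in> generated_algebra F \<Psi> \<Longrightarrow> g \<in> generated_algebra F \<Psi> \<Longrightarrow>
    (\<lambda>z\<in>F. f z * g z) \<in> generated_algebra F \<Psi>"

definition test_functions :: "'a set \<Rightarrow> ('a \<Rightarrow> complex) set \<Rightarrow> bool" where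
  "test_functions \<Omega> \<Psi> \<longleftrightarrow>
     \<Psi> \<subseteq> (\<Omega> \<rightarrow>\<^sub>E UNIV) \<and>
     (\<forall>z\<in>\<Omega>. (SUP \<psi>\<in>\<Psi>. ennreal (cmod (\<psi> z))) < 1) \<and>
     (\<forall>F. finite F \<and> F \<subseteq> \<Omega> \<longrightarrow> generated_algebra F \<Psi> = (F \<rightarrow>\<^sub>E UNIV))"

text \<open>The matrix \<open>(G z\<^sub>i z\<^sub>j)\<^sub>i\<^sub>j\<close> is positive semidefinite iff \<open>c\<^sup>* G c\<close> is a nonnegative real number
  for every complex vector \<open>c\<close>; over \<open>\<complex>\<close> this includes that it is Hermitian.\<close>

definition psd_on :: "'a set \<Rightarrow> ('a \<Rightarrow> 'a \<Rightarrow> complex) \<Rightarrow> bool" where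
  "psd_on \<Omega> G \<longleftrightarrow>
     (\<forall>zs. set zs \<subseteq> \<Omega> \<longrightarrow>
        (\<forall>c :: nat \<Rightarrow> complex.
           (\<Sum>i<length zs. \<Sum>j<length zs. cnj (c i) * G (zs ! i) (zs ! j) * c j) \<in> \<real>\<^sub>\<ge>\<^sub>0))"

definition admissible_kernels :: "'a set \<Rightarrow> ('a \<Rightarrow> complex) set \<Rightarrow> ('a \<Rightarrow> 'a \<Rightarrow> complex) set" where
  "admissible_kernels \<Omega> \<Psi> =
     {k. psd_on \<Omega> k \<and> (\<forall>\<psi>\<in>\<Psi>. psd_on \<Omega> (\<lambda>z w. (1 - \<psi> z * cnj (\<psi> w)) * k z w))}"

definition schur_agler_class :: "'a set \<Rightarrow> ('a \<Rightarrow> complex) set \<Rightarrow> ('a \<Rightarrow> complex) set" where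
  "schur_agler_class \<Omega> \<Psi> =
     {f \<in> \<Omega> \<rightarrow>\<^sub>E UNIV.
        \<forall>k\<in>admissible_kernels \<Omega> \<Psi>. psd_on \<Omega> (\<lambda>z w. (1 - f z * cnj (f w)) * k z w)}"

end

theory Submission
  imports Defs "HOL-Complex_Analysis.Conformal_Mappings"
begin

text \<open>
  Two facts about kernels carry both directions. First, extending a kernel by zero off a subset of
  \<open>\<Omega>\<close> keeps it admissible, so a member of the Schur-Agler class can be tested on kernels that live
  on two points, on a slice, or on a finite set. Secondly, a positive kernel on a finite set is a Gram
  matrix, which turns admissibility into contractivity of diagonal operators.

  From the test functions to the polydisc. Let \<open>F = (\<psi>\<^sub>1, \<dots>, \<psi>\<^sub>m)\<close>. Kernels on two points show that no
  member of the Schur-Agler class increases the pseudohyperbolic distance beyond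
  \<open>max\<^sub>j m(\<psi>\<^sub>j z, \<psi>\<^sub>j w)\<close> (\<open>schur_agler_two_points\<close>). If every Schur function belongs to that class, the
  Caratheodory distance from the common zero \<open>w\<^sub>0\<close> is at most \<open>max\<^sub>j \<bar>\<psi>\<^sub>j\<bar>\<close>, and a vector that is killed by all
  \<open>\<psi>\<^sub>j'\<close> is killed by the Caratheodory-Reiffen metric. So \<open>F\<close> is injective because test functions
  separate points, it is a proper map into \<open>\<DD>\<^sup>m\<close> because \<open>\<Omega>\<close> is finitely compact, and it is
  immersive because \<open>\<Omega>\<close> is \<open>\<gamma>\<close>-hyperbolic. As the dimensions agree, invariance of domain makes \<open>F\<close> open,
  hence a biholomorphic map onto \<open>\<DD>\<^sup>m\<close> (\<open>biholomorphic_polydisc\<close>).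

  Why \<open>m \<le> 2\<close>. Von Neumann's inequality fails for three commuting contractions. In the language of
  kernels: the polynomial of Varopoulos and Kaijser, \<open>x\<^sup>2 + y\<^sup>2 + z\<^sup>2 - 2 x y - 2 x z - 2 y z\<close>, is
  bounded by \<open>5\<close> on the tridisc (\<open>norm_vpoly_le\<close>), but one fifth of it is not a contractive multiplier for an
  explicit kernel for which the three coordinates are contractive multipliers (\<open>vkernel_psd\<close>,
  \<open>vkernel_not_multiplier\<close>). For \<open>m \<ge> 3\<close> this kernel is pulled back by three of the \<open>\<psi>\<^sub>j\<close> and
  placed on the set where the others vanish.

  From the polydisc to the test functions. For \<open>m \<le> 2\<close> the test functions are the components of the biholomorphic
  map. That Schur-Agler functions are holomorphic is seen on the coordinate discs: the Szego kernel
  of a disc bounds the second divided differences of such a function. The converse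
  inclusion is the theorem of Ando and Agler (\<open>agler_bidisc\<close>). On a finite set, an admissible kernel
  is a pair of commuting contractions with common eigenvectors; these are compressions of
  commuting isometries; and for commuting isometries von Neumann's inequality is Parseval's
  identity on a large square of the lattice of exponents. A function on the bidisc enters
  through its interpolation polynomials at scaled roots of unity. The case \<open>m = 1\<close> is
  the case of two equal coordinates.
\<close>

section \<open>Positive semidefinite matrices and Gram vectors\<close>

definition psd_matrix :: "nat \<Rightarrow> (nat \<Rightarrow> nat \<Rightarrow> complex) \<Rightarrow> bool" where
  "psd_matrix n G \<longleftrightarrow> (\<forall>c. (\<Sum>i<n. \<Sum>j<n. cnj (c i) * G i j * c j) \<in> \<real>\<^sub>\<ge>\<^sub>0)"

lemma psd_on_iff_psd_matrix:
  "psd_on \<Omega> G \<longleftrightarrow> (\<forall>zs. set zs \<subseteq> \<Omega> \<longrightarrow> psd_matrix (length zs) (\<lambda>i j. G (zs ! i) (zs ! j)))"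
  by (simp add: psd_on_def psd_matrix_def)

lemma psd_matrix_cong:
  assumes "\<And>i j. i < n \<Longrightarrow> j < n \<Longrightarrow> G i j = H i j"
  shows "psd_matrix n G \<longleftrightarrow> psd_matrix n H"
  unfolding psd_matrix_def using assms by (auto intro!: sum.cong)

lemma cmod_power2_eq_mult_cnj: "complex_of_real ((cmod w)\<^sup>2) = w * cnj w"
  using complex_norm_square[of w] by (simp only: of_real_power)

lemma sum_delta2:
  fixes G :: "nat \<Rightarrow> nat \<Rightarrow> complex"
  assumes "i < n" "j < n"
  shows "(\<Sum>p<n. \<Sum>q<n. cnj ((if p = i then \<alpha> else 0) + (if p = j then \<beta> else 0)) * G p q
            * ((if q = i then \<alpha> else 0) + (if q = j then \<beta> else 0)))
        = cnj \<alpha> * G i i * \<alpha> + cnj \<alpha> * G i j * \<beta> + cnj \<beta> * G j i * \<alpha> + cnj \<beta> * G j j * \<beta>"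
proof -
  have inner: "(\<Sum>q<n. x q * ((if q = i then \<alpha> else 0) + (if q = j then \<beta> else 0))) = x i * \<alpha> + x j * \<beta>"
    for x :: "nat \<Rightarrow> complex"
    using assms by (simp add: distrib_left sum.distrib if_distrib[of "\<lambda>t. _ * t"] cong: if_cong)
  have outer: "(\<Sum>q<n. cnj ((if q = i then \<alpha> else 0) + (if q = j then \<beta> else 0)) * x q)
      = cnj \<alpha> * x i + cnj \<beta> * x j" for x :: "nat \<Rightarrow> complex"
    using assms by (simp add: distrib_right sum.distrib if_distrib[of cnj] if_distrib[of "\<lambda>t. t * _"] cong: if_cong)
  have "(\<Sum>p<n. \<Sum>q<n. cnj ((if p = i then \<alpha> else 0) + (if p = j then \<beta> else 0)) * G p q
            * ((if q = i then \<alpha> else 0) + (if q = j then \<beta> else 0)))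
     = (\<Sum>p<n. cnj ((if p = i then \<alpha> else 0) + (if p = j then \<beta> else 0)) * (G p i * \<alpha> + G p j * \<beta>))"
    by (rule sum.cong[OF refl], subst inner, simp add: algebra_simps)
  also have "\<dots> = cnj \<alpha> * (G i i * \<alpha> + G i j * \<beta>) + cnj \<beta> * (G j i * \<alpha> + G j j * \<beta>)"
    by (rule outer)
  finally show ?thesis by (simp add: algebra_simps)
qed

lemma psd_matrix_two_points:
  assumes "psd_matrix n G" "i < n" "j < n"
  shows "cnj \<alpha> * G i i * \<alpha> + cnj \<alpha> * G i j * \<beta> + cnj \<beta> * G j i * \<alpha> + cnj \<beta> * G j j * \<beta> \<in> \<real>\<^sub>\<ge>\<^sub>0"
  using assms(1)[unfolded psd_matrix_def, rule_format,
      of "\<lambda>p. (if p = i then \<alpha> else 0) + (if p = j then \<beta> else 0)"]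
  unfolding sum_delta2[OF assms(2,3)] .

lemma psd_matrix_diag:
  assumes "psd_matrix n G" "i < n"
  shows "G i i \<in> \<real>\<^sub>\<ge>\<^sub>0"
  using psd_matrix_two_points[OF assms assms(2), of 1 0] by simp

lemma psd_matrix_hermitian:
  assumes "psd_matrix n G" "i < n" "j < n"
  shows "G j i = cnj (G i j)"
proof -
  have "Im (G i i) = 0" "Im (G j j) = 0"
    using psd_matrix_diag[OF assms(1)] assms by (auto simp: complex_nonneg_Reals_iff)
  then show ?thesis
    using psd_matrix_two_points[OF assms, of 1 1] psd_matrix_two_points[OF assms, of 1 \<i>]
    by (auto simp: complex_nonneg_Reals_iff complex_eq_iff)
qed

text \<open>If \<open>G\<^sub>i\<^sub>j \<noteq> 0\<close>, the vector with entry \<open>- s G\<^sub>i\<^sub>j\<close> at \<open>i\<close> and \<open>1\<close> at \<open>j\<close> makes the form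
  \<open>G\<^sub>j\<^sub>j - 2 s \<bar>G\<^sub>i\<^sub>j\<bar>\<^sup>2\<close>, which is negative for large \<open>s\<close>.\<close>

lemma psd_matrix_zero_diag:
  assumes "psd_matrix n G" "i < n" "j < n" "G i i = 0"
  shows "G i j = 0"
proof (rule ccontr)
  assume "G i j \<noteq> 0"
  define s where "s = (Re (G j j) + 1) / (cmod (G i j))\<^sup>2"
  have pos: "(cmod (G i j))\<^sup>2 > 0" using \<open>G i j \<noteq> 0\<close> by simp
  have ge: "Re (G j j) \<ge> 0" using psd_matrix_diag[OF assms(1,3)] by (simp add: complex_nonneg_Reals_iff)
  have h: "G j i = cnj (G i j)" by (rule psd_matrix_hermitian[OF assms(1-3)])
  have "0 \<le> Re (cnj (- of_real s * G i j) * G i i * (- of_real s * G i j) + cnj (- of_real s * G i j) * G i j * 1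
     + cnj 1 * G j i * (- of_real s * G i j) + cnj 1 * G j j * 1)"
    using psd_matrix_two_points[OF assms(1-3), of "- of_real s * G i j" 1]
    unfolding complex_nonneg_Reals_iff by blast
  also have "\<dots> = Re (G j j) - 2 * s * (cmod (G i j))\<^sup>2"
    unfolding assms(4) h cmod_power2 by (simp add: power2_eq_square algebra_simps)
  also have "\<dots> = - Re (G j j) - 2"
    using pos by (simp add: s_def)
  finally show False using ge by simp
qed

text \<open>Minimizing the form of \<open>G\<close> over the last entry \<open>t\<close> of a vector leaves the form of the Schur complement.
  If \<open>G\<^sub>n\<^sub>n = 0\<close>, division by zero yields \<open>t = 0\<close> and subtracts nothing, so no separate case arises.\<close>

lemma psd_matrix_schur_complement:
  assumes psd: "psd_matrix (Suc n) G"
  shows "psd_matrix n (\<lambda>i j. G i j - G i n * G n j / G n n)"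
  unfolding psd_matrix_def
proof
  fix c :: "nat \<Rightarrow> complex"
  define L where "L = (\<Sum>j<n. G n j * c j)"
  define t where "t = - L / G n n"
  define c' where "c' = c(n := t)"
  have real: "cnj (G n n) = G n n"
    using psd_matrix_hermitian[OF psd, of n n] by simp
  have cL: "(\<Sum>i<n. cnj (c i) * G i n) = cnj L"
    unfolding L_def cnj_sum
    by (rule sum.cong[OF refl], use psd_matrix_hermitian[OF psd, of _ n] in auto)
  have "(\<Sum>i<Suc n. \<Sum>j<Suc n. cnj (c' i) * G i j * c' j)
     = (\<Sum>i<n. \<Sum>j<n. cnj (c i) * G i j * c j) + (\<Sum>i<n. cnj (c i) * G i n) * t
       + cnj t * L + cnj t * G n n * t"
    by (simp add: c'_def L_def sum.distrib sum_distrib_left sum_distrib_right mult.assoc)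
  also have "\<dots> = (\<Sum>i<n. \<Sum>j<n. cnj (c i) * G i j * c j) - cnj L * L / G n n"
    unfolding cL t_def by (cases "G n n = 0") (simp_all add: real field_simps)
  also have "cnj L * L / G n n = (\<Sum>i<n. \<Sum>j<n. cnj (c i) * (G i n * G n j / G n n) * c j)"
    unfolding cL[symmetric] unfolding L_def sum_product sum_divide_distrib
    by (simp add: mult_ac)
  also have "(\<Sum>i<n. \<Sum>j<n. cnj (c i) * G i j * c j)
        - (\<Sum>i<n. \<Sum>j<n. cnj (c i) * (G i n * G n j / G n n) * c j)
      = (\<Sum>i<n. \<Sum>j<n. cnj (c i) * (G i j - G i n * G n j / G n n) * c j)"
    by (simp only: sum_subtractf[symmetric] right_diff_distrib left_diff_distrib)
  finally show "(\<Sum>i<n. \<Sum>j<n. cnj (c i) * (G i j - G i n * G n j / G n n) * c j) \<in> \<real>\<^sub>\<ge>\<^sub>0"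
    using psd[unfolded psd_matrix_def, rule_format, of c'] by metis
qed

text \<open>Cholesky factorization: the Schur complement splits off the last coordinate of the Gram vectors.\<close>

lemma psd_matrix_gram:
  assumes "psd_matrix n G"
  shows "\<exists>g. \<forall>i<n. \<forall>j<n. G i j = (\<Sum>l<n. g i l * cnj (g j l))"
  using assms
proof (induction n arbitrary: G)
    case 0
    then show ?case by simp
  next
    case (Suc n)
    define d where "d = Re (G n n)"
    have d: "G n n = of_real d" "d \<ge> 0"
      using psd_matrix_diag[OF Suc.prems, of n] by (auto simp: complex_nonneg_Reals_iff complex_eq_iff d_def)
    have herm: "G j i = cnj (G i j)" if "i < Suc n" "j < Suc n" for i j
      using psd_matrix_hermitian[OF Suc.prems that] .
    obtain g where g: "\<And>i j. i < n \<Longrightarrow> j < n \<Longrightarrow>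
        G i j - G i n * G n j / G n n = (\<Sum>l<n. g i l * cnj (g j l))"
      using Suc.IH[OF psd_matrix_schur_complement[OF Suc.prems]] by (elim exE) simp
    define g' where "g' i l = (if l = n then G i n / of_real (sqrt d) else if i = n then 0 else g i l)" for i l
    have last: "g' i n * cnj (g' j n) = G i n * G n j / G n n" if "i < Suc n" "j < Suc n" for i j
    proof -
      have "complex_of_real (sqrt d) * complex_of_real (sqrt d) = of_real d"
        using d(2) by (simp flip: of_real_mult)
      then show ?thesis
        using that herm[of j n] by (simp add: g'_def d(1))
    qed
    have "G i j = (\<Sum>l<Suc n. g' i l * cnj (g' j l))" if "i < Suc n" "j < Suc n" for i j
    proof -
      have *: "(\<Sum>l<Suc n. g' i l * cnj (g' j l)) = (\<Sum>l<n. g' i l * cnj (g' j l)) + G i n * G n j / G n n"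
        using last[OF that] by simp
      have "(i < n \<and> j < n) \<or> i = n \<or> j = n" using that by auto
      then consider "i < n" "j < n" | "i = n" | "j = n" by blast
      then show ?thesis
      proof cases
        case 1
        then show ?thesis unfolding * using g[OF 1] by (simp add: g'_def algebra_simps)
      next
        case 2
        have "(\<Sum>l<n. g' i l * cnj (g' j l)) = 0" using 2 by (simp add: g'_def)
        moreover have "G n n = 0 \<Longrightarrow> G n j = 0"
          using psd_matrix_zero_diag[OF Suc.prems _ that(2), of n] by simp
        ultimately show ?thesis unfolding * using 2 by auto
      next
        case 3
        have "(\<Sum>l<n. g' i l * cnj (g' j l)) = 0" using 3 by (simp add: g'_def)
        moreover have "G n n = 0 \<Longrightarrow> G i n = 0"
          using psd_matrix_zero_diag[OF Suc.prems _ that(1), of n] herm[of n i] that by simp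
        ultimately show ?thesis unfolding * using 3 by auto
      qed
    qed
    then show ?case by (intro exI[of _ g'] allI impI)
qed

lemma gram_quadratic_form:
  fixes g :: "'i \<Rightarrow> 'l \<Rightarrow> complex"
  shows "(\<Sum>i\<in>I. \<Sum>j\<in>I. cnj (c i) * (\<Sum>l\<in>A. g i l * cnj (g j l)) * c j)
       = of_real (\<Sum>l\<in>A. (cmod (\<Sum>i\<in>I. cnj (c i) * g i l))\<^sup>2)"
proof -
  have "(\<Sum>i\<in>I. \<Sum>j\<in>I. cnj (c i) * (\<Sum>l\<in>A. g i l * cnj (g j l)) * c j)
     = (\<Sum>i\<in>I. \<Sum>j\<in>I. \<Sum>l\<in>A. (cnj (c i) * g i l) * cnj (cnj (c j) * g j l))"
    by (simp add: sum_distrib_left sum_distrib_right mult_ac)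
  also have "\<dots> = (\<Sum>i\<in>I. \<Sum>l\<in>A. \<Sum>j\<in>I. (cnj (c i) * g i l) * cnj (cnj (c j) * g j l))"
    by (intro sum.cong[OF refl] sum.swap)
  also have "\<dots> = (\<Sum>l\<in>A. \<Sum>i\<in>I. \<Sum>j\<in>I. (cnj (c i) * g i l) * cnj (cnj (c j) * g j l))"
    by (rule sum.swap)
  also have "\<dots> = (\<Sum>l\<in>A. (\<Sum>i\<in>I. cnj (c i) * g i l) * cnj (\<Sum>i\<in>I. cnj (c i) * g i l))"
    by (simp add: cnj_sum sum_product)
  finally show ?thesis by (simp only: cmod_power2_eq_mult_cnj of_real_sum)
qed

section \<open>Unitary extension of isometries\<close>

definition clinear_map :: "(('i \<Rightarrow> complex) \<Rightarrow> ('j \<Rightarrow> complex)) \<Rightarrow> bool" where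
  "clinear_map T \<longleftrightarrow> (\<forall>u v c. T (\<lambda>l. u l + c * v l) = (\<lambda>l. T u l + c * T v l))"

lemma clinear_mapD: "clinear_map T \<Longrightarrow> T (\<lambda>l. u l + c * v l) = (\<lambda>l. T u l + c * T v l)"
  unfolding clinear_map_def by blast

lemma clinear_map_zero: assumes "clinear_map T" shows "T (\<lambda>_. 0) = (\<lambda>_. 0)"
proof -
  have "T (\<lambda>l. 0 + 1 * 0) = (\<lambda>l. T (\<lambda>_. 0) l + 1 * T (\<lambda>_. 0) l)"
    using clinear_mapD[OF assms, of "\<lambda>_. 0" 1 "\<lambda>_. 0"] by simp
  then show ?thesis by (simp add: fun_eq_iff)
qed

lemma clinear_map_sum:
  assumes "clinear_map T"
  shows "T (\<lambda>l. \<Sum>b\<in>I. p b * v b l) = (\<lambda>l. \<Sum>b\<in>I. p b * T (v b) l)"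
proof (induction I rule: infinite_finite_induct)
  case (insert x F)
  have "T (\<lambda>l. \<Sum>b\<in>insert x F. p b * v b l) = T (\<lambda>l. (\<Sum>b\<in>F. p b * v b l) + p x * v x l)"
    using insert by (simp add: add.commute)
  also have "\<dots> = (\<lambda>l. \<Sum>b\<in>insert x F. p b * T (v b) l)"
    unfolding clinear_mapD[OF assms] insert.IH using insert by (simp add: add.commute)
  finally show ?case .
qed (auto simp: clinear_map_zero[OF assms])

lemma clinear_mapI: "(\<And>u v c. T (\<lambda>l. u l + c * v l) = (\<lambda>l. T u l + c * T v l)) \<Longrightarrow> clinear_map T"
  unfolding clinear_map_def by blast

lemma clinear_map_comp:
  assumes "clinear_map S" "clinear_map T"
  shows "clinear_map (\<lambda>u. S (T u))"
  by (rule clinear_mapI) (simp only: clinear_mapD[OF assms(2)] clinear_mapD[OF assms(1)])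

definition cinner :: "'l set \<Rightarrow> ('l \<Rightarrow> complex) \<Rightarrow> ('l \<Rightarrow> complex) \<Rightarrow> complex" where
  "cinner A u v = (\<Sum>l\<in>A. u l * cnj (v l))"

lemma cinner_simps:
  "cinner A (\<lambda>l. u l + v l) w = cinner A u w + cinner A v w"
  "cinner A w (\<lambda>l. u l + v l) = cinner A w u + cinner A w v"
  "cinner A (\<lambda>l. u l - v l) w = cinner A u w - cinner A v w"
  "cinner A w (\<lambda>l. u l - v l) = cinner A w u - cinner A w v"
  "cinner A (\<lambda>l. c * u l) w = c * cinner A u w"
  "cinner A w (\<lambda>l. c * u l) = cnj c * cinner A w u"
  by (simp_all add: cinner_def algebra_simps sum.distrib sum_subtractf sum_distrib_left)

lemma cnj_cinner: "cnj (cinner A u v) = cinner A v u"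
  by (simp add: cinner_def cnj_sum mult.commute)

lemma cinner_self: "cinner A u u = of_real (\<Sum>l\<in>A. (cmod (u l))\<^sup>2)"
  by (simp only: cinner_def cmod_power2_eq_mult_cnj of_real_sum)

lemma cinner_self_zero: "finite A \<Longrightarrow> cinner A u u = 0 \<Longrightarrow> l \<in> A \<Longrightarrow> u l = 0"
  unfolding cinner_self of_real_eq_0_iff by (subst (asm) sum_nonneg_eq_0_iff) auto

text \<open>For \<open>\<tau> = 2 / \<langle>d, d\<rangle>\<close> this is the reflection in the hyperplane orthogonal to \<open>d\<close>. A complex \<open>\<tau>\<close> is
  needed to move a vector \<open>u\<close> to a vector \<open>v\<close> of equal norm when \<open>\<langle>u, v\<rangle>\<close> is not real.\<close>

definition creflect :: "'l set \<Rightarrow> ('l \<Rightarrow> complex) \<Rightarrow> complex \<Rightarrow> ('l \<Rightarrow> complex) \<Rightarrow> ('l \<Rightarrow> complex)" where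
  "creflect A d \<tau> w = (\<lambda>l. w l - \<tau> * cinner A w d * d l)"

lemma creflect_linear: "clinear_map (creflect A d \<tau>)"
  unfolding clinear_map_def creflect_def by (simp add: cinner_simps algebra_simps)

lemma creflect_cinner:
  assumes "\<tau> + cnj \<tau> = \<tau> * cnj \<tau> * cinner A d d"
  shows "cinner A (creflect A d \<tau> u) (creflect A d \<tau> v) = cinner A u v"
proof -
  have "cinner A (creflect A d \<tau> u) (creflect A d \<tau> v) = cinner A u v
     - cinner A u d * cinner A d v * (\<tau> + cnj \<tau> - \<tau> * cnj \<tau> * cinner A d d)"
    unfolding creflect_def cinner_simps
    by (simp only: complex_cnj_mult cnj_cinner) (simp add: algebra_simps)
  then show ?thesis by (simp only: assms diff_self mult_zero_right diff_zero)
qed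

lemma creflect_inverse:
  assumes "\<tau> + cnj \<tau> = \<tau> * cnj \<tau> * cinner A d d"
  shows "creflect A d (cnj \<tau>) (creflect A d \<tau> u) = u"
proof -
  have "creflect A d (cnj \<tau>) (creflect A d \<tau> u) l = u l
     - cinner A u d * d l * (\<tau> + cnj \<tau> - \<tau> * cnj \<tau> * cinner A d d)" for l
    unfolding creflect_def cinner_simps by (simp add: algebra_simps)
  then show ?thesis by (intro ext) (simp only: assms diff_self mult_zero_right diff_zero)
qed

definition unitary_pair :: "'l set \<Rightarrow> (('l \<Rightarrow> complex) \<Rightarrow> 'l \<Rightarrow> complex) \<Rightarrow> (('l \<Rightarrow> complex) \<Rightarrow> 'l \<Rightarrow> complex) \<Rightarrow> bool" where
  "unitary_pair A W B \<longleftrightarrow> clinear_map W \<and> clinear_map B \<and> (\<forall>u. W (B u) = u) \<and> (\<forall>u. B (W u) = u) \<and>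
     (\<forall>u v. cinner A (W u) (W v) = cinner A u v)"

lemma unitary_pairD:
  assumes "unitary_pair A W B"
  shows "clinear_map W" "clinear_map B" "W (B u) = u" "B (W u) = u"
    "cinner A (W u) (W v) = cinner A u v" "cinner A (B u) (B v) = cinner A u v"
proof -
  show WB: "W (B u) = u" for u using assms unfolding unitary_pair_def by blast
  show W: "cinner A (W u) (W v) = cinner A u v" for u v using assms unfolding unitary_pair_def by blast
  show "cinner A (B u) (B v) = cinner A u v" using W[of "B u" "B v"] unfolding WB by simp
qed (use assms in \<open>auto simp: unitary_pair_def\<close>)

lemma unitary_pair_comp:
  assumes "unitary_pair A W B" "unitary_pair A W' B'"
  shows "unitary_pair A (\<lambda>x. W' (W x)) (\<lambda>x. B (B' x))"
  unfolding unitary_pair_def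
  using clinear_map_comp[OF unitary_pairD(1)[OF assms(2)] unitary_pairD(1)[OF assms(1)]]
    clinear_map_comp[OF unitary_pairD(2)[OF assms(1)] unitary_pairD(2)[OF assms(2)]]
  by (simp add: unitary_pairD(3-5)[OF assms(1)] unitary_pairD(3-5)[OF assms(2)])

lemma unitary_pair_creflect:
  assumes "\<tau> + cnj \<tau> = \<tau> * cnj \<tau> * cinner A d d"
  shows "unitary_pair A (creflect A d \<tau>) (creflect A d (cnj \<tau>))"
proof -
  have "cnj \<tau> + cnj (cnj \<tau>) = cnj \<tau> * cnj (cnj \<tau>) * cinner A d d"
    using assms by (simp add: algebra_simps)
  from creflect_inverse[OF this] show ?thesis
    unfolding unitary_pair_def
    by (simp add: creflect_linear creflect_cinner[OF assms] creflect_inverse[OF assms])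
qed

text \<open>Vectors with equal Gram matrices are matched one at a time. If \<open>W\<close> already maps the first \<open>k\<close> vectors
  correctly, the reflection that moves \<open>u = W p\<^sub>k\<close> to \<open>v = q\<^sub>k\<close> along \<open>d = u - v\<close> fixes the earlier \<open>q\<^sub>i\<close>, since
  equality of the Gram matrices makes them orthogonal to \<open>d\<close>.\<close>

lemma unitary_extension:
  fixes p q :: "nat \<Rightarrow> 'l \<Rightarrow> complex"
  assumes fin: "finite A"
    and supp: "\<And>i l. i < n \<Longrightarrow> l \<notin> A \<Longrightarrow> p i l = 0" "\<And>i l. i < n \<Longrightarrow> l \<notin> A \<Longrightarrow> q i l = 0"
    and gram: "\<And>i j. i < n \<Longrightarrow> j < n \<Longrightarrow> cinner A (p i) (p j) = cinner A (q i) (q j)"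
  shows "\<exists>W B. unitary_pair A W B \<and> (\<forall>i<n. W (p i) = q i)"
proof -
  have "\<exists>W B. unitary_pair A W B \<and> (\<forall>u. \<forall>l. l \<notin> A \<longrightarrow> W u l = u l) \<and> (\<forall>i<k. W (p i) = q i)"
    if "k \<le> n" for k
    using that
  proof (induction k)
    case 0
    have "unitary_pair A (\<lambda>u. u) (\<lambda>u. u)" by (simp add: unitary_pair_def clinear_map_def)
    then show ?case by blast
  next
    case (Suc k)
    from Suc.IH[OF Suc_leD[OF Suc.prems]] obtain W B
      where *: "unitary_pair A W B \<and> (\<forall>u. \<forall>l. l \<notin> A \<longrightarrow> W u l = u l) \<and> (\<forall>i<k. W (p i) = q i)"
      by (elim exE)
    have WB: "unitary_pair A W B" using * by (rule conjunct1)
    have out: "W u l = u l" if "l \<notin> A" for u l using * that by blast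
    have Wp: "W (p i) = q i" if "i < k" for i using * that by blast
    have k: "k < n" using Suc.prems by simp
    define u where "u = W (p k)"
    define v where "v = q k"
    define d where "d = (\<lambda>l. u l - v l)"
    (* With this scalar the reflection sends u to u - d = v; if it degenerates, then d = 0. *)
    define \<tau> where "\<tau> = inverse (cinner A u d)"
    have d0: "d l = 0" if "l \<notin> A" for l
      using out[OF that] supp(1)[OF k that] supp(2)[OF k that] by (simp add: d_def u_def v_def)
    have uv: "cinner A u u = cinner A v v"
      unfolding u_def v_def unitary_pairD(5)[OF WB] by (rule gram[OF k k])
    have dd: "cinner A d d = cinner A u d + cnj (cinner A u d)"
      unfolding d_def by (simp add: cinner_simps cnj_cinner uv)
    have \<tau>: "\<tau> + cnj \<tau> = \<tau> * cnj \<tau> * cinner A d d"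
      unfolding dd \<tau>_def by (cases "cinner A u d = 0") (simp_all add: field_simps)
    have fixed: "creflect A d \<tau> (q i) = q i" if "i < k" for i
    proof -
      have "cinner A (q i) u = cinner A (p i) (p k)"
        unfolding u_def Wp[OF that, symmetric] by (rule unitary_pairD(5)[OF WB])
      then have "cinner A (q i) d = 0"
        unfolding d_def cinner_simps v_def using gram[of i k] that k by simp
      then show ?thesis by (simp add: creflect_def)
    qed
    have new: "creflect A d \<tau> u = v"
    proof (cases "cinner A u d = 0")
      case True
      then have "cinner A d d = 0" using dd by simp
      then have "d l = 0" for l using d0 cinner_self_zero[OF fin] by blast
      then have "u l = v l" for l unfolding d_def by simp
      then show ?thesis using True by (simp add: creflect_def fun_eq_iff)
    next
      case False
      then show ?thesis by (simp add: creflect_def \<tau>_def d_def)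
    qed
    have "unitary_pair A (\<lambda>x. creflect A d \<tau> (W x)) (\<lambda>x. B (creflect A d (cnj \<tau>) x))"
      by (rule unitary_pair_comp[OF WB unitary_pair_creflect[OF \<tau>]])
    moreover have "creflect A d \<tau> (W x) l = x l" if "l \<notin> A" for x l
      using d0[OF that] out[OF that] by (simp add: creflect_def)
    moreover have "creflect A d \<tau> (W (p i)) = q i" if "i < Suc k" for i
    proof (cases "i = k")
      case True
      then show ?thesis using new by (simp add: u_def v_def)
    next
      case False
      then show ?thesis using that fixed[of i] Wp[of i] by simp
    qed
    ultimately show ?case
      by (intro exI[of _ "\<lambda>x. creflect A d \<tau> (W x)"] exI[of _ "\<lambda>x. B (creflect A d (cnj \<tau>) x)"] conjI allI impI)
  qed
  from this[OF order_refl] show ?thesis by (elim exE conjE) (intro exI conjI)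
qed

section \<open>Correlation with a bounded polynomial\<close>

definition unity_root :: "nat \<Rightarrow> nat \<Rightarrow> complex" where
  "unity_root R j = exp (2 * of_real pi * \<i> * of_nat j / of_nat R)"

lemma norm_unity_root [simp]: "cmod (unity_root R j) = 1"
proof -
  have "unity_root R j = cis (2 * pi * j / R)"
    by (simp add: unity_root_def cis_conv_exp mult_ac)
  then show ?thesis by simp
qed

lemma unity_root_nonzero [simp]: "unity_root R j \<noteq> 0"
  by (simp add: unity_root_def)

lemma unity_root_power: "unity_root R j ^ k = unity_root R (j * k)"
  unfolding unity_root_def exp_of_nat_mult[symmetric] by (simp add: algebra_simps)

lemma unity_root_power_self: "R > 0 \<Longrightarrow> unity_root R j ^ R = 1"
  unfolding unity_root_def using complex_root_unity[of R j] by simp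

lemma unity_root_swap: "unity_root R j ^ k = unity_root R k ^ j"
  by (simp add: unity_root_power mult.commute)

lemma unity_root_eq_iff: "R > 0 \<Longrightarrow> j < R \<Longrightarrow> k < R \<Longrightarrow> unity_root R j = unity_root R k \<longleftrightarrow> j = k"
  unfolding unity_root_def using complex_root_unity_eq[of R j k] by simp

lemma cnj_unity_root: "cnj (unity_root R j) = inverse (unity_root R j)"
  using complex_div_cnj[of 1 "unity_root R j"] by (simp add: divide_inverse)

lemma unity_root_orthogonal:
  assumes "j < R" "k < R"
  shows "(\<Sum>g<R. unity_root R j ^ g * cnj (unity_root R k ^ g)) = (if j = k then of_nat R else 0)"
proof -
  define z where "z = unity_root R j / unity_root R k"
  have R: "R > 0" using assms by simp
  have eq: "(\<Sum>g<R. unity_root R j ^ g * cnj (unity_root R k ^ g)) = (\<Sum>g<R. z ^ g)"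
    by (simp add: z_def cnj_unity_root divide_inverse power_inverse power_mult_distrib)
  show ?thesis
  proof (cases "j = k")
    case True
    then show ?thesis unfolding eq by (simp add: z_def)
  next
    case False
    then have "z \<noteq> 1" using unity_root_eq_iff[OF R assms] by (simp add: z_def)
    moreover have "z ^ R = 1" by (simp add: z_def power_divide unity_root_power_self[OF R])
    ultimately show ?thesis unfolding eq using False by (simp add: geometric_sum)
  qed
qed

lemma parseval_dft:
  "(\<Sum>g<R. (cmod (\<Sum>j<R. h j * unity_root R j ^ g))\<^sup>2) = real R * (\<Sum>j<R. (cmod (h j))\<^sup>2)"
proof -
  have "complex_of_real (\<Sum>g<R. (cmod (\<Sum>j<R. h j * unity_root R j ^ g))\<^sup>2)
     = (\<Sum>g<R. \<Sum>j<R. \<Sum>k<R. (h j * cnj (h k)) * (unity_root R j ^ g * cnj (unity_root R k ^ g)))"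
    unfolding of_real_sum cmod_power2_eq_mult_cnj cnj_sum sum_product
    by (simp add: mult_ac)
  also have "\<dots> = (\<Sum>j<R. \<Sum>g<R. \<Sum>k<R. (h j * cnj (h k)) * (unity_root R j ^ g * cnj (unity_root R k ^ g)))"
    by (rule sum.swap)
  also have "\<dots> = (\<Sum>j<R. \<Sum>k<R. \<Sum>g<R. (h j * cnj (h k)) * (unity_root R j ^ g * cnj (unity_root R k ^ g)))"
    by (intro sum.cong[OF refl] sum.swap)
  also have "\<dots> = (\<Sum>j<R. \<Sum>k<R. (h j * cnj (h k)) * (if j = k then of_nat R else 0))"
    unfolding sum_distrib_left[symmetric]
    by (intro sum.cong[OF refl]) (simp only: unity_root_orthogonal lessThan_iff)
  also have "\<dots> = (\<Sum>j<R. of_nat R * complex_of_real ((cmod (h j))\<^sup>2))"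
    unfolding cmod_power2_eq_mult_cnj
    by (intro sum.cong[OF refl]) (simp add: if_distrib[of "\<lambda>t. _ * t"] cong: if_cong)
  also have "\<dots> = complex_of_real (real R * (\<Sum>j<R. (cmod (h j))\<^sup>2))"
    by (simp add: sum_distrib_left)
  finally show ?thesis by (simp only: of_real_eq_iff)
qed

lemma dft_inversion:
  assumes "g < R"
  shows "(\<Sum>j<R. ((\<Sum>k<R. x k * cnj (unity_root R j ^ k)) / of_nat R) * unity_root R j ^ g) = x g"
proof -
  have "(\<Sum>j<R. ((\<Sum>k<R. x k * cnj (unity_root R j ^ k)) / of_nat R) * unity_root R j ^ g)
     = (\<Sum>j<R. \<Sum>k<R. (x k / of_nat R) * (unity_root R j ^ g * cnj (unity_root R j ^ k)))"
    by (simp add: sum_distrib_left sum_distrib_right sum_divide_distrib mult_ac)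
  also have "\<dots> = (\<Sum>k<R. \<Sum>j<R. (x k / of_nat R) * (unity_root R g ^ j * cnj (unity_root R k ^ j)))"
    by (subst sum.swap) (simp only: unity_root_swap)
  also have "\<dots> = (\<Sum>k<R. (x k / of_nat R) * (if g = k then of_nat R else 0))"
    unfolding sum_distrib_left[symmetric]
    by (intro sum.cong[OF refl]) (simp only: unity_root_orthogonal[OF assms] lessThan_iff)
  also have "\<dots> = x g"
    using assms by (simp add: if_distrib[of "\<lambda>t. _ * t"] cong: if_cong)
  finally show ?thesis .
qed

lemma parseval_dft2:
  "(\<Sum>g<R. \<Sum>h<R. (cmod (\<Sum>j<R. \<Sum>i<R. X j i * unity_root R j ^ g * unity_root R i ^ h))\<^sup>2)
     = (real R)\<^sup>2 * (\<Sum>j<R. \<Sum>i<R. (cmod (X j i))\<^sup>2)"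
proof -
  have "(\<Sum>g<R. \<Sum>h<R. (cmod (\<Sum>j<R. \<Sum>i<R. X j i * unity_root R j ^ g * unity_root R i ^ h))\<^sup>2)
      = (\<Sum>g<R. \<Sum>h<R. (cmod (\<Sum>i<R. (\<Sum>j<R. X j i * unity_root R j ^ g) * unity_root R i ^ h))\<^sup>2)"
    unfolding sum_distrib_right by (subst sum.swap) (rule refl)
  also have "\<dots> = (\<Sum>g<R. \<Sum>i<R. real R * (cmod (\<Sum>j<R. X j i * unity_root R j ^ g))\<^sup>2)"
    by (rule sum.cong[OF refl], subst parseval_dft, rule sum_distrib_left)
  also have "\<dots> = (\<Sum>i<R. \<Sum>g<R. real R * (cmod (\<Sum>j<R. X j i * unity_root R j ^ g))\<^sup>2)"
    by (rule sum.swap)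
  also have "\<dots> = (\<Sum>i<R. (real R)\<^sup>2 * (\<Sum>j<R. (cmod (X j i))\<^sup>2))"
    unfolding sum_distrib_left[symmetric] parseval_dft by (simp add: power2_eq_square mult.assoc sum_distrib_left)
  also have "\<dots> = (real R)\<^sup>2 * (\<Sum>j<R. \<Sum>i<R. (cmod (X j i))\<^sup>2)"
    unfolding sum_distrib_left[symmetric] by (subst sum.swap) (rule refl)
  finally show ?thesis .
qed

definition poly2 :: "nat \<Rightarrow> (nat \<Rightarrow> nat \<Rightarrow> complex) \<Rightarrow> complex \<Rightarrow> complex \<Rightarrow> complex" where
  "poly2 N p z w = (\<Sum>k<N. \<Sum>l<N. p k l * z ^ k * w ^ l)"

lemma dft2_exists:
  "\<exists>X. \<forall>g<R. \<forall>h<R. x g h = (\<Sum>j<R. \<Sum>i<R. X j i * unity_root R j ^ g * unity_root R i ^ h)"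
proof -
  define X1 where "X1 j h = (\<Sum>k<R. x k h * cnj (unity_root R j ^ k)) / of_nat R" for j h
  define X where "X j i = (\<Sum>k<R. X1 j k * cnj (unity_root R i ^ k)) / of_nat R" for j i
  have "(\<Sum>j<R. \<Sum>i<R. X j i * unity_root R j ^ g * unity_root R i ^ h) = x g h" if "g < R" "h < R" for g h
  proof -
    have "(\<Sum>j<R. \<Sum>i<R. X j i * unity_root R j ^ g * unity_root R i ^ h)
       = (\<Sum>j<R. (\<Sum>i<R. X j i * unity_root R i ^ h) * unity_root R j ^ g)"
      by (simp add: sum_distrib_right sum_distrib_left mult_ac)
    also have "\<dots> = (\<Sum>j<R. X1 j h * unity_root R j ^ g)"
      unfolding X_def dft_inversion[OF that(2)] ..
    also have "\<dots> = x g h"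
      unfolding X1_def by (rule dft_inversion[OF that(1)])
    finally show ?thesis .
  qed
  then show ?thesis by (intro exI[of _ X]) simp
qed

text \<open>Expand \<open>x\<close> on the square of side \<open>R\<close> into characters. The correlation with \<open>p\<close> multiplies the
  coefficient of each character by a value of the polynomial on the torus, hence by at most \<open>M\<close>, and
  Parseval's identity does the rest. The bound holds on the smaller square, where the shifted indices
  stay inside and no wrap-around occurs.\<close>

lemma correlation_bound:
  assumes bound: "\<And>z w. cmod z = 1 \<Longrightarrow> cmod w = 1 \<Longrightarrow> cmod (poly2 N p z w) \<le> M"
    and KN: "K + N \<le> R"
  shows "(\<Sum>g<K. \<Sum>h<K. (cmod (\<Sum>k<N. \<Sum>l<N. p k l * x (g + k) (h + l)))\<^sup>2)
      \<le> M\<^sup>2 * (\<Sum>g<R. \<Sum>h<R. (cmod (x g h))\<^sup>2)"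
proof -
  obtain X where X: "\<And>g h. g < R \<Longrightarrow> h < R \<Longrightarrow>
      x g h = (\<Sum>j<R. \<Sum>i<R. X j i * unity_root R j ^ g * unity_root R i ^ h)"
    using dft2_exists[of R x] by auto
  let ?u = "unity_root R"
  define Y where "Y j i = X j i * poly2 N p (?u j) (?u i)" for j i
  have y: "(\<Sum>k<N. \<Sum>l<N. p k l * x (g + k) (h + l)) = (\<Sum>j<R. \<Sum>i<R. Y j i * ?u j ^ g * ?u i ^ h)"
    if "g < K" "h < K" for g h
  proof -
    have "(\<Sum>k<N. \<Sum>l<N. p k l * x (g + k) (h + l))
       = (\<Sum>k<N. \<Sum>l<N. \<Sum>j<R. \<Sum>i<R. X j i * (p k l * ?u j ^ k * ?u i ^ l) * ?u j ^ g * ?u i ^ h)"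
      using that KN by (simp add: X sum_distrib_left power_add mult_ac)
    also have "\<dots> = (\<Sum>k<N. \<Sum>j<R. \<Sum>l<N. \<Sum>i<R. X j i * (p k l * ?u j ^ k * ?u i ^ l) * ?u j ^ g * ?u i ^ h)"
      by (intro sum.cong[OF refl] sum.swap)
    also have "\<dots> = (\<Sum>j<R. \<Sum>k<N. \<Sum>l<N. \<Sum>i<R. X j i * (p k l * ?u j ^ k * ?u i ^ l) * ?u j ^ g * ?u i ^ h)"
      by (rule sum.swap)
    also have "\<dots> = (\<Sum>j<R. \<Sum>k<N. \<Sum>i<R. \<Sum>l<N. X j i * (p k l * ?u j ^ k * ?u i ^ l) * ?u j ^ g * ?u i ^ h)"
      by (intro sum.cong[OF refl] sum.swap)
    also have "\<dots> = (\<Sum>j<R. \<Sum>i<R. \<Sum>k<N. \<Sum>l<N. X j i * (p k l * ?u j ^ k * ?u i ^ l) * ?u j ^ g * ?u i ^ h)"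
      by (intro sum.cong[OF refl] sum.swap)
    also have "\<dots> = (\<Sum>j<R. \<Sum>i<R. Y j i * ?u j ^ g * ?u i ^ h)"
      unfolding Y_def poly2_def by (simp add: sum_distrib_left sum_distrib_right)
    finally show ?thesis .
  qed
  have "(\<Sum>g<K. \<Sum>h<K. (cmod (\<Sum>k<N. \<Sum>l<N. p k l * x (g + k) (h + l)))\<^sup>2)
     = (\<Sum>g<K. \<Sum>h<K. (cmod (\<Sum>j<R. \<Sum>i<R. Y j i * ?u j ^ g * ?u i ^ h))\<^sup>2)"
    using y by simp
  also have "\<dots> \<le> (\<Sum>g<R. \<Sum>h<K. (cmod (\<Sum>j<R. \<Sum>i<R. Y j i * ?u j ^ g * ?u i ^ h))\<^sup>2)"
    using KN by (intro sum_mono2 sum_nonneg) auto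
  also have "\<dots> \<le> (\<Sum>g<R. \<Sum>h<R. (cmod (\<Sum>j<R. \<Sum>i<R. Y j i * ?u j ^ g * ?u i ^ h))\<^sup>2)"
    using KN by (intro sum_mono sum_mono2) auto
  also have "\<dots> = (real R)\<^sup>2 * (\<Sum>j<R. \<Sum>i<R. (cmod (Y j i))\<^sup>2)"
    by (rule parseval_dft2)
  also have "\<dots> \<le> (real R)\<^sup>2 * (\<Sum>j<R. \<Sum>i<R. M\<^sup>2 * (cmod (X j i))\<^sup>2)"
  proof (intro mult_left_mono sum_mono)
    fix j i
    have "cmod (poly2 N p (?u j) (?u i)) \<le> M" by (rule bound) simp_all
    then have "(cmod (poly2 N p (?u j) (?u i)))\<^sup>2 \<le> M\<^sup>2" by (intro power_mono) auto
    then show "(cmod (Y j i))\<^sup>2 \<le> M\<^sup>2 * (cmod (X j i))\<^sup>2"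
      unfolding Y_def norm_mult power_mult_distrib by (simp add: mult.commute[of "M\<^sup>2"] mult_left_mono)
  qed simp
  also have "\<dots> = M\<^sup>2 * ((real R)\<^sup>2 * (\<Sum>j<R. \<Sum>i<R. (cmod (X j i))\<^sup>2))"
    by (simp add: sum_distrib_left mult_ac)
  also have "(real R)\<^sup>2 * (\<Sum>j<R. \<Sum>i<R. (cmod (X j i))\<^sup>2) = (\<Sum>g<R. \<Sum>h<R. (cmod (x g h))\<^sup>2)"
    unfolding parseval_dft2[symmetric] using X by simp
  finally show ?thesis .
qed

lemma le_of_rescaled_le:
  fixes E E' :: real
  assumes "\<And>K::nat. (real K)\<^sup>2 * E \<le> (real (K + N))\<^sup>2 * E'"
  shows "E \<le> E'"
proof (rule LIMSEQ_le)
  show "(\<lambda>K. E) \<longlonglongrightarrow> E" by simp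
  have "(\<lambda>K. (1 + real N * inverse (real (Suc K)))\<^sup>2 * E') \<longlonglongrightarrow> (1 + real N * 0)\<^sup>2 * E'"
    by (intro tendsto_intros LIMSEQ_inverse_real_of_nat)
  then show "(\<lambda>K. (1 + real N * inverse (real (Suc K)))\<^sup>2 * E') \<longlonglongrightarrow> E'" by simp
  have "E \<le> (1 + real N * inverse (real (Suc K)))\<^sup>2 * E'" for K
  proof -
    have pos: "(real (Suc K))\<^sup>2 > 0" by simp
    have "(real (Suc K))\<^sup>2 * E \<le> (real (Suc K))\<^sup>2 * ((1 + real N * inverse (real (Suc K)))\<^sup>2 * E')"
    proof -
      have "real (Suc K + N) = real (Suc K) * (1 + real N * inverse (real (Suc K)))"
        by (simp add: field_simps)
      then show ?thesis using assms[of "Suc K"] by (simp only: power_mult_distrib mult.assoc)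
    qed
    then show ?thesis using pos by (simp only: mult_le_cancel_left_pos)
  qed
  then show "\<exists>N0. \<forall>K\<ge>N0. E \<le> (1 + real N * inverse (real (Suc K)))\<^sup>2 * E'" by blast
qed

section \<open>Ando's theorem for diagonal contractions\<close>

definition norm_sq_comb :: "nat \<Rightarrow> (nat \<Rightarrow> nat \<Rightarrow> complex) \<Rightarrow> (nat \<Rightarrow> complex) \<Rightarrow> real" where
  "norm_sq_comb n v c = (\<Sum>l<n. (cmod (\<Sum>i<n. c i * v i l))\<^sup>2)"

lemma norm_sq_comb_gram:
  "complex_of_real (norm_sq_comb n v c)
     = (\<Sum>i<n. \<Sum>j<n. c i * (\<Sum>l<n. v i l * cnj (v j l)) * cnj (c j))"
  using gram_quadratic_form[where c = "\<lambda>i. cnj (c i)" and I = "{..<n}" and A = "{..<n}" and g = v]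
  unfolding norm_sq_comb_def by simp

text \<open>If \<open>e\<^sub>i\<close> are eigenvectors of \<open>T\<close> with eigenvalues \<open>a\<^sub>i\<close>, this is
  \<open>\<parallel>T h\<parallel>\<^sup>2 + \<parallel>D h\<parallel>\<^sup>2 = \<parallel>h\<parallel>\<^sup>2\<close> for the defect operator \<open>D\<close> that maps \<open>e\<^sub>i\<close> to \<open>x\<^sub>i\<close>.\<close>

lemma norm_sq_comb_defect:
  assumes "\<And>i j. i < n \<Longrightarrow> j < n \<Longrightarrow>
      (\<Sum>l<n. x i l * cnj (x j l)) = (1 - a i * cnj (a j)) * (\<Sum>l<n. e i l * cnj (e j l))"
  shows "norm_sq_comb n e (\<lambda>i. a i * c i) + norm_sq_comb n x c = norm_sq_comb n e c"
proof -
  have "complex_of_real (norm_sq_comb n e (\<lambda>i. a i * c i) + norm_sq_comb n x c)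
      = (\<Sum>i<n. \<Sum>j<n. (a i * c i) * (\<Sum>l<n. e i l * cnj (e j l)) * cnj (a j * c j)
           + c i * (\<Sum>l<n. x i l * cnj (x j l)) * cnj (c j))"
    unfolding of_real_add norm_sq_comb_gram by (simp only: sum.distrib)
  also have "\<dots> = (\<Sum>i<n. \<Sum>j<n. c i * (\<Sum>l<n. e i l * cnj (e j l)) * cnj (c j))"
  proof (intro sum.cong refl)
    fix i j assume "i \<in> {..<n}" "j \<in> {..<n}"
    then have *: "(\<Sum>l<n. x i l * cnj (x j l)) = (1 - a i * cnj (a j)) * (\<Sum>l<n. e i l * cnj (e j l))"
      using assms by simp
    show "(a i * c i) * (\<Sum>l<n. e i l * cnj (e j l)) * cnj (a j * c j)
           + c i * (\<Sum>l<n. x i l * cnj (x j l)) * cnj (c j)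
        = c i * (\<Sum>l<n. e i l * cnj (e j l)) * cnj (c j)"
      unfolding * by (simp add: ring_distribs mult_ac)
  qed
  also have "\<dots> = complex_of_real (norm_sq_comb n e c)" by (rule norm_sq_comb_gram[symmetric])
  finally show ?thesis by (simp only: of_real_eq_iff)
qed

text \<open>A state is a vector \<open>h\<close> of the original space followed by a sequence of blocks. The vector is stored in row
  \<open>0\<close> through its coefficients with respect to the eigenvectors; row \<open>Suc j\<close> is the \<open>j\<close>-th block. The
  Boolean index separates the two halves of a block: the half \<open>True\<close> receives the defect of the second contraction, the
  half \<open>False\<close> that of the first.\<close>

type_synonym block = "bool \<times> nat \<Rightarrow> complex"
type_synonym state = "nat \<times> bool \<times> nat \<Rightarrow> complex"

definition mix :: "block \<Rightarrow> block \<Rightarrow> block" where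
  "mix u v = (\<lambda>l. if fst l then u l else v l)"

lemma mix_linear: "mix (\<lambda>l. u l + c * u' l) (\<lambda>l. v l + c * v' l) = (\<lambda>l. mix u v l + c * mix u' v' l)"
  by (simp add: mix_def fun_eq_iff)

lemma mix_mix: "mix (mix u v) w = mix u w" "mix u (mix v w) = mix u w" "mix u u = u"
  by (simp_all add: mix_def fun_eq_iff)

definition row :: "state \<Rightarrow> nat \<Rightarrow> block" where "row s r = (\<lambda>l. s (r, l))"

definition head :: "state \<Rightarrow> nat \<Rightarrow> complex" where "head s = (\<lambda>i. s (0, False, i))"

lemma row_linear: "row (\<lambda>l. s l + c * t l) r = (\<lambda>l. row s r l + c * row t r l)"
  by (simp add: row_def)

lemma head_linear: "head (\<lambda>l. s l + c * t l) = (\<lambda>l. head s l + c * head t l)"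
  by (simp add: head_def)

definition block_comb :: "bool \<Rightarrow> nat \<Rightarrow> (nat \<Rightarrow> nat \<Rightarrow> complex) \<Rightarrow> (nat \<Rightarrow> complex) \<Rightarrow> block" where
  "block_comb t n v c = (\<lambda>l. if fst l = t \<and> snd l < n then (\<Sum>i<n. c i * v i (snd l)) else 0)"

lemma block_comb_linear:
  "block_comb t n v (\<lambda>l. c l + z * c' l) = (\<lambda>l. block_comb t n v c l + z * block_comb t n v c' l)"
  by (simp add: block_comb_def fun_eq_iff distrib_right sum.distrib sum_distrib_left mult.assoc)

definition half_norm_sq :: "bool \<Rightarrow> nat \<Rightarrow> block \<Rightarrow> real" where
  "half_norm_sq t n u = (\<Sum>l<n. (cmod (u (t, l)))\<^sup>2)"

abbreviation "block_norm_sq n u \<equiv> half_norm_sq True n u + half_norm_sq False n u"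

lemma half_norm_sq_mix [simp]:
  "half_norm_sq True n (mix u v) = half_norm_sq True n u"
  "half_norm_sq False n (mix u v) = half_norm_sq False n v"
  by (simp_all add: half_norm_sq_def mix_def)

lemma half_norm_sq_block_comb: "half_norm_sq t n (block_comb t n v c) = norm_sq_comb n v c"
  by (simp add: half_norm_sq_def block_comb_def norm_sq_comb_def)

lemma half_norm_sq_zero [simp]: "half_norm_sq t n (\<lambda>_. 0) = 0"
  by (simp add: half_norm_sq_def)

lemma half_norm_sq_nonneg: "half_norm_sq t n u \<ge> 0"
  by (simp add: half_norm_sq_def sum_nonneg)

lemma cinner_block: "cinner (UNIV \<times> {..<n}) u v
    = (\<Sum>l<n. u (True, l) * cnj (v (True, l))) + (\<Sum>l<n. u (False, l) * cnj (v (False, l)))"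
proof -
  have "cinner (UNIV \<times> {..<n}) u v = (\<Sum>t\<in>UNIV. \<Sum>l<n. u (t, l) * cnj (v (t, l)))"
    unfolding cinner_def by (simp only: sum.cartesian_product split_def prod.collapse)
  then show ?thesis by (simp add: UNIV_bool add.commute)
qed

lemma block_norm_sq_eq: "complex_of_real (block_norm_sq n u) = cinner (UNIV \<times> {..<n}) u u"
  unfolding cinner_block half_norm_sq_def of_real_add of_real_sum cmod_power2_eq_mult_cnj ..

lemma block_norm_sq_unitary:
  assumes "unitary_pair (UNIV \<times> {..<n}) W B"
  shows "block_norm_sq n (W u) = block_norm_sq n u"
proof -
  have "complex_of_real (block_norm_sq n (W u)) = complex_of_real (block_norm_sq n u)"
    unfolding block_norm_sq_eq by (rule unitary_pairD(5)[OF assms])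
  then show ?thesis by (simp only: of_real_eq_iff)
qed

lemma unitary_pair_swap: "unitary_pair A W B \<Longrightarrow> unitary_pair A B W"
  unfolding unitary_pair_def[of A B W] by (intro conjI allI unitary_pairD)

text \<open>The contractions are \<open>T\<^sub>1 e\<^sub>i = a\<^sub>i e\<^sub>i\<close> and \<open>T\<^sub>2 e\<^sub>i = b\<^sub>i e\<^sub>i\<close>, with defects \<open>x\<close> and \<open>y\<close>. The unitary
  \<open>W\<close> exists because both orders of applying \<open>T\<^sub>1\<close> and \<open>T\<^sub>2\<close> lose the same energy:
  \<open>\<parallel>D\<^sub>2 h\<parallel>\<^sup>2 + \<parallel>D\<^sub>1 T\<^sub>2 h\<parallel>\<^sup>2 = \<parallel>h\<parallel>\<^sup>2 - \<parallel>T\<^sub>1 T\<^sub>2 h\<parallel>\<^sup>2 = \<parallel>D\<^sub>2 T\<^sub>1 h\<parallel>\<^sup>2 + \<parallel>D\<^sub>1 h\<parallel>\<^sup>2\<close>.\<close>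

locale commuting_contractions =
  fixes n :: nat and a b :: "nat \<Rightarrow> complex" and e x y :: "nat \<Rightarrow> nat \<Rightarrow> complex"
    and W B :: "block \<Rightarrow> block"
  assumes defect_a: "\<And>i j. i < n \<Longrightarrow> j < n \<Longrightarrow>
      (\<Sum>l<n. x i l * cnj (x j l)) = (1 - a i * cnj (a j)) * (\<Sum>l<n. e i l * cnj (e j l))"
    and defect_b: "\<And>i j. i < n \<Longrightarrow> j < n \<Longrightarrow>
      (\<Sum>l<n. y i l * cnj (y j l)) = (1 - b i * cnj (b j)) * (\<Sum>l<n. e i l * cnj (e j l))"
    and unitary: "unitary_pair (UNIV \<times> {..<n}) W B"
    and W_defect: "\<And>c. W (mix (block_comb True n y c) (block_comb False n x (\<lambda>i. b i * c i)))
        = mix (block_comb True n y (\<lambda>i. a i * c i)) (block_comb False n x c)"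
begin

text \<open>Each of the two isometries shifts its own half of the blocks and feeds in its own defect. They would
  commute except for the first block, where the defects arrive in the two orders; \<open>W\<close>, applied on
  one side, and its inverse \<open>B\<close>, applied on the other, correct this.\<close>

definition V1 :: "state \<Rightarrow> state" where
  "V1 s = (\<lambda>(r, l). case r of 0 \<Rightarrow> a (snd l) * s (0, l)
     | Suc j \<Rightarrow> W (mix (row s (Suc j)) (if j = 0 then block_comb False n x (head s) else row s j)) l)"

definition V2 :: "state \<Rightarrow> state" where
  "V2 s = (\<lambda>(r, l). case r of 0 \<Rightarrow> b (snd l) * s (0, l)
     | Suc j \<Rightarrow> mix (if j = 0 then block_comb True n y (head s) else B (row s j)) (B (row s (Suc j))) l)"

lemma row_V1: "row (V1 s) (Suc j)
    = W (mix (row s (Suc j)) (if j = 0 then block_comb False n x (head s) else row s j))"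
  by (simp add: V1_def row_def[of "\<lambda>(r, l). _ r l"])

lemma row_V2: "row (V2 s) (Suc j)
    = mix (if j = 0 then block_comb True n y (head s) else B (row s j)) (B (row s (Suc j)))"
  by (simp add: V2_def row_def[of "\<lambda>(r, l). _ r l"])

lemma head_V1: "head (V1 s) = (\<lambda>i. a i * head s i)" by (simp add: head_def V1_def)
lemma head_V2: "head (V2 s) = (\<lambda>i. b i * head s i)" by (simp add: head_def V2_def)

lemma row_0_V1: "row (V1 s) 0 = (\<lambda>l. a (snd l) * row s 0 l)" by (simp add: row_def V1_def)
lemma row_0_V2: "row (V2 s) 0 = (\<lambda>l. b (snd l) * row s 0 l)" by (simp add: row_def V2_def)

lemma state_eqI: "(\<And>r. row s r = row t r) \<Longrightarrow> s = t"
  by (auto simp: row_def fun_eq_iff)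

lemmas W_linear = clinear_mapD[OF unitary_pairD(1)[OF unitary]]
lemmas B_linear = clinear_mapD[OF unitary_pairD(2)[OF unitary]]

lemma V1_linear: "clinear_map V1"
proof (rule clinear_mapI, rule state_eqI)
  fix s t :: state and c r
  show "row (V1 (\<lambda>l. s l + c * t l)) r = row (\<lambda>l. V1 s l + c * V1 t l) r"
  proof (cases r)
    case 0
    then show ?thesis by (simp add: row_linear row_0_V1 algebra_simps)
  next
    case (Suc j)
    have "(if j = 0 then block_comb False n x (head (\<lambda>l. s l + c * t l)) else row (\<lambda>l. s l + c * t l) j)
       = (\<lambda>l. (if j = 0 then block_comb False n x (head s) else row s j) l
            + c * (if j = 0 then block_comb False n x (head t) else row t j) l)"
      by (simp add: row_linear head_linear block_comb_linear)
    then show ?thesis unfolding Suc row_linear row_V1 by (simp only: mix_linear W_linear)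
  qed
qed

lemma V2_linear: "clinear_map V2"
proof (rule clinear_mapI, rule state_eqI)
  fix s t :: state and c r
  show "row (V2 (\<lambda>l. s l + c * t l)) r = row (\<lambda>l. V2 s l + c * V2 t l) r"
  proof (cases r)
    case 0
    then show ?thesis by (simp add: row_linear row_0_V2 algebra_simps)
  next
    case (Suc j)
    have "(if j = 0 then block_comb True n y (head (\<lambda>l. s l + c * t l)) else B (row (\<lambda>l. s l + c * t l) j))
       = (\<lambda>l. (if j = 0 then block_comb True n y (head s) else B (row s j)) l
            + c * (if j = 0 then block_comb True n y (head t) else B (row t j)) l)"
      by (simp add: row_linear head_linear block_comb_linear B_linear)
    then show ?thesis unfolding Suc row_linear row_V2 by (simp only: mix_linear B_linear)
  qed
qed

lemma V_commute: "V1 (V2 s) = V2 (V1 s)"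
proof (rule state_eqI)
  fix r
  show "row (V1 (V2 s)) r = row (V2 (V1 s)) r"
  proof (cases r)
    case 0
    then show ?thesis by (simp add: row_0_V1 row_0_V2 mult_ac)
  next
    case (Suc j)
    show ?thesis
    proof (cases j)
      case 0
      show ?thesis unfolding Suc row_V1 row_V2 0 head_V1 head_V2
        by (simp add: mix_mix W_defect unitary_pairD(4)[OF unitary])
    next
      case (Suc i)
      show ?thesis unfolding \<open>r = Suc j\<close> row_V1 row_V2 Suc
        by (simp add: mix_mix row_V1 row_V2 unitary_pairD(3,4)[OF unitary])
    qed
  qed
qed

definition state_norm_sq :: "nat \<Rightarrow> state \<Rightarrow> real" where
  "state_norm_sq L s = norm_sq_comb n e (head s) + (\<Sum>j<L. block_norm_sq n (row s (Suc j)))"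

definition supported :: "nat \<Rightarrow> state \<Rightarrow> bool" where
  "supported m s \<longleftrightarrow> (\<forall>r>m. row s r = (\<lambda>_. 0))"

lemma supported_mono: "supported m s \<Longrightarrow> m \<le> m' \<Longrightarrow> supported m' s"
  unfolding supported_def by simp

lemma supported_V1: assumes "supported m s" shows "supported (Suc m) (V1 s)"
  unfolding supported_def
proof (intro allI impI)
  fix r assume r: "Suc m < r"
  then obtain j where j: "r = Suc j" "m < j" "j \<noteq> 0" by (cases r) auto
  have "row s (Suc j) = (\<lambda>_. 0)" "row s j = (\<lambda>_. 0)"
    using assms j unfolding supported_def by auto
  moreover have "mix (\<lambda>_. 0) (\<lambda>_. 0) = (\<lambda>_. 0)" by (simp add: mix_def)
  ultimately show "row (V1 s) r = (\<lambda>_. 0)"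
    unfolding j row_V1 using j by (simp add: clinear_map_zero[OF unitary_pairD(1)[OF unitary]])
qed

lemma supported_V2: assumes "supported m s" shows "supported (Suc m) (V2 s)"
  unfolding supported_def
proof (intro allI impI)
  fix r assume r: "Suc m < r"
  then obtain j where j: "r = Suc j" "m < j" "j \<noteq> 0" by (cases r) auto
  have "row s (Suc j) = (\<lambda>_. 0)" "row s j = (\<lambda>_. 0)"
    using assms j unfolding supported_def by auto
  moreover have "mix (\<lambda>_. 0) (\<lambda>_. 0) = (\<lambda>_. 0)" by (simp add: mix_def)
  ultimately show "row (V2 s) r = (\<lambda>_. 0)"
    unfolding j row_V2 using j by (simp add: clinear_map_zero[OF unitary_pairD(2)[OF unitary]])
qed

lemma sum_shift_rows:
  fixes f :: "nat \<Rightarrow> real"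
  shows "(\<Sum>j<Suc L. if j = 0 then z else f j) + f (Suc L) = z + (\<Sum>j<Suc L. f (Suc j))"
  by (subst sum.lessThan_Suc_shift) simp

text \<open>The energy lost by the contraction is what enters the first block. Only \<open>L + 1\<close> blocks are counted; the last one
  has to be empty, so that nothing is shifted out of sight.\<close>

lemma state_norm_sq_V1:
  assumes "supported L s"
  shows "state_norm_sq (Suc L) (V1 s) = state_norm_sq (Suc L) s"
proof -
  have top: "half_norm_sq False n (row s (Suc L)) = 0"
    using assms unfolding supported_def by simp
  have "block_norm_sq n (row (V1 s) (Suc j)) = half_norm_sq True n (row s (Suc j))
     + (if j = 0 then norm_sq_comb n x (head s) else half_norm_sq False n (row s j))" for j
    unfolding row_V1 block_norm_sq_unitary[OF unitary] by (simp add: half_norm_sq_block_comb)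
  then have "state_norm_sq (Suc L) (V1 s) = norm_sq_comb n e (\<lambda>i. a i * head s i)
     + (\<Sum>j<Suc L. half_norm_sq True n (row s (Suc j)))
     + (\<Sum>j<Suc L. if j = 0 then norm_sq_comb n x (head s) else half_norm_sq False n (row s j))"
    unfolding state_norm_sq_def head_V1 by (simp only: sum.distrib add.assoc)
  also have "(\<Sum>j<Suc L. if j = 0 then norm_sq_comb n x (head s) else half_norm_sq False n (row s j))
     = norm_sq_comb n x (head s) + (\<Sum>j<Suc L. half_norm_sq False n (row s (Suc j)))"
    using sum_shift_rows[where L = L and z = "norm_sq_comb n x (head s)" and f = "\<lambda>j. half_norm_sq False n (row s j)"] top by simp
  finally show ?thesis
    using norm_sq_comb_defect[of n x a e "head s", OF defect_a]
    unfolding state_norm_sq_def sum.distrib by simp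
qed

lemma state_norm_sq_V2:
  assumes "supported L s"
  shows "state_norm_sq (Suc L) (V2 s) = state_norm_sq (Suc L) s"
proof -
  have BB: "block_norm_sq n (B u) = block_norm_sq n u" for u
    by (rule block_norm_sq_unitary[OF unitary_pair_swap[OF unitary]])
  have "row s (Suc L) = (\<lambda>_. 0)" using assms unfolding supported_def by simp
  then have top: "half_norm_sq True n (B (row s (Suc L))) = 0"
    by (simp add: clinear_map_zero[OF unitary_pairD(2)[OF unitary]])
  have "block_norm_sq n (row (V2 s) (Suc j)) =
     (if j = 0 then norm_sq_comb n y (head s) else half_norm_sq True n (B (row s j)))
      + half_norm_sq False n (B (row s (Suc j)))" for j
    unfolding row_V2 by (simp add: half_norm_sq_block_comb)
  then have "state_norm_sq (Suc L) (V2 s) = norm_sq_comb n e (\<lambda>i. b i * head s i)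
     + (\<Sum>j<Suc L. if j = 0 then norm_sq_comb n y (head s) else half_norm_sq True n (B (row s j)))
     + (\<Sum>j<Suc L. half_norm_sq False n (B (row s (Suc j))))"
    unfolding state_norm_sq_def head_V2 by (simp only: sum.distrib add.assoc)
  also have "(\<Sum>j<Suc L. if j = 0 then norm_sq_comb n y (head s) else half_norm_sq True n (B (row s j)))
     = norm_sq_comb n y (head s) + (\<Sum>j<Suc L. half_norm_sq True n (B (row s (Suc j))))"
    using sum_shift_rows[where L = L and z = "norm_sq_comb n y (head s)" and f = "\<lambda>j. half_norm_sq True n (B (row s j))"] top by simp
  also have "norm_sq_comb n e (\<lambda>i. b i * head s i)
     + (norm_sq_comb n y (head s) + (\<Sum>j<Suc L. half_norm_sq True n (B (row s (Suc j)))))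
     + (\<Sum>j<Suc L. half_norm_sq False n (B (row s (Suc j))))
     = norm_sq_comb n e (head s) + (\<Sum>j<Suc L. block_norm_sq n (B (row s (Suc j))))"
    using norm_sq_comb_defect[of n y b e "head s", OF defect_b] by (simp add: sum.distrib)
  finally show ?thesis unfolding state_norm_sq_def BB .
qed

definition orbit :: "nat \<Rightarrow> nat \<Rightarrow> state \<Rightarrow> state" where
  "orbit g h s = (V1 ^^ g) ((V2 ^^ h) s)"

lemma V2_V1_funpow: "V2 ((V1 ^^ g) s) = (V1 ^^ g) (V2 s)"
  by (induction g) (simp_all add: V_commute[symmetric])

lemma V2_funpow_V1_funpow: "(V2 ^^ h) ((V1 ^^ g) s) = (V1 ^^ g) ((V2 ^^ h) s)"
  by (induction h) (simp_all add: V2_V1_funpow)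

lemma orbit_orbit: "orbit g h (orbit k l s) = orbit (g + k) (h + l) s"
  unfolding orbit_def by (simp add: funpow_add V2_funpow_V1_funpow)

lemma funpow_linear:
  fixes T :: "state \<Rightarrow> state"
  assumes "clinear_map T" shows "clinear_map (T ^^ g)"
proof (induction g)
  case 0
  show ?case by (rule clinear_mapI) (simp only: funpow.simps id_apply)
next
  case (Suc g)
  have "clinear_map (\<lambda>u. T ((T ^^ g) u))" by (rule clinear_map_comp[OF assms Suc])
  then show ?case by (simp add: comp_def)
qed

lemma orbit_linear: "clinear_map (orbit g h)"
proof -
  have "clinear_map (\<lambda>u. (V1 ^^ g) ((V2 ^^ h) u))"
    by (rule clinear_map_comp[OF funpow_linear[OF V1_linear] funpow_linear[OF V2_linear]])
  then show ?thesis by (simp add: orbit_def[abs_def])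
qed

lemma supported_orbit:
  assumes "supported m s" shows "supported (m + g + h) (orbit g h s)"
proof -
  have "supported (m + h) ((V2 ^^ h) s)" by (induction h) (use assms supported_V2 in auto)
  then show ?thesis unfolding orbit_def
    by (induction g) (use supported_V1 in \<open>auto simp: add_ac\<close>)
qed

lemma state_norm_sq_orbit:
  assumes "supported m s" "m + g + h \<le> L"
  shows "state_norm_sq (Suc L) (orbit g h s) = state_norm_sq (Suc L) s"
  using assms(2)
proof (induction g)
  case 0
  then show ?case
  proof (induction h)
    case (Suc h)
    have "supported (m + 0 + h) (orbit 0 h s)" by (rule supported_orbit[OF assms(1)])
    then have "supported L (orbit 0 h s)" by (rule supported_mono) (use Suc.prems in simp)
    then show ?case using Suc state_norm_sq_V2[of L "orbit 0 h s"] by (simp add: orbit_def)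
  qed (simp add: orbit_def)
next
  case (Suc g)
  have "supported (m + g + h) (orbit g h s)" by (rule supported_orbit[OF assms(1)])
  then have "supported L (orbit g h s)" by (rule supported_mono) (use Suc.prems in simp)
  then show ?case using Suc state_norm_sq_V1[of L "orbit g h s"] by (simp add: orbit_def)
qed

lemma head_orbit: "head (orbit g h s) = (\<lambda>i. a i ^ g * b i ^ h * head s i)"
proof -
  have "head ((V2 ^^ h) s) = (\<lambda>i. b i ^ h * head s i)"
    by (induction h) (simp_all add: head_V2 mult_ac)
  then show ?thesis unfolding orbit_def
    by (induction g) (simp_all add: head_V1 mult_ac)
qed

definition initial :: "(nat \<Rightarrow> complex) \<Rightarrow> state" where
  "initial c = (\<lambda>(r, t, i). if r = 0 then c i else 0)"

lemma head_initial: "head (initial c) = c" by (simp add: head_def initial_def)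
lemma supported_initial: "supported 0 (initial c)" by (auto simp: supported_def row_def initial_def)

definition poly_orbit :: "nat \<Rightarrow> (nat \<Rightarrow> nat \<Rightarrow> complex) \<Rightarrow> state \<Rightarrow> state" where
  "poly_orbit N p s = (\<lambda>i. \<Sum>k<N. \<Sum>l<N. p k l * orbit k l s i)"

lemma orbit_poly_orbit:
  "orbit g h (poly_orbit N p s) = (\<lambda>i. \<Sum>k<N. \<Sum>l<N. p k l * orbit (g + k) (h + l) s i)"
proof -
  have "poly_orbit N p s = (\<lambda>i. \<Sum>kl\<in>{..<N} \<times> {..<N}. p (fst kl) (snd kl) * orbit (fst kl) (snd kl) s i)"
    unfolding poly_orbit_def by (simp add: sum.cartesian_product split_def)
  then have "orbit g h (poly_orbit N p s)
      = (\<lambda>i. \<Sum>kl\<in>{..<N} \<times> {..<N}. p (fst kl) (snd kl) * orbit g h (orbit (fst kl) (snd kl) s) i)"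
    by (simp only: clinear_map_sum[OF orbit_linear])
  then show ?thesis unfolding orbit_orbit by (simp add: sum.cartesian_product split_def)
qed

lemma supported_poly_orbit:
  assumes "supported m s" shows "supported (m + 2 * N) (poly_orbit N p s)"
  unfolding supported_def
proof (intro allI impI)
  fix r assume r: "m + 2 * N < r"
  have "orbit k l s (r, i) = 0" if "k < N" "l < N" for k l i
  proof -
    have "row (orbit k l s) r = (\<lambda>_. 0)"
      using supported_orbit[OF assms, of k l] that r unfolding supported_def by simp
    then show ?thesis unfolding row_def by (rule fun_cong)
  qed
  then show "row (poly_orbit N p s) r = (\<lambda>_. 0)"
    by (simp add: row_def poly_orbit_def)
qed

lemma state_norm_sq_correlation:
  assumes bound: "\<And>z w. cmod z = 1 \<Longrightarrow> cmod w = 1 \<Longrightarrow> cmod (poly2 N p z w) \<le> M"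
  shows "(\<Sum>g<K. \<Sum>h<K. state_norm_sq L (orbit g h (poly_orbit N p s)))
     \<le> M\<^sup>2 * (\<Sum>g<K + N. \<Sum>h<K + N. state_norm_sq L (orbit g h s))"
proof -
  define f where "f = (\<lambda>(r, t, l) u. if r = 0 then \<Sum>i<n. head u i * e i l else row u r (t, l))"
  define \<K> where "\<K> = ({0} \<times> {True} \<times> {..<n}) \<union> ({1..L} \<times> UNIV \<times> {..<n})"
  have fin: "finite \<K>" by (simp add: \<K>_def)
  have norm: "state_norm_sq L u = (\<Sum>\<kappa>\<in>\<K>. (cmod (f \<kappa> u))\<^sup>2)" for u
  proof -
    have "(\<Sum>\<kappa>\<in>\<K>. (cmod (f \<kappa> u))\<^sup>2) = (\<Sum>\<kappa>\<in>{0} \<times> {True} \<times> {..<n}. (cmod (f \<kappa> u))\<^sup>2)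
        + (\<Sum>\<kappa>\<in>{1..L} \<times> UNIV \<times> {..<n}. (cmod (f \<kappa> u))\<^sup>2)"
      unfolding \<K>_def by (rule sum.union_disjoint) auto
    also have "(\<Sum>\<kappa>\<in>{0} \<times> {True} \<times> {..<n}. (cmod (f \<kappa> u))\<^sup>2) = norm_sq_comb n e (head u)"
      unfolding norm_sq_comb_def
      by (rule sum.reindex_bij_witness[where i = "\<lambda>l. (0, True, l)" and j = "\<lambda>\<kappa>. snd (snd \<kappa>)"])
        (auto simp: f_def)
    also have "(\<Sum>\<kappa>\<in>{1..L} \<times> UNIV \<times> {..<n}. (cmod (f \<kappa> u))\<^sup>2)
        = (\<Sum>r\<in>{1..L}. \<Sum>t\<in>UNIV. \<Sum>l<n. (cmod (f (r, t, l) u))\<^sup>2)"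
      by (simp only: sum.cartesian_product split_def prod.collapse)
    also have "\<dots> = (\<Sum>r\<in>{1..L}. block_norm_sq n (row u r))"
      by (intro sum.cong refl) (simp add: f_def UNIV_bool half_norm_sq_def add.commute)
    also have "\<dots> = (\<Sum>j<L. block_norm_sq n (row u (Suc j)))"
      by (rule sum.reindex_bij_witness[where i = Suc and j = "\<lambda>r. r - 1"]) auto
    finally show ?thesis by (simp add: state_norm_sq_def)
  qed
  have f_sum: "f \<kappa> (orbit g h (poly_orbit N p s)) = (\<Sum>k<N. \<Sum>l<N. p k l * f \<kappa> (orbit (g + k) (h + l) s))"
    for \<kappa> g h
  proof (cases \<kappa>)
    case (fields r t m)
    show ?thesis
    proof (cases "r = 0")
      case True
      have "f \<kappa> (orbit g h (poly_orbit N p s))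
          = (\<Sum>i<n. \<Sum>k<N. \<Sum>l<N. p k l * (head (orbit (g + k) (h + l) s) i * e i m))"
        unfolding fields True f_def orbit_poly_orbit by (simp add: head_def sum_distrib_right mult.assoc)
      also have "\<dots> = (\<Sum>k<N. \<Sum>i<n. \<Sum>l<N. p k l * (head (orbit (g + k) (h + l) s) i * e i m))"
        by (rule sum.swap)
      also have "\<dots> = (\<Sum>k<N. \<Sum>l<N. \<Sum>i<n. p k l * (head (orbit (g + k) (h + l) s) i * e i m))"
        by (intro sum.cong[OF refl] sum.swap)
      also have "\<dots> = (\<Sum>k<N. \<Sum>l<N. p k l * f \<kappa> (orbit (g + k) (h + l) s))"
        unfolding fields True f_def by (simp add: sum_distrib_left)
      finally show ?thesis .
    next
      case False
      then show ?thesis unfolding fields f_def orbit_poly_orbit by (simp add: row_def)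
    qed
  qed
  have "(\<Sum>g<K. \<Sum>h<K. state_norm_sq L (orbit g h (poly_orbit N p s)))
      = (\<Sum>\<kappa>\<in>\<K>. \<Sum>g<K. \<Sum>h<K. (cmod (f \<kappa> (orbit g h (poly_orbit N p s))))\<^sup>2)"
    unfolding norm by (simp only: sum.swap[of _ \<K>])
  also have "\<dots> \<le> (\<Sum>\<kappa>\<in>\<K>. M\<^sup>2 * (\<Sum>g<K + N. \<Sum>h<K + N. (cmod (f \<kappa> (orbit g h s)))\<^sup>2))"
    unfolding f_sum
    by (rule sum_mono, rule correlation_bound[OF bound order_refl, where x = "\<lambda>g h. f _ (orbit g h s)"])
  also have "\<dots> = M\<^sup>2 * (\<Sum>g<K + N. \<Sum>h<K + N. state_norm_sq L (orbit g h s))"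
    unfolding norm sum_distrib_left[symmetric] by (simp only: sum.swap[of _ \<K>])
  finally show ?thesis .
qed

text \<open>For isometries, applying a polynomial commutes with the motion along the orbit and keeps the norm, so the
  correlation bound reads \<open>K\<^sup>2 \<parallel>p(V) h\<parallel>\<^sup>2 \<le> (K + N)\<^sup>2 M\<^sup>2 \<parallel>h\<parallel>\<^sup>2\<close>. Dividing by \<open>K\<^sup>2\<close> and letting \<open>K\<close> grow
  removes the boundary effect. The original space sees only a part of \<open>p(V) h\<close>, namely \<open>p(T) h\<close>.\<close>

lemma poly2_contractive:
  assumes bound: "\<And>z w. cmod z = 1 \<Longrightarrow> cmod w = 1 \<Longrightarrow> cmod (poly2 N p z w) \<le> M"
  shows "norm_sq_comb n e (\<lambda>i. poly2 N p (a i) (b i) * c i) \<le> M\<^sup>2 * norm_sq_comb n e c"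
proof (rule le_of_rescaled_le)
  fix K :: nat
  let ?s = "initial c"
  let ?y = "poly_orbit N p ?s"
  (* Enough blocks for every step of the orbit of the starting vector and of its polynomial. *)
  define L where "L = 2 * K + 2 * N"
  have supp: "supported 0 ?s" "supported (2 * N) ?y"
    using supported_initial supported_poly_orbit[OF supported_initial, of N p c] by auto
  have head_y: "head ?y = (\<lambda>i. poly2 N p (a i) (b i) * c i)"
  proof -
    have "head ?y i = (\<Sum>k<N. \<Sum>l<N. p k l * head (orbit k l ?s) i)" for i
      by (simp add: poly_orbit_def head_def)
    then show ?thesis
      unfolding head_orbit head_initial by (simp add: poly2_def sum_distrib_right mult.assoc fun_eq_iff)
  qed
  have "norm_sq_comb n e (\<lambda>i. poly2 N p (a i) (b i) * c i) \<le> state_norm_sq (Suc L) ?y"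
    unfolding state_norm_sq_def head_y by (simp add: sum_nonneg half_norm_sq_nonneg)
  then have "(real K)\<^sup>2 * norm_sq_comb n e (\<lambda>i. poly2 N p (a i) (b i) * c i)
      \<le> (real K)\<^sup>2 * state_norm_sq (Suc L) ?y"
    by (intro mult_left_mono) auto
  also have "\<dots> = (\<Sum>g<K. \<Sum>h<K. state_norm_sq (Suc L) (orbit g h ?y))"
  proof -
    have "state_norm_sq (Suc L) (orbit g h ?y) = state_norm_sq (Suc L) ?y" if "g < K" "h < K" for g h
      by (rule state_norm_sq_orbit[OF supp(2)]) (use that in \<open>simp add: L_def\<close>)
    then show ?thesis by (simp add: power2_eq_square)
  qed
  also have "\<dots> \<le> M\<^sup>2 * (\<Sum>g<K + N. \<Sum>h<K + N. state_norm_sq (Suc L) (orbit g h ?s))"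
    by (rule state_norm_sq_correlation[OF bound])
  also have "(\<Sum>g<K + N. \<Sum>h<K + N. state_norm_sq (Suc L) (orbit g h ?s))
      = (real (K + N))\<^sup>2 * state_norm_sq (Suc L) ?s"
  proof -
    have "state_norm_sq (Suc L) (orbit g h ?s) = state_norm_sq (Suc L) ?s" if "g < K + N" "h < K + N" for g h
      by (rule state_norm_sq_orbit[OF supp(1)]) (use that in \<open>simp add: L_def\<close>)
    then show ?thesis by (simp add: power2_eq_square)
  qed
  also have "state_norm_sq (Suc L) ?s = norm_sq_comb n e c"
    using supp(1) unfolding state_norm_sq_def head_initial supported_def by simp
  finally show "(real K)\<^sup>2 * norm_sq_comb n e (\<lambda>i. poly2 N p (a i) (b i) * c i)
      \<le> (real (K + N))\<^sup>2 * (M\<^sup>2 * norm_sq_comb n e c)"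
    by (simp only: mult.left_commute)
qed

end

lemma ando_von_neumann:
  assumes k: "psd_matrix n k"
    and ka: "psd_matrix n (\<lambda>i j. (1 - a i * cnj (a j)) * k i j)"
    and kb: "psd_matrix n (\<lambda>i j. (1 - b i * cnj (b j)) * k i j)"
  shows "\<exists>e. (\<forall>i<n. \<forall>j<n. k i j = (\<Sum>l<n. e i l * cnj (e j l))) \<and>
    (\<forall>N p M c. (\<forall>z w. cmod z = 1 \<longrightarrow> cmod w = 1 \<longrightarrow> cmod (poly2 N p z w) \<le> M) \<longrightarrow>
       norm_sq_comb n e (\<lambda>i. poly2 N p (a i) (b i) * c i) \<le> M\<^sup>2 * norm_sq_comb n e c)"
proof -
  obtain e where e: "\<And>i j. i < n \<Longrightarrow> j < n \<Longrightarrow> k i j = (\<Sum>l<n. e i l * cnj (e j l))"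
    using psd_matrix_gram[OF k] by auto
  obtain x where x: "\<And>i j. i < n \<Longrightarrow> j < n \<Longrightarrow> (1 - a i * cnj (a j)) * k i j = (\<Sum>l<n. x i l * cnj (x j l))"
    using psd_matrix_gram[OF ka] by auto
  obtain y where y: "\<And>i j. i < n \<Longrightarrow> j < n \<Longrightarrow> (1 - b i * cnj (b j)) * k i j = (\<Sum>l<n. y i l * cnj (y j l))"
    using psd_matrix_gram[OF kb] by auto
  define p where "p i = (\<lambda>(t, l). if l < n then (if t then y i l else b i * x i l) else 0)" for i
  define q where "q i = (\<lambda>(t, l). if l < n then (if t then a i * y i l else x i l) else 0)" for i
  have "cinner (UNIV \<times> {..<n}) (p i) (p j) = cinner (UNIV \<times> {..<n}) (q i) (q j)" if "i < n" "j < n" for i j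
  proof -
    have "cinner (UNIV \<times> {..<n}) (p i) (p j)
        = (\<Sum>l<n. y i l * cnj (y j l)) + b i * cnj (b j) * (\<Sum>l<n. x i l * cnj (x j l))"
      unfolding cinner_block p_def by (simp add: sum_distrib_left mult_ac)
    moreover have "cinner (UNIV \<times> {..<n}) (q i) (q j)
        = a i * cnj (a j) * (\<Sum>l<n. y i l * cnj (y j l)) + (\<Sum>l<n. x i l * cnj (x j l))"
      unfolding cinner_block q_def by (simp add: sum_distrib_left mult_ac)
    ultimately show ?thesis
      unfolding x[OF that, symmetric] y[OF that, symmetric]
      by (simp add: algebra_simps) (metis add_right_cancel)
  qed
  then obtain W B where WB: "unitary_pair (UNIV \<times> {..<n}) W B" and W: "\<forall>i<n. W (p i) = q i"
    using unitary_extension[of "UNIV \<times> {..<n}" n p q] by (auto simp: p_def q_def)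
  have defect: "W (mix (block_comb True n y c) (block_comb False n x (\<lambda>i. b i * c i)))
        = mix (block_comb True n y (\<lambda>i. a i * c i)) (block_comb False n x c)" for c
  proof -
    have "mix (block_comb True n y c) (block_comb False n x (\<lambda>i. b i * c i)) = (\<lambda>l. \<Sum>i<n. c i * p i l)"
      by (auto simp: mix_def block_comb_def p_def fun_eq_iff mult_ac intro!: sum.cong)
    moreover have "mix (block_comb True n y (\<lambda>i. a i * c i)) (block_comb False n x c) = (\<lambda>l. \<Sum>i<n. c i * q i l)"
      by (auto simp: mix_def block_comb_def q_def fun_eq_iff mult_ac intro!: sum.cong)
    moreover have "(\<lambda>l. \<Sum>i<n. c i * W (p i) l) = (\<lambda>l. \<Sum>i<n. c i * q i l)"
      using W by simp
    ultimately show ?thesis by (simp only: clinear_map_sum[OF unitary_pairD(1)[OF WB]])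
  qed
  interpret commuting_contractions n a b e x y W B
    by unfold_locales (use x y e WB defect in auto)
  show ?thesis
    using e poly2_contractive by (intro exI[of _ e]) auto
qed

section \<open>Agler's theorem on the bidisc\<close>

lemma bounded_holomorphic_taylor:
  assumes holo: "h holomorphic_on ball 0 1" and bdd: "\<And>z. z \<in> ball 0 1 \<Longrightarrow> cmod (h z) \<le> 1"
  shows "\<exists>c. (\<forall>z\<in>ball 0 1. (\<lambda>m. c m * z ^ m) sums h z) \<and> (\<forall>m. cmod (c m) \<le> 1)"
proof -
  define c where "c m = (deriv ^^ m) h 0 / fact m" for m
  have "(\<lambda>m. c m * z ^ m) sums h z" if "z \<in> ball 0 1" for z
    using holomorphic_power_series[OF holo that] by (simp add: c_def)
  moreover have "cmod (c m) \<le> 1" for m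
  proof -
    have le: "r ^ m * cmod (c m) \<le> 1" if r: "0 < r" "r < 1" for r :: real
    proof -
      have sub: "cball 0 r \<subseteq> ball (0::complex) 1" using r by auto
      have "cmod ((deriv ^^ m) h 0) \<le> fact m * 1 / r ^ m"
      proof (rule Cauchy_inequality)
        show "h holomorphic_on ball 0 r" by (rule holomorphic_on_subset[OF holo]) (use r in auto)
        show "continuous_on (cball 0 r) h"
          by (rule continuous_on_subset[OF holomorphic_on_imp_continuous_on[OF holo] sub])
        show "cmod (h x) \<le> 1" if "cmod (0 - x) = r" for x
          by (rule bdd) (use that r in simp)
      qed (use r in auto)
      then show ?thesis using r by (simp add: c_def norm_divide field_simps)
    qed
    have lim: "((\<lambda>r. r ^ m * cmod (c m)) \<longlongrightarrow> 1 ^ m * cmod (c m)) (at_left (1::real))"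
      by (intro tendsto_intros)
    have "eventually (\<lambda>r. r ^ m * cmod (c m) \<le> 1) (at_left (1::real))"
      using eventually_at_left_real[of 0 1] by (rule eventually_mono) (use le in auto)
    from tendsto_upperbound[OF lim this] show ?thesis by simp
  qed
  ultimately show ?thesis by blast
qed

text \<open>The Lagrange polynomial of the node \<open>\<rho> \<omega>\<^sub>j\<close> among all \<open>\<rho>\<close>-multiples of the \<open>N\<close>-th roots of unity.\<close>

definition interp_kernel :: "real \<Rightarrow> nat \<Rightarrow> nat \<Rightarrow> complex \<Rightarrow> complex" where
  "interp_kernel \<rho> N j z = (\<Sum>k<N. (z / (of_real \<rho> * unity_root N j)) ^ k) / of_nat N"

text \<open>Aliasing: on the nodes, \<open>z\<^sup>m\<close> agrees with a multiple of \<open>z\<^sup>r\<close> where \<open>r\<close> is the residue of \<open>m\<close> modulo \<open>N\<close>.\<close>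

lemma interp_kernel_monomial:
  assumes "N > 0" "\<rho> > 0"
  shows "(\<Sum>j<N. (of_real \<rho> * unity_root N j) ^ m * interp_kernel \<rho> N j z)
       = of_real \<rho> ^ (m - m mod N) * z ^ (m mod N)"
proof -
  let ?r = "m mod N"
  have rN: "?r < N" using assms by simp
  have pow: "unity_root N j ^ m = unity_root N j ^ ?r" for j
  proof -
    have "unity_root N j ^ m = unity_root N j ^ (N * (m div N) + ?r)" by simp
    also have "\<dots> = unity_root N j ^ ?r"
      unfolding power_add power_mult unity_root_power_self[OF assms(1)] by simp
    finally show ?thesis .
  qed
  have "(\<Sum>j<N. (of_real \<rho> * unity_root N j) ^ m * interp_kernel \<rho> N j z)
     = (\<Sum>j<N. \<Sum>k<N. of_real \<rho> ^ m * (z / of_real \<rho>) ^ k / of_nat N * (unity_root N j ^ ?r * cnj (unity_root N j ^ k)))"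
    unfolding interp_kernel_def
    by (intro sum.cong[OF refl])
      (simp add: sum_distrib_left sum_divide_distrib power_mult_distrib power_divide cnj_unity_root
        power_inverse pow divide_inverse mult_ac)
  also have "\<dots> = (\<Sum>k<N. \<Sum>j<N. of_real \<rho> ^ m * (z / of_real \<rho>) ^ k / of_nat N * (unity_root N ?r ^ j * cnj (unity_root N k ^ j)))"
    by (subst sum.swap) (simp only: unity_root_swap)
  also have "\<dots> = (\<Sum>k<N. of_real \<rho> ^ m * (z / of_real \<rho>) ^ k / of_nat N * (if ?r = k then of_nat N else 0))"
    unfolding sum_distrib_left[symmetric]
    by (intro sum.cong[OF refl]) (simp only: unity_root_orthogonal[OF rN] lessThan_iff)
  also have "\<dots> = of_real \<rho> ^ m * (z / of_real \<rho>) ^ ?r"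
    using rN assms by (simp add: if_distrib[of "\<lambda>t. _ * t"] cong: if_cong)
  also have "\<dots> = of_real \<rho> ^ (m - ?r) * z ^ ?r"
  proof -
    have "of_real \<rho> ^ m = complex_of_real \<rho> ^ (m - ?r) * of_real \<rho> ^ ?r"
      by (simp flip: power_add)
    then show ?thesis using assms by (simp add: power_divide)
  qed
  finally show ?thesis .
qed

text \<open>Monomials below degree \<open>N\<close> are reproduced exactly; from degree \<open>N\<close> on, each costs at most
  \<open>2 \<rho>\<^sup>m\<close>. The bound is the same for all functions in the unit ball, which allows interpolation in one variable
  uniformly in the other.\<close>

lemma interpolation_error:
  assumes holo: "h holomorphic_on ball 0 1" and bdd: "\<And>z. z \<in> ball 0 1 \<Longrightarrow> cmod (h z) \<le> 1"
    and N: "N > 0" and \<rho>: "0 < \<rho>" "\<rho> < 1" and z: "cmod z \<le> \<rho>"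
  shows "cmod (h z - (\<Sum>j<N. h (of_real \<rho> * unity_root N j) * interp_kernel \<rho> N j z))
     \<le> 2 * \<rho> ^ N / (1 - \<rho>)"
proof -
  obtain c where c: "\<And>z. z \<in> ball 0 1 \<Longrightarrow> (\<lambda>m. c m * z ^ m) sums h z" "\<And>m. cmod (c m) \<le> 1"
    using bounded_holomorphic_taylor[OF holo bdd] by blast
  let ?D = "\<lambda>m. z ^ m - (\<Sum>j<N. (of_real \<rho> * unity_root N j) ^ m * interp_kernel \<rho> N j z)"
  have node: "of_real \<rho> * unity_root N j \<in> ball 0 1" for j using \<rho> by (simp add: norm_mult)
  have "(\<lambda>m. c m * z ^ m - (\<Sum>j<N. c m * (of_real \<rho> * unity_root N j) ^ m * interp_kernel \<rho> N j z))
      sums (h z - (\<Sum>j<N. h (of_real \<rho> * unity_root N j) * interp_kernel \<rho> N j z))"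
    using z \<rho> by (intro sums_diff sums_sum sums_mult2 c(1) node) auto
  then have sums: "(\<lambda>m. c m * ?D m) sums (h z - (\<Sum>j<N. h (of_real \<rho> * unity_root N j) * interp_kernel \<rho> N j z))"
    by (simp add: algebra_simps sum_distrib_left)
  have D0: "?D m = 0" if "m < N" for m
    unfolding interp_kernel_monomial[OF N \<rho>(1)] using that by simp
  have Dle: "cmod (c m * ?D m) \<le> 2 * \<rho> ^ m" for m
  proof -
    have "cmod (?D m) \<le> cmod (z ^ m) + cmod (of_real \<rho> ^ (m - m mod N) * z ^ (m mod N))"
      unfolding interp_kernel_monomial[OF N \<rho>(1)] by (rule norm_triangle_ineq4)
    also have "\<dots> \<le> \<rho> ^ m + \<rho> ^ (m - m mod N) * \<rho> ^ (m mod N)"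
      using z \<rho> by (intro add_mono) (auto simp: norm_power norm_mult intro!: power_mono mult_left_mono)
    also have "\<dots> = 2 * \<rho> ^ m" by (simp flip: power_add)
    finally have "cmod (?D m) \<le> 2 * \<rho> ^ m" .
    moreover have "cmod (c m) * cmod (?D m) \<le> 1 * cmod (?D m)"
      by (intro mult_right_mono c) auto
    ultimately show ?thesis unfolding norm_mult by linarith
  qed
  define E where "E m = (if m < N then 0 else 2 * \<rho> ^ m)" for m
  have "(\<lambda>m. 2 * \<rho> ^ N * \<rho> ^ m) sums (2 * \<rho> ^ N * (1 / (1 - \<rho>)))"
    using \<rho> by (intro sums_mult geometric_sums) auto
  then have "(\<lambda>m. E (m + N)) sums (2 * \<rho> ^ N * (1 / (1 - \<rho>)))"
    unfolding E_def by (simp add: power_add mult_ac)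
  then have E: "E sums (2 * \<rho> ^ N * (1 / (1 - \<rho>)))"
    unfolding sums_iff_shift by (simp add: E_def)
  have "cmod (c m * ?D m) \<le> E m" for m
    using Dle[of m] D0[of m] by (cases "m < N") (auto simp: E_def)
  then have "cmod (suminf (\<lambda>m. c m * ?D m)) \<le> suminf E"
    using E by (intro norm_suminf_le) (auto simp: sums_iff)
  then show ?thesis using sums E by (simp add: sums_iff)
qed

lemma norm_interp_kernel_le:
  assumes "N > 0" "0 < \<rho>" "r < \<rho>" "0 \<le> r" "cmod z \<le> r"
  shows "cmod (interp_kernel \<rho> N j z) \<le> (1 / (1 - r / \<rho>)) / real N"
proof -
  have q: "0 \<le> r / \<rho>" "r / \<rho> < 1" using assms by auto
  have "cmod (\<Sum>k<N. (z / (of_real \<rho> * unity_root N j)) ^ k) \<le> (\<Sum>k<N. (r / \<rho>) ^ k)"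
    using assms
    by (intro sum_norm_le) (auto simp: norm_power norm_divide norm_mult intro!: power_mono divide_right_mono)
  also have "\<dots> \<le> (\<Sum>k. (r / \<rho>) ^ k)"
    using q by (intro sum_le_suminf summable_geometric) auto
  also have "\<dots> = 1 / (1 - r / \<rho>)" using q by (intro suminf_geometric) auto
  finally show ?thesis
    unfolding interp_kernel_def norm_divide norm_of_nat by (rule divide_right_mono) simp
qed

text \<open>Interpolation in the first variable, then in the second. The dilation by \<open>r < \<rho>\<close> makes the interpolation kernels
  summable, so that the second error is not amplified by more than \<open>C\<close>.\<close>

lemma bidisc_polynomial_approximation:
  assumes holo1: "\<And>w. w \<in> ball 0 1 \<Longrightarrow> (\<lambda>z. f z w) holomorphic_on ball 0 1"
    and holo2: "\<And>z. z \<in> ball 0 1 \<Longrightarrow> (\<lambda>w. f z w) holomorphic_on ball 0 1"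
    and bdd: "\<And>z w. z \<in> ball 0 1 \<Longrightarrow> w \<in> ball 0 1 \<Longrightarrow> cmod (f z w) \<le> 1"
    and r: "0 < r" "r < 1" and \<epsilon>: "\<epsilon> > 0"
  shows "\<exists>N p. \<forall>z w. cmod z \<le> 1 \<longrightarrow> cmod w \<le> 1 \<longrightarrow>
      cmod (poly2 N p z w - f (of_real r * z) (of_real r * w)) \<le> \<epsilon>"
proof -
  define \<rho> where "\<rho> = (1 + r) / 2"
  have \<rho>: "0 < \<rho>" "\<rho> < 1" "r < \<rho>" using r by (auto simp: \<rho>_def)
  define C where "C = 1 / (1 - r / \<rho>)"
  have C: "C > 0" using \<rho> by (simp add: C_def)
  have "(\<lambda>N. 2 * \<rho> ^ N / (1 - \<rho>) * (1 + C)) \<longlonglongrightarrow> 2 * 0 / (1 - \<rho>) * (1 + C)"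
    using \<rho> by (intro tendsto_intros LIMSEQ_realpow_zero) auto
  then have "eventually (\<lambda>N. 2 * \<rho> ^ N / (1 - \<rho>) * (1 + C) < \<epsilon>) sequentially"
    using \<epsilon> by (intro order_tendstoD(2)) auto
  then have "eventually (\<lambda>N. 2 * \<rho> ^ N / (1 - \<rho>) * (1 + C) < \<epsilon> \<and> N > 0) sequentially"
    using eventually_gt_at_top[of 0] by (rule eventually_conj)
  then obtain N where N: "2 * \<rho> ^ N / (1 - \<rho>) * (1 + C) < \<epsilon>" "N > 0"
    using eventually_happens'[OF sequentially_bot] by blast
  define \<delta> where "\<delta> = 2 * \<rho> ^ N / (1 - \<rho>)"
  have \<delta>: "\<delta> \<ge> 0" using \<rho> by (simp add: \<delta>_def)
  let ?u = "\<lambda>j. of_real \<rho> * unity_root N j"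
  have node: "?u j \<in> ball 0 1" for j using \<rho> by (simp add: norm_mult)
  define p where "p k l = (\<Sum>j<N. \<Sum>i<N. f (?u j) (?u i) * (of_real r / ?u j) ^ k / of_nat N * (of_real r / ?u i) ^ l / of_nat N)"
    for k l
  have poly: "poly2 N p z w
      = (\<Sum>j<N. (\<Sum>i<N. f (?u j) (?u i) * interp_kernel \<rho> N i (of_real r * w)) * interp_kernel \<rho> N j (of_real r * z))"
    for z w
  proof -
    let ?t = "\<lambda>k l j i. f (?u j) (?u i) * (of_real r * z / ?u j) ^ k / of_nat N * (of_real r * w / ?u i) ^ l / of_nat N"
    have "poly2 N p z w = (\<Sum>k<N. \<Sum>l<N. \<Sum>j<N. \<Sum>i<N. ?t k l j i)"
      unfolding poly2_def p_def
      by (simp add: sum_distrib_left sum_distrib_right power_mult_distrib power_divide mult_ac)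
    also have "\<dots> = (\<Sum>k<N. \<Sum>j<N. \<Sum>l<N. \<Sum>i<N. ?t k l j i)"
      by (intro sum.cong[OF refl] sum.swap)
    also have "\<dots> = (\<Sum>j<N. \<Sum>k<N. \<Sum>l<N. \<Sum>i<N. ?t k l j i)"
      by (rule sum.swap)
    also have "\<dots> = (\<Sum>j<N. \<Sum>k<N. \<Sum>i<N. \<Sum>l<N. ?t k l j i)"
      by (intro sum.cong[OF refl] sum.swap)
    also have "\<dots> = (\<Sum>j<N. \<Sum>i<N. \<Sum>k<N. \<Sum>l<N. ?t k l j i)"
      by (intro sum.cong[OF refl] sum.swap)
    also have "\<dots> = (\<Sum>j<N. \<Sum>i<N. \<Sum>l<N. \<Sum>k<N. ?t k l j i)"
      by (intro sum.cong[OF refl] sum.swap)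
    also have "\<dots> = (\<Sum>j<N. (\<Sum>i<N. f (?u j) (?u i) * interp_kernel \<rho> N i (of_real r * w)) * interp_kernel \<rho> N j (of_real r * z))"
      unfolding interp_kernel_def sum_distrib_right
      by (intro sum.cong[OF refl]) (simp add: sum_divide_distrib sum_distrib_left sum_distrib_right mult_ac)
    finally show ?thesis .
  qed
  have "cmod (poly2 N p z w - f (of_real r * z) (of_real r * w)) \<le> \<epsilon>" if zw: "cmod z \<le> 1" "cmod w \<le> 1" for z w
  proof -
    let ?z = "of_real r * z" and ?w = "of_real r * w"
    have le_r: "cmod ?z \<le> r" "cmod ?w \<le> r" using zw r by (auto simp: norm_mult)
    then have in_ball: "?z \<in> ball 0 1" "?w \<in> ball 0 1" and le_\<rho>: "cmod ?z \<le> \<rho>" "cmod ?w \<le> \<rho>"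
      using r \<rho> by auto
    define I where "I = (\<Sum>j<N. f (?u j) ?w * interp_kernel \<rho> N j ?z)"
    have 1: "cmod (f ?z ?w - I) \<le> \<delta>"
      unfolding I_def \<delta>_def
      by (rule interpolation_error[OF holo1[OF in_ball(2)] bdd[OF _ in_ball(2)] N(2) \<rho>(1,2) le_\<rho>(1)])
    have "cmod (I - poly2 N p z w) = cmod (\<Sum>j<N. (f (?u j) ?w - (\<Sum>i<N. f (?u j) (?u i) * interp_kernel \<rho> N i ?w)) * interp_kernel \<rho> N j ?z)"
      unfolding I_def poly by (simp only: left_diff_distrib sum_subtractf)
    also have "\<dots> \<le> (\<Sum>j<N. \<delta> * (C / real N))"
    proof (rule sum_norm_le)
      fix j assume "j \<in> {..<N}"
      have "cmod (f (?u j) ?w - (\<Sum>i<N. f (?u j) (?u i) * interp_kernel \<rho> N i ?w)) \<le> \<delta>"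
        unfolding \<delta>_def
        by (rule interpolation_error[OF holo2[OF node] bdd[OF node] N(2) \<rho>(1,2) le_\<rho>(2)])
      moreover have "cmod (interp_kernel \<rho> N j ?z) \<le> C / real N"
        unfolding C_def by (rule norm_interp_kernel_le[OF N(2) \<rho>(1,3) less_imp_le[OF r(1)] le_r(1)])
      ultimately show "cmod ((f (?u j) ?w - (\<Sum>i<N. f (?u j) (?u i) * interp_kernel \<rho> N i ?w)) * interp_kernel \<rho> N j ?z)
          \<le> \<delta> * (C / real N)"
        unfolding norm_mult using \<delta> by (intro mult_mono) auto
    qed
    also have "\<dots> = \<delta> * C" using N(2) by simp
    finally have 2: "cmod (I - poly2 N p z w) \<le> \<delta> * C" .
    have "cmod (f ?z ?w - poly2 N p z w) \<le> cmod (f ?z ?w - I) + cmod (I - poly2 N p z w)"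
      using norm_triangle_ineq[of "f ?z ?w - I" "I - poly2 N p z w"] by simp
    also have "\<dots> \<le> \<delta> * (1 + C)" using 1 2 by (simp add: algebra_simps)
    also have "\<dots> \<le> \<epsilon>" using N(1) by (simp add: \<delta>_def)
    finally show ?thesis by (simp add: norm_minus_commute)
  qed
  then show ?thesis by blast
qed

lemma tendsto_norm_sq_comb:
  assumes "\<And>i. i < n \<Longrightarrow> ((\<lambda>t. g t i) \<longlongrightarrow> g' i) F"
  shows "((\<lambda>t. norm_sq_comb n e (g t)) \<longlongrightarrow> norm_sq_comb n e g') F"
  unfolding norm_sq_comb_def using assms by (intro tendsto_intros) auto

text \<open>Von Neumann's inequality passes from polynomials to the dilated function \<open>f(r z, r w)\<close> by
  uniform approximation, and to \<open>f\<close> itself as \<open>r\<close> tends to \<open>1\<close>.\<close>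

theorem agler_bidisc:
  assumes holo1: "\<And>w. w \<in> ball 0 1 \<Longrightarrow> (\<lambda>z. f z w) holomorphic_on ball 0 1"
    and holo2: "\<And>z. z \<in> ball 0 1 \<Longrightarrow> (\<lambda>w. f z w) holomorphic_on ball 0 1"
    and bdd: "\<And>z w. z \<in> ball 0 1 \<Longrightarrow> w \<in> ball 0 1 \<Longrightarrow> cmod (f z w) \<le> 1"
    and cont: "continuous_on (ball 0 1 \<times> ball 0 1) (\<lambda>x. f (fst x) (snd x))"
    and ab: "\<And>i. i < n \<Longrightarrow> a i \<in> ball 0 1" "\<And>i. i < n \<Longrightarrow> b i \<in> ball 0 1"
    and k: "psd_matrix n k"
    and ka: "psd_matrix n (\<lambda>i j. (1 - a i * cnj (a j)) * k i j)"
    and kb: "psd_matrix n (\<lambda>i j. (1 - b i * cnj (b j)) * k i j)"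
  shows "psd_matrix n (\<lambda>i j. (1 - f (a i) (b i) * cnj (f (a j) (b j))) * k i j)"
proof -
  obtain e where e: "\<And>i j. i < n \<Longrightarrow> j < n \<Longrightarrow> k i j = (\<Sum>l<n. e i l * cnj (e j l))"
    and vN: "\<And>N p M c. (\<And>z w. cmod z = 1 \<Longrightarrow> cmod w = 1 \<Longrightarrow> cmod (poly2 N p z w) \<le> M) \<Longrightarrow>
       norm_sq_comb n e (\<lambda>i. poly2 N p (a i) (b i) * c i) \<le> M\<^sup>2 * norm_sq_comb n e c"
    using ando_von_neumann[OF k ka kb] by (elim exE conjE) simp
  have scaled: "norm_sq_comb n e (\<lambda>i. f (of_real r * a i) (of_real r * b i) * c i) \<le> norm_sq_comb n e c"
    if r: "0 < r" "r < 1" for r :: real and c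
  proof -
    have "\<exists>p. \<forall>z w. cmod z \<le> 1 \<longrightarrow> cmod w \<le> 1 \<longrightarrow>
      cmod (poly2 (fst p) (snd p) z w - f (of_real r * z) (of_real r * w)) \<le> inverse (real (Suc m))" for m
    proof -
      have pos: "inverse (real (Suc m)) > 0" by simp
      obtain N q where "\<forall>z w. cmod z \<le> 1 \<longrightarrow> cmod w \<le> 1 \<longrightarrow>
          cmod (poly2 N q z w - f (of_real r * z) (of_real r * w)) \<le> inverse (real (Suc m))"
        using bidisc_polynomial_approximation[OF holo1 holo2 bdd r pos] by blast
      then show ?thesis by (intro exI[of _ "(N, q)"]) simp
    qed
    then obtain p where p: "\<And>m z w. cmod z \<le> 1 \<Longrightarrow> cmod w \<le> 1 \<Longrightarrow>
      cmod (poly2 (fst (p m)) (snd (p m)) z w - f (of_real r * z) (of_real r * w)) \<le> inverse (real (Suc m))"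
      by metis
    have le: "norm_sq_comb n e (\<lambda>i. poly2 (fst (p m)) (snd (p m)) (a i) (b i) * c i)
        \<le> (1 + inverse (real (Suc m)))\<^sup>2 * norm_sq_comb n e c" for m
    proof (rule vN)
      fix z w :: complex assume zw: "cmod z = 1" "cmod w = 1"
      have "cmod (f (of_real r * z) (of_real r * w)) \<le> 1"
        by (rule bdd) (use zw r in \<open>auto simp: norm_mult\<close>)
      moreover have "cmod (poly2 (fst (p m)) (snd (p m)) z w - f (of_real r * z) (of_real r * w)) \<le> inverse (real (Suc m))"
        by (rule p) (use zw in auto)
      ultimately show "cmod (poly2 (fst (p m)) (snd (p m)) z w) \<le> 1 + inverse (real (Suc m))"
        by (smt (verit) norm_triangle_sub)
    qed
    have "(\<lambda>m. poly2 (fst (p m)) (snd (p m)) (a i) (b i)) \<longlonglongrightarrow> f (of_real r * a i) (of_real r * b i)" if "i < n" for i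
    proof (rule Lim_transform_bound[OF _ LIMSEQ_inverse_real_of_nat, THEN Lim_null[THEN iffD2]])
      show "\<forall>\<^sub>F m in sequentially. cmod (poly2 (fst (p m)) (snd (p m)) (a i) (b i) - f (of_real r * a i) (of_real r * b i))
          \<le> norm (inverse (real (Suc m)))"
        using p ab[OF that] by (intro always_eventually allI) auto
    qed
    then have 1: "(\<lambda>m. norm_sq_comb n e (\<lambda>i. poly2 (fst (p m)) (snd (p m)) (a i) (b i) * c i))
        \<longlonglongrightarrow> norm_sq_comb n e (\<lambda>i. f (of_real r * a i) (of_real r * b i) * c i)"
      by (intro tendsto_norm_sq_comb tendsto_mult tendsto_const) auto
    have 2: "(\<lambda>m. (1 + inverse (real (Suc m)))\<^sup>2 * norm_sq_comb n e c) \<longlonglongrightarrow> (1 + 0)\<^sup>2 * norm_sq_comb n e c"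
      by (intro tendsto_intros LIMSEQ_inverse_real_of_nat)
    from LIMSEQ_le[OF 1 2] le show ?thesis by simp
  qed
  have contr: "norm_sq_comb n e (\<lambda>i. f (a i) (b i) * c i) \<le> norm_sq_comb n e c" for c
  proof -
    have "((\<lambda>r. f (of_real r * a i) (of_real r * b i)) \<longlongrightarrow> f (a i) (b i)) (at_left (1::real))" if i: "i < n" for i
    proof -
      have op: "open (ball 0 1 \<times> ball 0 1 :: (complex \<times> complex) set)" by (intro open_Times open_ball)
      have c: "continuous (at (a i, b i)) (\<lambda>x. f (fst x) (snd x))"
        using cont ab[OF i] unfolding continuous_on_eq_continuous_at[OF op] by auto
      have "((\<lambda>r. (complex_of_real r * a i, complex_of_real r * b i)) \<longlongrightarrow> (of_real 1 * a i, of_real 1 * b i)) (at_left (1::real))"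
        by (intro tendsto_intros)
      then have t: "((\<lambda>r. (complex_of_real r * a i, complex_of_real r * b i)) \<longlongrightarrow> (a i, b i)) (at_left (1::real))" by simp
      show ?thesis using continuous_within_tendsto_compose'[of "(a i, b i)" UNIV "\<lambda>x. f (fst x) (snd x)", OF c _ t] by simp
    qed
    then have 1: "((\<lambda>r. norm_sq_comb n e (\<lambda>i. f (of_real r * a i) (of_real r * b i) * c i))
        \<longlongrightarrow> norm_sq_comb n e (\<lambda>i. f (a i) (b i) * c i)) (at_left (1::real))"
      by (intro tendsto_norm_sq_comb tendsto_mult tendsto_const) auto
    have "eventually (\<lambda>r. norm_sq_comb n e (\<lambda>i. f (of_real r * a i) (of_real r * b i) * c i) \<le> norm_sq_comb n e c) (at_left (1::real))"
      using eventually_at_left_real[of 0 1] by (rule eventually_mono) (use scaled in auto)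
    from tendsto_upperbound[OF 1 this] show ?thesis by simp
  qed
  show ?thesis unfolding psd_matrix_def
  proof
    fix c :: "nat \<Rightarrow> complex"
    let ?f = "\<lambda>i. f (a i) (b i)"
    have "(\<Sum>i<n. \<Sum>j<n. cnj (c i) * ((1 - ?f i * cnj (?f j)) * k i j) * c j)
       = (\<Sum>i<n. \<Sum>j<n. cnj (c i) * k i j * cnj (cnj (c j)) - (?f i * cnj (c i)) * k i j * cnj (?f j * cnj (c j)))"
      by (intro sum.cong refl) (simp add: algebra_simps)
    also have "\<dots> = complex_of_real (norm_sq_comb n e (\<lambda>i. cnj (c i)) - norm_sq_comb n e (\<lambda>i. ?f i * cnj (c i)))"
      unfolding of_real_diff norm_sq_comb_gram sum_subtractf using e by simp
    also have "\<dots> \<in> \<real>\<^sub>\<ge>\<^sub>0" using contr[of "\<lambda>i. cnj (c i)"] unfolding nonneg_Reals_of_real_iff by simp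
    finally show "(\<Sum>i<n. \<Sum>j<n. cnj (c i) * ((1 - ?f i * cnj (?f j)) * k i j) * c j) \<in> \<real>\<^sub>\<ge>\<^sub>0" .
  qed
qed

section \<open>Operations on positive kernels\<close>

lemma psd_onD:
  "psd_on \<Omega> G \<Longrightarrow> set zs \<subseteq> \<Omega> \<Longrightarrow>
    (\<Sum>i<length zs. \<Sum>j<length zs. cnj (c i) * G (zs ! i) (zs ! j) * c j) \<in> \<real>\<^sub>\<ge>\<^sub>0"
  unfolding psd_on_def by blast

lemma psd_on_cong:
  assumes "\<And>z w. z \<in> \<Omega> \<Longrightarrow> w \<in> \<Omega> \<Longrightarrow> G z w = H z w"
  shows "psd_on \<Omega> G \<longleftrightarrow> psd_on \<Omega> H"
proof -
  have "(\<Sum>i<length zs. \<Sum>j<length zs. cnj (c i) * G (zs ! i) (zs ! j) * c j)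
      = (\<Sum>i<length zs. \<Sum>j<length zs. cnj (c i) * H (zs ! i) (zs ! j) * c j)"
    if "set zs \<subseteq> \<Omega>" for zs and c :: "nat \<Rightarrow> complex"
  proof (intro sum.cong refl)
    fix i j assume "i \<in> {..<length zs}" "j \<in> {..<length zs}"
    then have "zs ! i \<in> \<Omega>" "zs ! j \<in> \<Omega>" using that nth_mem by auto
    then show "cnj (c i) * G (zs ! i) (zs ! j) * c j = cnj (c i) * H (zs ! i) (zs ! j) * c j"
      by (simp add: assms)
  qed
  then show ?thesis unfolding psd_on_def by simp
qed

lemma psd_on_add:
  assumes "psd_on \<Omega> G" "psd_on \<Omega> H" shows "psd_on \<Omega> (\<lambda>z w. G z w + H z w)"
  unfolding psd_on_def
proof (intro allI impI)
  fix zs and c :: "nat \<Rightarrow> complex" assume zs: "set zs \<subseteq> \<Omega>"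
  have "(\<Sum>i<length zs. \<Sum>j<length zs. cnj (c i) * (G (zs ! i) (zs ! j) + H (zs ! i) (zs ! j)) * c j)
     = (\<Sum>i<length zs. \<Sum>j<length zs. cnj (c i) * G (zs ! i) (zs ! j) * c j)
     + (\<Sum>i<length zs. \<Sum>j<length zs. cnj (c i) * H (zs ! i) (zs ! j) * c j)"
    by (simp add: distrib_left distrib_right sum.distrib)
  then show "(\<Sum>i<length zs. \<Sum>j<length zs. cnj (c i) * (G (zs ! i) (zs ! j) + H (zs ! i) (zs ! j)) * c j) \<in> \<real>\<^sub>\<ge>\<^sub>0"
    using psd_onD[OF assms(1) zs] psd_onD[OF assms(2) zs] by (simp add: nonneg_Reals_add_I)
qed

lemma psd_on_conjugate:
  assumes "psd_on \<Omega> G" shows "psd_on \<Omega> (\<lambda>z w. u z * cnj (u w) * G z w)"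
  unfolding psd_on_def
proof (intro allI impI)
  fix zs and c :: "nat \<Rightarrow> complex" assume zs: "set zs \<subseteq> \<Omega>"
  show "(\<Sum>i<length zs. \<Sum>j<length zs. cnj (c i) * (u (zs ! i) * cnj (u (zs ! j)) * G (zs ! i) (zs ! j)) * c j) \<in> \<real>\<^sub>\<ge>\<^sub>0"
    using psd_onD[OF assms zs, of "\<lambda>i. cnj (u (zs ! i)) * c i"] by (simp add: mult_ac)
qed

lemma psd_on_one: "psd_on \<Omega> (\<lambda>z w. 1)"
  unfolding psd_on_def
proof (intro allI impI)
  fix zs :: "'a list" and c :: "nat \<Rightarrow> complex"
  have "(\<Sum>i<length zs. \<Sum>j<length zs. cnj (c i) * 1 * c j)
      = of_real ((cmod (\<Sum>j<length zs. c j))\<^sup>2)"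
    unfolding cmod_power2_eq_mult_cnj cnj_sum sum_product
    by (subst sum.swap) (simp add: mult.commute)
  then show "(\<Sum>i<length zs. \<Sum>j<length zs. cnj (c i) * 1 * c j) \<in> \<real>\<^sub>\<ge>\<^sub>0"
    by (simp only: nonneg_Reals_of_real_iff) simp
qed

lemma psd_on_rank_one: "psd_on \<Omega> (\<lambda>z w. u z * cnj (u w))"
  using psd_on_conjugate[OF psd_on_one, of \<Omega> u] by simp

lemma psd_on_scale:
  assumes "psd_on \<Omega> G" "r \<ge> 0" shows "psd_on \<Omega> (\<lambda>z w. of_real r * G z w)"
proof -
  have "complex_of_real (sqrt r) * complex_of_real (sqrt r) = of_real r"
    using assms(2) by (simp flip: of_real_mult)
  then show ?thesis using psd_on_conjugate[OF assms(1), of "\<lambda>_. of_real (sqrt r)"] by simp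
qed

lemma psd_on_zero: "psd_on \<Omega> (\<lambda>z w. 0)"
  unfolding psd_on_def by simp

lemma psd_on_sum: "(\<And>m. m \<in> I \<Longrightarrow> psd_on \<Omega> (G m)) \<Longrightarrow> psd_on \<Omega> (\<lambda>z w. \<Sum>m\<in>I. G m z w)"
  by (induction I rule: infinite_finite_induct) (auto intro: psd_on_add psd_on_zero)

lemma psd_on_sums:
  assumes "\<And>m. psd_on \<Omega> (G m)"
    and sums: "\<And>z w. z \<in> \<Omega> \<Longrightarrow> w \<in> \<Omega> \<Longrightarrow> (\<lambda>m. G m z w) sums H z w"
  shows "psd_on \<Omega> H"
  unfolding psd_on_def
proof (intro allI impI)
  fix zs and c :: "nat \<Rightarrow> complex" assume zs: "set zs \<subseteq> \<Omega>"
  let ?S = "\<lambda>M. \<Sum>i<length zs. \<Sum>j<length zs. cnj (c i) * (\<Sum>m<M. G m (zs ! i) (zs ! j)) * c j"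
  have pos: "?S M \<in> \<real>\<^sub>\<ge>\<^sub>0" for M
    by (rule psd_onD[OF psd_on_sum[OF assms(1)] zs])
  have lim: "?S \<longlonglongrightarrow> (\<Sum>i<length zs. \<Sum>j<length zs. cnj (c i) * H (zs ! i) (zs ! j) * c j)"
  proof (intro tendsto_intros)
    fix i j assume "i \<in> {..<length zs}" "j \<in> {..<length zs}"
    then have "zs ! i \<in> \<Omega>" "zs ! j \<in> \<Omega>" using zs by auto
    then show "(\<lambda>M. \<Sum>m<M. G m (zs ! i) (zs ! j)) \<longlonglongrightarrow> H (zs ! i) (zs ! j)"
      using sums unfolding sums_def by blast
  qed
  show "(\<Sum>i<length zs. \<Sum>j<length zs. cnj (c i) * H (zs ! i) (zs ! j) * c j) \<in> \<real>\<^sub>\<ge>\<^sub>0"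
    by (rule closed_sequentially[OF closed_nonneg_Reals_complex pos lim])
qed

text \<open>Geometric series: \<open>G / (1 - u \<cdot> cnj u)\<close> is the sum of the kernels \<open>u\<^sup>m G cnj (u\<^sup>m)\<close>.\<close>

lemma psd_on_szego:
  assumes "psd_on \<Omega> G" "\<And>z. z \<in> \<Omega> \<Longrightarrow> cmod (u z) < 1"
  shows "psd_on \<Omega> (\<lambda>z w. G z w / (1 - u z * cnj (u w)))"
proof (rule psd_on_sums)
  show "psd_on \<Omega> (\<lambda>z w. u z ^ m * cnj (u w ^ m) * G z w)" for m
    by (rule psd_on_conjugate[OF assms(1)])
  fix z w assume "z \<in> \<Omega>" "w \<in> \<Omega>"
  then have "cmod (u z * cnj (u w)) < 1 * 1"
    unfolding norm_mult complex_mod_cnj using assms(2) by (intro mult_strict_mono') auto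
  then have "(\<lambda>m. (u z * cnj (u w)) ^ m * G z w) sums (1 / (1 - u z * cnj (u w)) * G z w)"
    by (intro sums_mult2 geometric_sums) auto
  then show "(\<lambda>m. u z ^ m * cnj (u w ^ m) * G z w) sums (G z w / (1 - u z * cnj (u w)))"
    by (simp add: power_mult_distrib)
qed

text \<open>Points outside \<open>A\<close> are moved to some point of \<open>A\<close> and receive the coefficient \<open>0\<close>.\<close>

lemma psd_on_zero_extension:
  assumes "psd_on A G"
  shows "psd_on \<Omega> (\<lambda>z w. if z \<in> A \<and> w \<in> A then G z w else 0)"
  unfolding psd_on_def
proof (intro allI impI)
  fix zs and c :: "nat \<Rightarrow> complex" assume zs: "set zs \<subseteq> \<Omega>"
  let ?n = "length zs"
  show "(\<Sum>i<?n. \<Sum>j<?n. cnj (c i) * (if zs ! i \<in> A \<and> zs ! j \<in> A then G (zs ! i) (zs ! j) else 0) * c j) \<in> \<real>\<^sub>\<ge>\<^sub>0"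
  proof (cases "A = {}")
    case False
    then obtain a where a: "a \<in> A" by blast
    define zs' where "zs' = map (\<lambda>z. if z \<in> A then z else a) zs"
    define c' where "c' i = (if zs ! i \<in> A then c i else 0)" for i
    have "set zs' \<subseteq> A" using a by (auto simp: zs'_def)
    from psd_onD[OF assms this, of c']
    have "(\<Sum>i<?n. \<Sum>j<?n. cnj (c' i) * G (zs' ! i) (zs' ! j) * c' j) \<in> \<real>\<^sub>\<ge>\<^sub>0"
      by (simp add: zs'_def)
    also have "(\<Sum>i<?n. \<Sum>j<?n. cnj (c' i) * G (zs' ! i) (zs' ! j) * c' j)
       = (\<Sum>i<?n. \<Sum>j<?n. cnj (c i) * (if zs ! i \<in> A \<and> zs ! j \<in> A then G (zs ! i) (zs ! j) else 0) * c j)"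
      by (intro sum.cong refl) (auto simp: zs'_def c'_def)
    finally show ?thesis .
  qed simp
qed

lemma psd_on_subset: "psd_on \<Omega> G \<Longrightarrow> A \<subseteq> \<Omega> \<Longrightarrow> psd_on A G"
  unfolding psd_on_def by blast

lemma schur_agler_psd:
  "f \<in> schur_agler_class \<Omega> \<Psi> \<Longrightarrow> k \<in> admissible_kernels \<Omega> \<Psi> \<Longrightarrow>
     psd_on \<Omega> (\<lambda>z w. (1 - f z * cnj (f w)) * k z w)"
  unfolding schur_agler_class_def by blast

lemma admissible_kernel_zero_extension:
  assumes "psd_on A k" "\<And>\<psi>. \<psi> \<in> \<Psi> \<Longrightarrow> psd_on A (\<lambda>z w. (1 - \<psi> z * cnj (\<psi> w)) * k z w)"
  shows "(\<lambda>z w. if z \<in> A \<and> w \<in> A then k z w else 0) \<in> admissible_kernels \<Omega> \<Psi>"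
proof -
  have "(\<lambda>z w. (1 - \<psi> z * cnj (\<psi> w)) * (if z \<in> A \<and> w \<in> A then k z w else 0))
      = (\<lambda>z w. if z \<in> A \<and> w \<in> A then (1 - \<psi> z * cnj (\<psi> w)) * k z w else 0)" for \<psi>
    by (simp add: fun_eq_iff)
  then show ?thesis
    unfolding admissible_kernels_def using psd_on_zero_extension assms by auto
qed

text \<open>The way in which membership in the Schur-Agler class is used throughout: a kernel on any
  subset \<open>A\<close> can serve as a test.\<close>

lemma schur_agler_psd_on_subset:
  assumes f: "f \<in> schur_agler_class \<Omega> \<Psi>" and A: "A \<subseteq> \<Omega>"
    and k: "psd_on A k" "\<And>\<psi>. \<psi> \<in> \<Psi> \<Longrightarrow> psd_on A (\<lambda>z w. (1 - \<psi> z * cnj (\<psi> w)) * k z w)"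
  shows "psd_on A (\<lambda>z w. (1 - f z * cnj (f w)) * k z w)"
proof -
  have "psd_on \<Omega> (\<lambda>z w. (1 - f z * cnj (f w)) * (if z \<in> A \<and> w \<in> A then k z w else 0))"
    by (rule schur_agler_psd[OF f admissible_kernel_zero_extension]) (use k in auto)
  then have "psd_on A (\<lambda>z w. (1 - f z * cnj (f w)) * (if z \<in> A \<and> w \<in> A then k z w else 0))"
    using A by (rule psd_on_subset)
  then show ?thesis by (subst (asm) psd_on_cong[where H = "\<lambda>z w. (1 - f z * cnj (f w)) * k z w"]) auto
qed

lemma psd_on_one_minus_const:
  assumes "psd_on A k" "cmod c \<le> 1" "\<And>z. z \<in> A \<Longrightarrow> \<psi> z = c"
  shows "psd_on A (\<lambda>z w. (1 - \<psi> z * cnj (\<psi> w)) * k z w)"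
proof -
  have "(cmod c)\<^sup>2 \<le> 1" using assms(2) by (simp add: power_le_one)
  then have "psd_on A (\<lambda>z w. of_real (1 - (cmod c)\<^sup>2) * k z w)"
    by (intro psd_on_scale[OF assms(1)]) simp
  then show ?thesis
    by (subst psd_on_cong[where H = "\<lambda>z w. of_real (1 - (cmod c)\<^sup>2) * k z w"])
      (use assms(3) in \<open>simp_all only: of_real_diff of_real_1 cmod_power2_eq_mult_cnj\<close>)
qed

section \<open>Schur-Agler functions are holomorphic on discs\<close>

text \<open>The values of \<open>h\<close> define a functional of norm at most \<open>1\<close> on the span of the Szego
  kernels: the squared norm of a combination of Szego kernels with coefficients \<open>c\<^sub>i\<close> at the points \<open>a\<^sub>i\<close> is
  \<open>\<Sum>m. \<bar>\<Sum>i. c\<^sub>i a\<^sub>i\<^sup>m\<bar>\<^sup>2\<close>. Upper bounds \<open>B\<close> of the partial sums avoid summability side conditions.\<close>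

definition hardy_functional :: "(complex \<Rightarrow> complex) \<Rightarrow> bool" where
  "hardy_functional h \<longleftrightarrow> (\<forall>as c B. set as \<subseteq> ball 0 1 \<longrightarrow>
     (\<forall>M. (\<Sum>m<M. (cmod (\<Sum>i<length as. c i * (as ! i) ^ m))\<^sup>2) \<le> B) \<longrightarrow>
     (cmod (\<Sum>i<length as. c i * h (as ! i)))\<^sup>2 \<le> B)"

lemma hardy_functionalD:
  assumes "hardy_functional h" "set as \<subseteq> ball 0 1"
    and "\<And>M. (\<Sum>m<M. (cmod (\<Sum>i<length as. c i * (as ! i) ^ m))\<^sup>2) \<le> B"
  shows "(cmod (\<Sum>i<length as. c i * h (as ! i)))\<^sup>2 \<le> B"
  using assms unfolding hardy_functional_def by blast

text \<open>Let \<open>k\<close> be the Szego kernel on the image of \<open>\<gamma>\<close>. Both \<open>(1 - f \<cdot> cnj f) k\<close> and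
  \<open>f (k - 1) cnj f\<close> are positive, hence so is their sum \<open>k - f \<cdot> cnj f\<close>, which is the asserted bound.\<close>

lemma schur_agler_slice:
  assumes f: "f \<in> schur_agler_class \<Omega> \<Psi>" and \<gamma>: "\<And>a. a \<in> ball 0 1 \<Longrightarrow> \<gamma> a \<in> \<Omega>"
    and u: "\<And>a. a \<in> ball 0 1 \<Longrightarrow> u (\<gamma> a) = a"
    and \<psi>: "\<And>\<psi>. \<psi> \<in> \<Psi> \<Longrightarrow> (\<forall>a\<in>ball 0 1. \<psi> (\<gamma> a) = a) \<or> (\<exists>c. cmod c \<le> 1 \<and> (\<forall>a\<in>ball 0 1. \<psi> (\<gamma> a) = c))"
  shows "hardy_functional (\<lambda>a. f (\<gamma> a))"
proof -
  define A where "A = \<gamma> ` ball 0 1"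
  have A: "A \<subseteq> \<Omega>" using \<gamma> by (auto simp: A_def)
  have uA: "cmod (u z) < 1" if "z \<in> A" for z using that u by (auto simp: A_def)
  define k where "k z w = 1 / (1 - u z * cnj (u w))" for z w
  have ne: "1 - u z * cnj (u w) \<noteq> 0" if "z \<in> A" "w \<in> A" for z w
  proof -
    have "cmod (u z * cnj (u w)) < 1 * 1"
      unfolding norm_mult complex_mod_cnj using uA that by (intro mult_strict_mono') auto
    then show ?thesis by auto
  qed
  have k: "psd_on A k" unfolding k_def by (rule psd_on_szego[OF psd_on_one uA])
  have "psd_on A (\<lambda>z w. (1 - f z * cnj (f w)) * k z w)"
  proof (rule schur_agler_psd_on_subset[OF f A k])
    fix \<psi> assume "\<psi> \<in> \<Psi>"
    from \<psi>[OF this] show "psd_on A (\<lambda>z w. (1 - \<psi> z * cnj (\<psi> w)) * k z w)"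
    proof
      assume "\<forall>a\<in>ball 0 1. \<psi> (\<gamma> a) = a"
      then have "\<psi> z = u z" if "z \<in> A" for z using that u by (auto simp: A_def)
      then have "(1 - \<psi> z * cnj (\<psi> w)) * k z w = 1" if "z \<in> A" "w \<in> A" for z w
        using that ne by (simp add: k_def)
      then show ?thesis by (subst psd_on_cong[where H = "\<lambda>z w. 1"]) (simp_all add: psd_on_one)
    next
      assume "\<exists>c. cmod c \<le> 1 \<and> (\<forall>a\<in>ball 0 1. \<psi> (\<gamma> a) = c)"
      then obtain c where c: "cmod c \<le> 1" "\<And>a. a \<in> ball 0 1 \<Longrightarrow> \<psi> (\<gamma> a) = c" by blast
      show ?thesis by (rule psd_on_one_minus_const[OF k c(1)]) (use c(2) in \<open>auto simp: A_def\<close>)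
    qed
  qed
  moreover have "psd_on A (\<lambda>z w. f z * cnj (f w) * (u z * cnj (u w) * k z w))"
    by (intro psd_on_conjugate k)
  ultimately have "psd_on A (\<lambda>z w. (1 - f z * cnj (f w)) * k z w + f z * cnj (f w) * (u z * cnj (u w) * k z w))"
    by (rule psd_on_add)
  then have diff: "psd_on A (\<lambda>z w. k z w - f z * cnj (f w))"
  proof (subst (asm) psd_on_cong[where H = "\<lambda>z w. k z w - f z * cnj (f w)"])
    have "(1 - F) * (1 / (1 - P)) + F * (P * (1 / (1 - P))) = 1 / (1 - P) - F"
      if "1 - P \<noteq> 0" for F P :: complex
    proof -
      have "(1 - F) * X + F * (P * X) = X - F * (X * (1 - P))" for X
        by (simp add: algebra_simps)
      from this[of "1 / (1 - P)"] show ?thesis using that by simp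
    qed
    then show "(1 - f z * cnj (f w)) * k z w + f z * cnj (f w) * (u z * cnj (u w) * k z w) = k z w - f z * cnj (f w)"
      if "z \<in> A" "w \<in> A" for z w
      using ne[OF that] by (simp only: k_def)
  qed
  show ?thesis unfolding hardy_functional_def
  proof (intro allI impI)
    fix as :: "complex list" and c :: "nat \<Rightarrow> complex" and B :: real
    assume as: "set as \<subseteq> ball 0 1"
      and B: "\<forall>M. (\<Sum>m<M. (cmod (\<Sum>i<length as. c i * (as ! i) ^ m))\<^sup>2) \<le> B"
    let ?n = "length as"
    let ?zs = "map \<gamma> as"
    have as_in: "as ! i \<in> ball 0 1" if "i < ?n" for i using as nth_mem[OF that] by blast
    have lt: "cmod (as ! i * cnj (as ! j)) < 1" if "i < ?n" "j < ?n" for i j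
    proof -
      have "cmod (as ! i * cnj (as ! j)) < 1 * 1"
        unfolding norm_mult complex_mod_cnj using as_in that by (intro mult_strict_mono') auto
      then show ?thesis by simp
    qed
    let ?Q = "\<Sum>i<?n. \<Sum>j<?n. c i * cnj (c j) / (1 - as ! i * cnj (as ! j))"
    have "set ?zs \<subseteq> A" using as by (auto simp: A_def)
    from psd_onD[OF diff this, of "\<lambda>i. cnj (c i)"]
    have "(\<Sum>i<?n. \<Sum>j<?n. c i * (k (\<gamma> (as ! i)) (\<gamma> (as ! j)) - f (\<gamma> (as ! i)) * cnj (f (\<gamma> (as ! j)))) * cnj (c j)) \<in> \<real>\<^sub>\<ge>\<^sub>0"
      by simp
    also have "(\<Sum>i<?n. \<Sum>j<?n. c i * (k (\<gamma> (as ! i)) (\<gamma> (as ! j)) - f (\<gamma> (as ! i)) * cnj (f (\<gamma> (as ! j)))) * cnj (c j))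
       = (\<Sum>i<?n. \<Sum>j<?n. c i * cnj (c j) / (1 - as ! i * cnj (as ! j)) - (c i * f (\<gamma> (as ! i))) * cnj (c j * f (\<gamma> (as ! j))))"
      using as_in u by (intro sum.cong refl) (simp add: k_def algebra_simps)
    also have "\<dots> = ?Q - of_real ((cmod (\<Sum>i<?n. c i * f (\<gamma> (as ! i))))\<^sup>2)"
      unfolding cmod_power2_eq_mult_cnj cnj_sum sum_product by (simp add: sum_subtractf)
    finally have *: "?Q - of_real ((cmod (\<Sum>i<?n. c i * f (\<gamma> (as ! i))))\<^sup>2) \<in> \<real>\<^sub>\<ge>\<^sub>0" .
    have "(\<lambda>m. \<Sum>i<?n. \<Sum>j<?n. c i * cnj (c j) * (as ! i * cnj (as ! j)) ^ m)
        sums (\<Sum>i<?n. \<Sum>j<?n. c i * cnj (c j) * (1 / (1 - as ! i * cnj (as ! j))))"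
      using lt by (intro sums_sum sums_mult geometric_sums) auto
    moreover have "(\<Sum>i<?n. \<Sum>j<?n. c i * cnj (c j) * (as ! i * cnj (as ! j)) ^ m)
       = of_real ((cmod (\<Sum>i<?n. c i * (as ! i) ^ m))\<^sup>2)" for m
      unfolding cmod_power2_eq_mult_cnj cnj_sum sum_product by (simp add: power_mult_distrib mult_ac)
    ultimately have "(\<lambda>m. complex_of_real ((cmod (\<Sum>i<?n. c i * (as ! i) ^ m))\<^sup>2)) sums ?Q" by simp
    then have "(\<lambda>m. Re (complex_of_real ((cmod (\<Sum>i<?n. c i * (as ! i) ^ m))\<^sup>2))) sums Re ?Q"
      by (rule sums_Re)
    then have "(\<lambda>M. \<Sum>m<M. (cmod (\<Sum>i<?n. c i * (as ! i) ^ m))\<^sup>2) \<longlonglongrightarrow> Re ?Q"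
      unfolding sums_def by simp
    then have "Re ?Q \<le> B" by (rule LIMSEQ_le_const2) (use B in auto)
    moreover have "(cmod (\<Sum>i<?n. c i * f (\<gamma> (as ! i))))\<^sup>2 \<le> Re ?Q"
      using * unfolding complex_nonneg_Reals_iff minus_complex.simps Re_complex_of_real by simp
    ultimately show "(cmod (\<Sum>i<?n. c i * f (\<gamma> (as ! i))))\<^sup>2 \<le> B" by simp
  qed
qed

lemma norm_power_diff_le:
  fixes b c :: complex
  assumes "cmod b \<le> r" "cmod c \<le> r" "r > 0"
  shows "cmod (b ^ k - c ^ k) \<le> real k * r ^ k / r * cmod (b - c)"
proof -
  have "b ^ k - c ^ k = (b - c) * (\<Sum>i<k. c ^ (k - Suc i) * b ^ i)" by (rule power_diff_sumr2)
  moreover have "cmod (\<Sum>i<k. c ^ (k - Suc i) * b ^ i) \<le> (\<Sum>i<k. r ^ k / r)"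
  proof (rule sum_norm_le)
    fix i assume "i \<in> {..<k}"
    have "cmod (c ^ (k - Suc i) * b ^ i) \<le> r ^ (k - Suc i) * r ^ i"
      unfolding norm_mult norm_power using assms by (intro mult_mono power_mono) auto
    also have "\<dots> = r ^ k / r"
    proof -
      have "r ^ k = r ^ (k - Suc i) * r ^ i * r"
        using \<open>i \<in> {..<k}\<close> by (simp flip: power_add power_Suc2)
      then show ?thesis using assms(3) by simp
    qed
    finally show "cmod (c ^ (k - Suc i) * b ^ i) \<le> r ^ k / r" .
  qed
  ultimately have "cmod (b ^ k - c ^ k) \<le> (\<Sum>i<k. r ^ k / r) * cmod (b - c)"
    by (simp only: norm_mult mult.commute[of "cmod (b - c)"]) (rule mult_right_mono, auto)
  then show ?thesis by simp
qed

lemma second_difference_power_le: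
  fixes a b c :: complex
  assumes "cmod a \<le> r" "cmod b \<le> r" "cmod c \<le> r" "r > 0" "b \<noteq> a" "c \<noteq> a"
  shows "cmod ((b ^ m - a ^ m) / (b - a) - (c ^ m - a ^ m) / (c - a)) \<le> (real m)\<^sup>2 * r ^ m / r\<^sup>2 * cmod (b - c)"
proof -
  have q: "(x ^ m - a ^ m) / (x - a) = (\<Sum>i<m. a ^ (m - Suc i) * x ^ i)" if "x \<noteq> a" for x
    unfolding power_diff_sumr2 using that by simp
  have "(b ^ m - a ^ m) / (b - a) - (c ^ m - a ^ m) / (c - a) = (\<Sum>i<m. a ^ (m - Suc i) * (b ^ i - c ^ i))"
    unfolding q[OF assms(5)] q[OF assms(6)] by (simp add: right_diff_distrib sum_subtractf)
  also have "cmod \<dots> \<le> (\<Sum>i<m. real m * r ^ m / r\<^sup>2 * cmod (b - c))"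
  proof (rule sum_norm_le)
    fix i assume i: "i \<in> {..<m}"
    have "cmod (a ^ (m - Suc i) * (b ^ i - c ^ i)) \<le> r ^ (m - Suc i) * (real i * r ^ i / r * cmod (b - c))"
      unfolding norm_mult norm_power using assms
      by (intro mult_mono power_mono norm_power_diff_le) auto
    also have "\<dots> = real i * (r ^ m / r\<^sup>2 * cmod (b - c))"
    proof -
      have "r ^ m = r ^ (m - Suc i) * r ^ i * r" using i by (simp flip: power_add power_Suc2)
      then show ?thesis using assms(4) by (simp add: power2_eq_square)
    qed
    also have "\<dots> \<le> real m * (r ^ m / r\<^sup>2 * cmod (b - c))"
      using i assms(4) by (intro mult_right_mono) auto
    finally show "cmod (a ^ (m - Suc i) * (b ^ i - c ^ i)) \<le> real m * r ^ m / r\<^sup>2 * cmod (b - c)" by simp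
  qed
  also have "\<dots> = (real m)\<^sup>2 * r ^ m / r\<^sup>2 * cmod (b - c)" by (simp add: power2_eq_square)
  finally show ?thesis .
qed

lemma square_times_power_le:
  fixes r :: real
  assumes "0 < r" "r < 1"
  shows "\<exists>C. \<forall>m. (real m)\<^sup>2 * r ^ m \<le> C * (sqrt r) ^ m"
proof -
  define t where "t = sqrt (sqrt r)"
  have t: "0 < t" "t < 1" "t ^ 2 = sqrt r" using assms by (auto simp: t_def)
  have "(\<lambda>m. real m * t ^ m) \<longlonglongrightarrow> 0"
    using t powser_times_n_limit_0[of t] by simp
  then have "Bseq (\<lambda>m. real m * t ^ m)" by (intro convergent_imp_Bseq convergentI)
  then obtain K where K: "\<And>m. norm (real m * t ^ m) \<le> K" unfolding Bseq_def by blast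
  have "(real m)\<^sup>2 * r ^ m \<le> K\<^sup>2 * (sqrt r) ^ m" for m
  proof -
    have tm: "(t ^ 2) ^ m = (t ^ m)\<^sup>2" by (metis power_mult mult.commute)
    have "r = t ^ 2 * t ^ 2" using assms t(3) by simp
    then have "r ^ m = (t ^ m)\<^sup>2 * (t ^ m)\<^sup>2" by (simp only: power_mult_distrib tm)
    moreover have "(sqrt r) ^ m = (t ^ m)\<^sup>2" unfolding t(3)[symmetric] by (rule tm)
    moreover have "(real m * t ^ m)\<^sup>2 \<le> K\<^sup>2" using K[of m] by (intro power_mono) (use t in auto)
    moreover have "(real m * t ^ m)\<^sup>2 * (t ^ m)\<^sup>2 \<le> K\<^sup>2 * (t ^ m)\<^sup>2"
      by (rule mult_right_mono[OF calculation(3)]) simp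
    ultimately show ?thesis by (simp only: power_mult_distrib mult.assoc)
  qed
  then show ?thesis by blast
qed

text \<open>Applied to a second divided difference at \<open>a, b, c\<close>, the functional shows that the difference quotient at
  \<open>a\<close> is Lipschitz in a punctured neighbourhood of \<open>a\<close>; therefore it has a limit.\<close>

lemma hardy_functional_holomorphic:
  assumes "hardy_functional h"
  shows "h holomorphic_on ball 0 1"
  unfolding holomorphic_on_open[OF open_ball]
proof
  fix a :: complex assume a: "a \<in> ball 0 1"
  define r where "r = (1 + cmod a) / 2"
  have "0 < 1 + cmod a" "cmod a < 1" using a add_pos_nonneg[OF zero_less_one norm_ge_zero, of a] by auto
  then have r: "0 < r" "r < 1" "cmod a < r" by (simp_all add: r_def)
  obtain C where C: "\<And>m. (real m)\<^sup>2 * r ^ m \<le> C * (sqrt r) ^ m"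
    using square_times_power_le[OF r(1,2)] by blast
  define K where "K = \<bar>C\<bar> / r\<^sup>2 * sqrt (1 / (1 - r))"
  have K: "K \<ge> 0" using r by (simp add: K_def)
  define D where "D b = (h b - h a) / (b - a)" for b
  have lip: "cmod (D b - D c) \<le> K * cmod (b - c)" if bc: "b \<in> ball 0 r - {a}" "c \<in> ball 0 r - {a}" for b c
  proof -
    let ?as = "[a, b, c]"
    (* Coefficients of the difference of the two difference quotients at a. *)
    define w where "w = (\<lambda>i::nat. [1 / (c - a) - 1 / (b - a), 1 / (b - a), - (1 / (c - a))] ! i)"
    have exp: "(\<Sum>i<length ?as. w i * g (?as ! i)) = (g b - g a) / (b - a) - (g c - g a) / (c - a)" for g
      by (simp add: w_def numeral_3_eq_3 diff_divide_distrib algebra_simps)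
    have "(\<Sum>m<M. (cmod (\<Sum>i<length ?as. w i * (?as ! i) ^ m))\<^sup>2) \<le> (K * cmod (b - c))\<^sup>2" for M
    proof -
      have "(\<Sum>m<M. (cmod (\<Sum>i<length ?as. w i * (?as ! i) ^ m))\<^sup>2) \<le> (\<Sum>m<M. (\<bar>C\<bar> / r\<^sup>2 * cmod (b - c))\<^sup>2 * r ^ m)"
      proof (rule sum_mono)
        fix m
        have "cmod (\<Sum>i<length ?as. w i * (?as ! i) ^ m)
            = cmod ((b ^ m - a ^ m) / (b - a) - (c ^ m - a ^ m) / (c - a))"
          using exp[of "\<lambda>x. x ^ m"] by simp
        also have "\<dots> \<le> (real m)\<^sup>2 * r ^ m / r\<^sup>2 * cmod (b - c)"
          using bc r by (intro second_difference_power_le) auto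
        also have "\<dots> \<le> \<bar>C\<bar> * (sqrt r) ^ m / r\<^sup>2 * cmod (b - c)"
        proof (intro mult_right_mono divide_right_mono)
          have "C * (sqrt r) ^ m \<le> \<bar>C\<bar> * (sqrt r) ^ m" using r by (intro mult_right_mono) auto
          then show "(real m)\<^sup>2 * r ^ m \<le> \<bar>C\<bar> * (sqrt r) ^ m" using C[of m] by linarith
        qed auto
        finally have "(cmod (\<Sum>i<length ?as. w i * (?as ! i) ^ m))\<^sup>2 \<le> (\<bar>C\<bar> * (sqrt r) ^ m / r\<^sup>2 * cmod (b - c))\<^sup>2"
          by (intro power_mono) auto
        also have "\<dots> = (\<bar>C\<bar> / r\<^sup>2 * cmod (b - c))\<^sup>2 * ((sqrt r)\<^sup>2) ^ m"
          by (simp add: power_mult_distrib power_divide mult_ac flip: power_mult)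
        finally show "(cmod (\<Sum>i<length ?as. w i * (?as ! i) ^ m))\<^sup>2 \<le> (\<bar>C\<bar> / r\<^sup>2 * cmod (b - c))\<^sup>2 * r ^ m"
          using r by simp
      qed
      also have "\<dots> = (\<bar>C\<bar> / r\<^sup>2 * cmod (b - c))\<^sup>2 * (\<Sum>m<M. r ^ m)"
        by (simp only: sum_distrib_left)
      also have "\<dots> \<le> (\<bar>C\<bar> / r\<^sup>2 * cmod (b - c))\<^sup>2 * (\<Sum>m. r ^ m)"
        using r by (intro mult_left_mono sum_le_suminf summable_geometric) auto
      also have "(\<Sum>m. r ^ m) = 1 / (1 - r)" using r by (intro suminf_geometric) auto
      also have "(\<bar>C\<bar> / r\<^sup>2 * cmod (b - c))\<^sup>2 * (1 / (1 - r)) = (K * cmod (b - c))\<^sup>2"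
      proof -
        have "(sqrt (1 / (1 - r)))\<^sup>2 = 1 / (1 - r)" using r by (intro real_sqrt_pow2) auto
        then show ?thesis unfolding K_def power_mult_distrib by (simp only: mult_ac)
      qed
      finally show ?thesis .
    qed
    moreover have "set ?as \<subseteq> ball 0 1" using a bc r by auto
    ultimately have "(cmod (\<Sum>i<length ?as. w i * h (?as ! i)))\<^sup>2 \<le> (K * cmod (b - c))\<^sup>2"
      by (intro hardy_functionalD[OF assms])
    then have "(cmod (D b - D c))\<^sup>2 \<le> (K * cmod (b - c))\<^sup>2" unfolding D_def exp[of h] .
    then show ?thesis by (rule power2_le_imp_le) (use K in simp)
  qed
  have "uniformly_continuous_on (ball 0 r - {a}) D"
  proof (rule lipschitz_on_uniformly_continuous)
    show "K-lipschitz_on (ball 0 r - {a}) D"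
      using lip K by (intro lipschitz_onI) (auto simp: dist_norm)
  qed
  then obtain g where g: "uniformly_continuous_on (closure (ball 0 r - {a})) g"
      "\<And>x. x \<in> ball 0 r - {a} \<Longrightarrow> D x = g x"
    by (rule uniformly_continuous_on_extension_on_closure) auto
  have "a islimpt ball 0 r" using r by (intro open_imp_islimpt) auto
  then have acl: "a \<in> closure (ball 0 r - {a})"
    unfolding closure_approachable islimpt_approachable by blast
  have "(g \<longlongrightarrow> g a) (at a within closure (ball 0 r - {a}))"
    using uniformly_continuous_imp_continuous[OF g(1)] acl by (simp add: continuous_on_def)
  then have "(g \<longlongrightarrow> g a) (at a within (ball 0 r - {a}))"
    by (rule tendsto_within_subset[OF _ closure_subset])
  moreover have "eventually (\<lambda>x. g x = D x) (at a within (ball 0 r - {a}))"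
    using g(2) by (auto simp: eventually_at_filter)
  ultimately have "(D \<longlongrightarrow> g a) (at a within (ball 0 r - {a}))"
    using Lim_transform_eventually by blast
  moreover have "at a within (ball 0 r - {a}) = at a"
  proof -
    have "at a within (ball 0 r - {a}) = at a within ball 0 r" by (simp add: at_within_def)
    also have "\<dots> = at a" using r by (intro at_within_open) auto
    finally show ?thesis .
  qed
  ultimately have "(D \<longlongrightarrow> g a) (at a)" by simp
  then show "\<exists>f'. (h has_field_derivative f') (at a)"
    unfolding has_field_derivative_iff D_def by blast
qed

section \<open>Holomorphy in several variables\<close>

lemma bounded_holomorphic_lipschitz:
  assumes holo: "\<phi> holomorphic_on ball a r" and bdd: "\<And>z. z \<in> ball a r \<Longrightarrow> cmod (\<phi> z) \<le> B"
    and r: "r > 0" and h: "cmod h < r / 2"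
  shows "cmod (\<phi> (a + h) - \<phi> a) \<le> 4 * B / r * cmod h"
proof -
  have "cmod (\<phi> (a + h) - \<phi> a) \<le> 4 * B / r * cmod (a + h - a)"
  proof (rule field_differentiable_bound[of "ball a (r / 2)" \<phi> "deriv \<phi>"])
    show "convex (ball a (r / 2))" by simp
    fix z assume z: "z \<in> ball a (r / 2)"
    then have za: "dist a z < r / 2" by simp
    then have zr: "z \<in> ball a r" using r by simp
    show "(\<phi> has_field_derivative deriv \<phi> z) (at z within ball a (r / 2))"
      using holomorphic_derivI[OF holo open_ball zr] by (rule has_field_derivative_at_within)
    have sub: "cball z (r / 4) \<subseteq> ball a r"
    proof
      fix y assume "y \<in> cball z (r / 4)"
      then show "y \<in> ball a r" using za dist_triangle[of a y z] r by (simp add: dist_commute)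
    qed
    have "cmod ((deriv ^^ 1) \<phi> z) \<le> fact 1 * B / (r / 4) ^ 1"
    proof (rule Cauchy_inequality)
      show "\<phi> holomorphic_on ball z (r / 4)"
        by (rule holomorphic_on_subset[OF holo]) (use sub in auto)
      show "continuous_on (cball z (r / 4)) \<phi>"
        by (rule continuous_on_subset[OF holomorphic_on_imp_continuous_on[OF holo] sub])
      show "cmod (\<phi> x) \<le> B" if "cmod (z - x) = r / 4" for x
        by (rule bdd, rule subsetD[OF sub]) (use that in \<open>simp add: dist_norm\<close>)
    qed (use r in simp)
    then show "cmod (deriv \<phi> z) \<le> 4 * B / r" using r by (simp add: field_simps)
  qed (use h r in \<open>auto simp: dist_norm\<close>)
  then show ?thesis by simp
qed

text \<open>The two partial derivatives give the linear part. What remains is the mixed difference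
  \<open>E\<close>, which is \<open>O(\<bar>h\<bar> \<bar>k\<bar>)\<close>: as a function of the first increment it is holomorphic and of size
  \<open>O(\<bar>k\<bar>)\<close>, and it vanishes with the first increment.\<close>

lemma separately_holomorphic_has_derivative:
  assumes holo1: "\<And>w. w \<in> ball 0 1 \<Longrightarrow> (\<lambda>z. g z w) holomorphic_on ball 0 1"
    and holo2: "\<And>z. z \<in> ball 0 1 \<Longrightarrow> (\<lambda>w. g z w) holomorphic_on ball 0 1"
    and bdd: "\<And>z w. z \<in> ball 0 1 \<Longrightarrow> w \<in> ball 0 1 \<Longrightarrow> cmod (g z w) \<le> M"
    and ab: "a \<in> ball 0 1" "b \<in> ball 0 1"
  shows "\<exists>g1 g2. ((\<lambda>x. g (fst x) (snd x)) has_derivative (\<lambda>x. g1 * fst x + g2 * snd x)) (at (a, b))"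
proof -
  define g1 where "g1 = deriv (\<lambda>z. g z b) a"
  define g2 where "g2 = deriv (\<lambda>w. g a w) b"
  define E where "E x = g (fst x) (snd x) - g (fst x) b - g a (snd x) + g a b" for x
  have d1: "((\<lambda>z. g z b) has_derivative (\<lambda>h. g1 * h)) (at a)"
    using holomorphic_derivI[OF holo1[OF ab(2)] open_ball ab(1)]
    unfolding g1_def has_field_derivative_def .
  have d2: "((\<lambda>w. g a w) has_derivative (\<lambda>h. g2 * h)) (at b)"
    using holomorphic_derivI[OF holo2[OF ab(1)] open_ball ab(2)]
    unfolding g2_def has_field_derivative_def .
  have e1: "((\<lambda>x. g (fst x) b) has_derivative (\<lambda>x. g1 * fst x)) (at (a, b))"
    using has_derivative_compose[OF bounded_linear_imp_has_derivative[OF bounded_linear_fst, of "at (a, b)"],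
        of "\<lambda>z. g z b" "\<lambda>h. g1 * h"] d1 by simp
  have e2: "((\<lambda>x. g a (snd x)) has_derivative (\<lambda>x. g2 * snd x)) (at (a, b))"
    using has_derivative_compose[OF bounded_linear_imp_has_derivative[OF bounded_linear_snd, of "at (a, b)"],
        of "\<lambda>w. g a w" "\<lambda>h. g2 * h"] d2 by simp
  define r where "r = 1 - cmod a"
  define s where "s = 1 - cmod b"
  have rs: "r > 0" "s > 0" using ab by (auto simp: r_def s_def)
  have in_a: "z \<in> ball 0 1" if "z \<in> ball a r" for z
    using that norm_triangle_sub[of z a] by (simp add: r_def dist_norm norm_minus_commute)
  have in_b: "w \<in> ball 0 1" if "w \<in> ball b s" for w
    using that norm_triangle_sub[of w b] by (simp add: s_def dist_norm norm_minus_commute)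
  define C where "C = 4 / r * (4 * M / s)"
  have mixed: "cmod (E x) \<le> C * cmod (fst x - a) * cmod (snd x - b)"
    if "cmod (fst x - a) < r / 2" "cmod (snd x - b) < s / 2" for x
  proof -
    obtain z w where x: "x = (z, w)" by (cases x)
    have zw: "cmod (z - a) < r / 2" "cmod (w - b) < s / 2" using that x by auto
    have w_in: "w \<in> ball 0 1" by (rule in_b) (use zw rs in \<open>simp add: dist_norm norm_minus_commute\<close>)
    have lip: "cmod (g \<zeta> w - g \<zeta> b) \<le> 4 * M / s * cmod (w - b)" if "\<zeta> \<in> ball a r" for \<zeta>
    proof -
      have "cmod (g \<zeta> (b + (w - b)) - g \<zeta> b) \<le> 4 * M / s * cmod (w - b)"
      proof (rule bounded_holomorphic_lipschitz)
        show "(\<lambda>w. g \<zeta> w) holomorphic_on ball b s"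
          by (rule holomorphic_on_subset[OF holo2[OF in_a[OF that]]]) (use in_b in blast)
      qed (use bdd in_a[OF that] in_b rs zw in auto)
      then show ?thesis by simp
    qed
    have "cmod ((g (a + (z - a)) w - g (a + (z - a)) b) - (g a w - g a b)) \<le> 4 * (4 * M / s * cmod (w - b)) / r * cmod (z - a)"
    proof (rule bounded_holomorphic_lipschitz)
      show "(\<lambda>\<zeta>. g \<zeta> w - g \<zeta> b) holomorphic_on ball a r"
        by (intro holomorphic_on_diff; rule holomorphic_on_subset[OF holo1]) (use in_a w_in ab in blast)+
    qed (use lip rs zw in auto)
    then show ?thesis by (simp add: x E_def C_def algebra_simps)
  qed
  have E: "(E has_derivative (\<lambda>x. 0)) (at (a, b))"
    unfolding has_derivative_iff_norm
  proof (intro conjI bounded_linear_zero)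
    have E0: "E (a, b) = 0" by (simp add: E_def)
    show "((\<lambda>y. norm (E y - E (a, b) - 0) / norm (y - (a, b))) \<longlongrightarrow> 0) (at (a, b))"
    proof (rule tendsto_sandwich[of "\<lambda>_. 0" _ _ "\<lambda>y. \<bar>C\<bar> * norm (y - (a, b))"])
      have "((\<lambda>y. \<bar>C\<bar> * norm (y - (a, b))) \<longlongrightarrow> \<bar>C\<bar> * norm ((a, b) - (a, b))) (at (a, b))"
        by (intro tendsto_intros)
      then show "((\<lambda>y. \<bar>C\<bar> * norm (y - (a, b))) \<longlongrightarrow> 0) (at (a, b))" by simp
      have "norm (E y - E (a, b) - 0) / norm (y - (a, b)) \<le> \<bar>C\<bar> * norm (y - (a, b))"
        if "dist y (a, b) < min (r / 2) (s / 2)" for y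
      proof (cases "y = (a, b)")
        case False
        have n: "cmod (fst y - a) \<le> norm (y - (a, b))" "cmod (snd y - b) \<le> norm (y - (a, b))"
          using norm_fst_le[of "fst y - a" "snd y - b"] norm_snd_le[of "snd y - b" "fst y - a"]
          by (cases y; simp)+
        have "cmod (E y) \<le> C * cmod (fst y - a) * cmod (snd y - b)"
          by (rule mixed) (use n that in \<open>auto simp: dist_norm\<close>)
        also have "\<dots> \<le> \<bar>C\<bar> * cmod (fst y - a) * cmod (snd y - b)"
          by (intro mult_right_mono) auto
        also have "\<dots> \<le> \<bar>C\<bar> * norm (y - (a, b)) * norm (y - (a, b))"
          using n by (intro mult_mono) auto
        finally show ?thesis using False E0 by (simp add: pos_divide_le_eq)
      qed (simp add: E0)
      then show "\<forall>\<^sub>F y in at (a, b). norm (E y - E (a, b) - 0) / norm (y - (a, b)) \<le> \<bar>C\<bar> * norm (y - (a, b))"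
        unfolding eventually_at using rs by (intro exI[of _ "min (r / 2) (s / 2)"]) auto
    qed auto
  qed
  have "((\<lambda>x. E x + g (fst x) b + g a (snd x) - g a b) has_derivative (\<lambda>x. 0 + g1 * fst x + g2 * snd x - 0)) (at (a, b))"
    by (intro has_derivative_diff has_derivative_add E e1 e2 has_derivative_const)
  then have "((\<lambda>x. g (fst x) (snd x)) has_derivative (\<lambda>x. g1 * fst x + g2 * snd x)) (at (a, b))"
    by (simp add: E_def)
  then show ?thesis by blast
qed

lemma mholomorphic_onE:
  assumes "f mholomorphic_on \<Omega>" "z \<in> \<Omega>"
  obtains f' where "(f has_derivative f') (at z)" "\<And>c X. f' (c *s X) = c * f' X"
  using assms unfolding mholomorphic_on_def by blast

lemma mholomorphic_onI:
  "(\<And>z. z \<in> \<Omega> \<Longrightarrow> \<exists>f'. (f has_derivative f') (at z) \<and> (\<forall>c X. f' (c *s X) = c * f' X)) \<Longrightarrow> f mholomorphic_on \<Omega>"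
  unfolding mholomorphic_on_def by blast

lemma mholomorphic_on_continuous: "f mholomorphic_on \<Omega> \<Longrightarrow> continuous_on \<Omega> f"
  by (metis continuous_at_imp_continuous_on has_derivative_continuous mholomorphic_onE)

lemma mholomorphic_on_cong:
  assumes "open \<Omega>" "\<And>z. z \<in> \<Omega> \<Longrightarrow> f z = g z" "f mholomorphic_on \<Omega>"
  shows "g mholomorphic_on \<Omega>"
proof (rule mholomorphic_onI)
  fix z assume z: "z \<in> \<Omega>"
  obtain f' where f': "(f has_derivative f') (at z)" "\<And>c X. f' (c *s X) = c * f' X"
    by (rule mholomorphic_onE[OF assms(3) z]) blast
  have "(g has_derivative f') (at z)"
    by (rule has_derivative_transform_within_open[OF f'(1) assms(1) z assms(2)])
  then show "\<exists>f'. (g has_derivative f') (at z) \<and> (\<forall>c X. f' (c *s X) = c * f' X)"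
    using f'(2) by blast
qed

lemma mholomorphic_on_compose_bidisc:
  assumes u: "u mholomorphic_on \<Omega>" "u ` \<Omega> \<subseteq> ball 0 1" and v: "v mholomorphic_on \<Omega>" "v ` \<Omega> \<subseteq> ball 0 1"
    and holo1: "\<And>w. w \<in> ball 0 1 \<Longrightarrow> (\<lambda>z. g z w) holomorphic_on ball 0 1"
    and holo2: "\<And>z. z \<in> ball 0 1 \<Longrightarrow> (\<lambda>w. g z w) holomorphic_on ball 0 1"
    and bdd: "\<And>z w. z \<in> ball 0 1 \<Longrightarrow> w \<in> ball 0 1 \<Longrightarrow> cmod (g z w) \<le> M"
  shows "(\<lambda>z. g (u z) (v z)) mholomorphic_on \<Omega>"
proof (rule mholomorphic_onI)
  fix z assume z: "z \<in> \<Omega>"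
  obtain u' where u': "(u has_derivative u') (at z)" "\<And>c X. u' (c *s X) = c * u' X"
    by (rule mholomorphic_onE[OF u(1) z]) blast
  obtain v' where v': "(v has_derivative v') (at z)" "\<And>c X. v' (c *s X) = c * v' X"
    by (rule mholomorphic_onE[OF v(1) z]) blast
  have uv: "u z \<in> ball 0 1" "v z \<in> ball 0 1" using u v z by auto
  obtain g1 g2 where g: "((\<lambda>x. g (fst x) (snd x)) has_derivative (\<lambda>x. g1 * fst x + g2 * snd x)) (at (u z, v z))"
    using separately_holomorphic_has_derivative[OF holo1 holo2 bdd uv] by blast
  have "((\<lambda>z. g (fst (u z, v z)) (snd (u z, v z))) has_derivative
      (\<lambda>X. g1 * fst (u' X, v' X) + g2 * snd (u' X, v' X))) (at z)"
    by (rule has_derivative_compose[OF has_derivative_Pair[OF u'(1) v'(1)] g])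
  then have "((\<lambda>z. g (u z) (v z)) has_derivative (\<lambda>X. g1 * u' X + g2 * v' X)) (at z)" by simp
  moreover have "\<forall>c X. g1 * u' (c *s X) + g2 * v' (c *s X) = c * (g1 * u' X + g2 * v' X)"
    by (simp add: u' v' algebra_simps)
  ultimately show "\<exists>f'. ((\<lambda>z. g (u z) (v z)) has_derivative f') (at z) \<and> (\<forall>c X. f' (c *s X) = c * f' X)"
    by blast
qed

section \<open>The polynomial of Varopoulos and Kaijser\<close>

definition vpoly :: "complex \<Rightarrow> complex \<Rightarrow> complex \<Rightarrow> complex" where
  "vpoly x y z = x\<^sup>2 + y\<^sup>2 + z\<^sup>2 - 2 * x * y - 2 * x * z - 2 * y * z"

text \<open>For \<open>c\<^sup>2 \<le> 7/8\<close> the factor \<open>1 - c\<^sup>2\<close> is bounded below and \<open>4 c (w - c) \<le> (c + w)\<^sup>2\<close> suffices; otherwise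
  \<open>c + w\<close> is large and \<open>w - c \<le> 1 - c\<^sup>2\<close>.\<close>

lemma vpoly_real_inequality_aux:
  fixes c w :: real
  assumes c: "0 \<le> c" "c \<le> 1" and w: "c < w" "w \<le> 1"
  shows "2 * (c * (w - c)) \<le> 4 * (1 - c\<^sup>2) * (c + w)\<^sup>2"
proof (cases "c\<^sup>2 \<le> 7 / 8")
  case True
  have "(c + w)\<^sup>2 = 4 * (c * (w - c)) + ((w - c)\<^sup>2 + 4 * c\<^sup>2)" by algebra
  moreover have "0 \<le> (w - c)\<^sup>2 + 4 * c\<^sup>2" by simp
  ultimately have "4 * (c * (w - c)) \<le> (c + w)\<^sup>2" by (simp only: le_add_same_cancel1)
  then have "2 * (c * (w - c)) \<le> 1 / 2 * (c + w)\<^sup>2" by simp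
  also have "\<dots> \<le> 4 * (1 - c\<^sup>2) * (c + w)\<^sup>2" by (rule mult_right_mono) (use True in simp_all)
  finally show ?thesis .
next
  case False
  have "(2 * c)\<^sup>2 \<le> (c + w)\<^sup>2" by (rule power_mono) (use c w in simp_all)
  then have sq: "2 \<le> (c + w)\<^sup>2" using False by (simp add: power_mult_distrib)
  have "c * c \<le> 1 * c" by (rule mult_right_mono) (use c in simp_all)
  then have le: "w - c \<le> 1 - c\<^sup>2" using w by (simp add: power2_eq_square)
  have "c * (w - c) \<le> 1 * (w - c)" by (rule mult_right_mono) (use c w in simp_all)
  then have "2 * (c * (w - c)) \<le> 2 * (w - c)" by simp
  also have "\<dots> \<le> 4 * (w - c) * 2" using w by simp
  also have "\<dots> \<le> 4 * (1 - c\<^sup>2) * (c + w)\<^sup>2" by (rule mult_mono) (use le sq w in simp_all)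
  finally show ?thesis .
qed

lemma vpoly_real_inequality_nonneg:
  fixes c y :: real
  assumes c: "0 \<le> c" "c \<le> 1" and y: "\<bar>y\<bar> \<le> 1"
  shows "0 \<le> 4 * (1 - c\<^sup>2) * (c - y)\<^sup>2 + 2 * c * (c + y)"
proof (cases "c + y \<ge> 0")
  case True
  have "c\<^sup>2 \<le> 1" by (rule power_le_one) (use c in simp_all)
  then have "0 \<le> 4 * (1 - c\<^sup>2) * (c - y)\<^sup>2" by simp
  moreover have "0 \<le> 2 * c * (c + y)" using c True by simp
  ultimately show ?thesis by (rule add_nonneg_nonneg)
next
  case False
  have "2 * (c * (- y - c)) \<le> 4 * (1 - c\<^sup>2) * (c + - y)\<^sup>2"
    by (rule vpoly_real_inequality_aux) (use c y False in simp_all)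
  moreover have "2 * (c * (- y - c)) = - (2 * c * (c + y))" by algebra
  ultimately show ?thesis by simp
qed

lemma vpoly_real_inequality:
  fixes c y :: real
  assumes "\<bar>c\<bar> \<le> 1" "\<bar>y\<bar> \<le> 1"
  shows "0 \<le> 4 * (1 - c\<^sup>2) * (c - y)\<^sup>2 + 2 * c * (c + y)"
proof (cases "c \<ge> 0")
  case True
  then show ?thesis using vpoly_real_inequality_nonneg[of c y] assms by auto
next
  case False
  then have "0 \<le> 4 * (1 - (-c)\<^sup>2) * ((-c) - (-y))\<^sup>2 + 2 * (-c) * ((-c) + (-y))"
    using assms by (intro vpoly_real_inequality_nonneg) auto
  moreover have "((-c) - (-y))\<^sup>2 = (c - y)\<^sup>2" by (simp add: power2_commute)
  moreover have "2 * (-c) * ((-c) + (-y)) = 2 * c * (c + y)" by (simp add: algebra_simps)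
  ultimately show ?thesis by (simp only: power2_minus)
qed

text \<open>With \<open>c = Re \<mu>\<close> and \<open>y = Re \<zeta>\<close> the deficit \<open>25 - \<bar>vpoly\<bar>\<^sup>2\<close> is four times the expression in
  \<open>vpoly_real_inequality\<close>.\<close>

lemma norm_vpoly_torus_aux:
  assumes "cmod \<zeta> = 1" "cmod \<mu> = 1"
  shows "cmod (vpoly (\<zeta> * \<mu>) (\<zeta> * cnj \<mu>) 1) \<le> 5"
proof -
  define c s y x where "c = Re \<mu>" "s = Im \<mu>" "y = Re \<zeta>" "x = Im \<zeta>"
  note defs = this
  have cs: "c\<^sup>2 + s\<^sup>2 = 1" and yx: "y\<^sup>2 + x\<^sup>2 = 1"
    using assms by (auto simp: defs cmod_def)
  have \<mu>: "\<mu> = Complex c s" and \<zeta>: "\<zeta> = Complex y x" by (auto simp: defs)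
  have zz: "\<zeta> * cnj \<zeta> = 1" "\<mu> * cnj \<mu> = 1" using assms by (simp_all add: complex_norm_square[symmetric])
  have "vpoly (\<zeta> * \<mu>) (\<zeta> * cnj \<mu>) 1 = \<zeta>\<^sup>2 * (\<mu> - cnj \<mu>)\<^sup>2 + 1 - 2 * \<zeta> * (\<mu> + cnj \<mu>)"
    by (simp add: vpoly_def power2_eq_square algebra_simps)
  also have "\<mu> - cnj \<mu> = 2 * \<i> * of_real s" by (simp add: \<mu> complex_eq_iff)
  also have "\<mu> + cnj \<mu> = 2 * of_real c" by (simp add: \<mu> complex_eq_iff)
  finally have P: "vpoly (\<zeta> * \<mu>) (\<zeta> * cnj \<mu>) 1
      = \<zeta>\<^sup>2 * (2 * \<i> * of_real s)\<^sup>2 + 1 - 2 * \<zeta> * (2 * of_real c)" .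
  have "vpoly (\<zeta> * \<mu>) (\<zeta> * cnj \<mu>) 1 * cnj \<zeta>
      = - 4 * of_real (s\<^sup>2) * \<zeta> * (\<zeta> * cnj \<zeta>) + cnj \<zeta> - 4 * of_real c * (\<zeta> * cnj \<zeta>)"
    unfolding P by (simp add: power2_eq_square algebra_simps)
  then have eq: "vpoly (\<zeta> * \<mu>) (\<zeta> * cnj \<mu>) 1 * cnj \<zeta> = Complex ((1 - 4 * s\<^sup>2) * y - 4 * c) (- (1 + 4 * s\<^sup>2) * x)"
    unfolding zz by (simp add: \<zeta> complex_eq_iff algebra_simps)
  have "(cmod (vpoly (\<zeta> * \<mu>) (\<zeta> * cnj \<mu>) 1))\<^sup>2 = (cmod (vpoly (\<zeta> * \<mu>) (\<zeta> * cnj \<mu>) 1 * cnj \<zeta>))\<^sup>2"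
    using assms by (simp add: norm_mult)
  also have "\<dots> = ((1 - 4 * s\<^sup>2) * y - 4 * c)\<^sup>2 + (1 + 4 * s\<^sup>2)\<^sup>2 * x\<^sup>2"
    unfolding eq cmod_power2 by (simp add: power2_eq_square algebra_simps)
  also have "\<dots> = 25 - 4 * (4 * (1 - c\<^sup>2) * (c - y)\<^sup>2 + 2 * c * (c + y))"
  proof -
    have s: "s\<^sup>2 = 1 - c\<^sup>2" and x: "x\<^sup>2 = 1 - y\<^sup>2" using cs yx by simp_all
    show ?thesis unfolding s x by algebra
  qed
  also have "\<dots> \<le> 5\<^sup>2"
  proof -
    have "\<bar>c\<bar> \<le> 1" "\<bar>y\<bar> \<le> 1"
      using abs_Re_le_cmod[of \<mu>] abs_Re_le_cmod[of \<zeta>] assms by (auto simp: defs)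
    moreover have "25 - 4 * t \<le> 5\<^sup>2" if "0 \<le> t" for t :: real using that by simp
    ultimately show ?thesis using vpoly_real_inequality by blast
  qed
  finally show ?thesis by (rule power2_le_imp_le) simp
qed

text \<open>By homogeneity \<open>z = 1\<close>. Writing the remaining two variables as \<open>\<zeta> \<mu>\<close> and \<open>\<zeta> \<cdot> cnj \<mu>\<close>, with \<open>\<zeta>\<close> a square root of
  their product, reduces the modulus to two real parameters.\<close>

lemma norm_vpoly_torus:
  assumes "cmod x = 1" "cmod y = 1" "cmod z = 1"
  shows "cmod (vpoly x y z) \<le> 5"
proof -
  define u v where "u = x * cnj z" "v = y * cnj z"
  note uv = this
  have zz: "z * cnj z = 1" using assms by (simp add: complex_norm_square[symmetric])
  have xy: "x = u * z" "y = v * z" using zz by (simp_all add: uv mult.assoc mult.commute[of "cnj z"])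
  have nuv: "cmod u = 1" "cmod v = 1" using assms by (auto simp: uv norm_mult)
  define \<zeta> where "\<zeta> = csqrt (u * v)"
  have \<zeta>2: "\<zeta> * \<zeta> = u * v" using power2_csqrt[of "u * v"] by (simp add: \<zeta>_def power2_eq_square)
  have "cmod \<zeta> * cmod \<zeta> = 1" using arg_cong[OF \<zeta>2, of cmod] nuv by (simp add: norm_mult)
  then have n\<zeta>: "cmod \<zeta> = 1" by (simp add: square_eq_1_iff) (use norm_ge_zero[of \<zeta>] in linarith)
  define \<mu> where "\<mu> = u * cnj \<zeta>"
  have n\<mu>: "cmod \<mu> = 1" using nuv n\<zeta> by (simp add: \<mu>_def norm_mult)
  have zz': "\<zeta> * cnj \<zeta> = 1" "u * cnj u = 1" using n\<zeta> nuv by (simp_all add: complex_norm_square[symmetric])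
  have "\<zeta> * \<mu> = u * (\<zeta> * cnj \<zeta>)" by (simp add: \<mu>_def)
  then have 1: "\<zeta> * \<mu> = u" using zz' by simp
  have "\<zeta> * cnj \<mu> = (\<zeta> * \<zeta>) * cnj u" by (simp add: \<mu>_def)
  also have "\<dots> = v * (u * cnj u)" unfolding \<zeta>2 by simp
  finally have 2: "\<zeta> * cnj \<mu> = v" using zz' by simp
  have "vpoly x y z = z\<^sup>2 * vpoly u v 1" unfolding xy vpoly_def by (simp add: power2_eq_square algebra_simps)
  then have "cmod (vpoly x y z) = cmod (vpoly u v 1)" using assms by (simp add: norm_mult norm_power)
  also have "\<dots> \<le> 5" using norm_vpoly_torus_aux[OF n\<zeta> n\<mu>] unfolding 1 2 .
  finally show ?thesis .
qed

lemma maximum_modulus_unit_disc: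
  assumes "f holomorphic_on UNIV" "\<And>z. cmod z = 1 \<Longrightarrow> cmod (f z) \<le> B" "cmod z \<le> 1"
  shows "cmod (f z) \<le> B"
proof (rule maximum_modulus_frontier[of f "cball 0 1"])
  show "f holomorphic_on interior (cball 0 1)" "continuous_on (closure (cball 0 1)) f"
    by (rule holomorphic_on_subset[OF assms(1) subset_UNIV],
      rule continuous_on_subset[OF holomorphic_on_imp_continuous_on[OF assms(1)] subset_UNIV])
qed (use assms in auto)

lemma vpoly_holomorphic:
  "(\<lambda>x. vpoly x y z) holomorphic_on A" "(\<lambda>y. vpoly x y z) holomorphic_on A" "(\<lambda>z. vpoly x y z) holomorphic_on A"
  unfolding vpoly_def by (intro holomorphic_intros)+

lemma norm_vpoly_le:
  assumes "cmod x \<le> 1" "cmod y \<le> 1" "cmod z \<le> 1"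
  shows "cmod (vpoly x y z) \<le> 5"
proof -
  have 1: "cmod (vpoly x y z) \<le> 5" if "cmod x \<le> 1" "cmod y = 1" "cmod z = 1" for x y z
    by (rule maximum_modulus_unit_disc[OF vpoly_holomorphic(1) norm_vpoly_torus that(1)]) (use that in auto)
  have 2: "cmod (vpoly x y z) \<le> 5" if "cmod x \<le> 1" "cmod y \<le> 1" "cmod z = 1" for x y z
    by (rule maximum_modulus_unit_disc[OF vpoly_holomorphic(2) 1 that(2)]) (use that in auto)
  show ?thesis
    by (rule maximum_modulus_unit_disc[OF vpoly_holomorphic(3) 2 assms(3)]) (use assms in auto)
qed

section \<open>A kernel that separates the Schur class of the tridisc\<close>

text \<open>The components of \<open>vkernel\<close> by degree: \<open>1\<close> in degree \<open>0\<close>, the sum of the \<open>t\<^sub>j = z\<^sub>j \<cdot> cnj w\<^sub>j\<close> in degree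
  \<open>1\<close>, seven times the Szego kernel minus \<open>14/13\<close> times the Hermitian square of \<open>vquad\<close> in degree \<open>2\<close>, and seven times the Szego kernel
  from degree \<open>3\<close> on. It perturbs the finite-dimensional example of Varopoulos and Kaijser: there the
  degree \<open>2\<close> part of the space is one-dimensional, dual to \<open>vquad\<close>; the part of degree \<open>3\<close> and higher only has
  to be large. A factor above \<open>27/4\<close> is needed for the separation; for the factor \<open>7\<close>, the coefficient \<open>14/13\<close> is
  the largest that keeps the coordinates contractive. The primed arguments of \<open>vkernel\<close> stand for the conjugated
  coordinates of the second point, which makes the identities below polynomial.\<close>

definition vquad :: "complex \<Rightarrow> complex \<Rightarrow> complex \<Rightarrow> complex" where
  "vquad x y z = x\<^sup>2 + y\<^sup>2 + z\<^sup>2 - x * y - x * z - y * z"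

definition vkernel :: "complex \<Rightarrow> complex \<Rightarrow> complex \<Rightarrow> complex \<Rightarrow> complex \<Rightarrow> complex \<Rightarrow> complex" where
  "vkernel a b c a' b' c' = 7 / ((1 - a * a') * (1 - b * b') * (1 - c * c'))
     - 6 * (1 + a * a' + b * b' + c * c') - 14 / 13 * (vquad a b c * vquad a' b' c')"

lemma vkernel_swap:
  "vkernel b a c b' a' c' = vkernel a b c a' b' c'" "vkernel c b a c' b' a' = vkernel a b c a' b' c'"
  by (simp_all add: vkernel_def vquad_def algebra_simps)

text \<open>Cauchy-Schwarz with equality, since \<open>14/13 \<cdot> (3/7 + 3/6) = 1\<close>.\<close>

lemma quadratic_sos:
  fixes x1 x2 x3 y1 y2 y3 x1' x2' x3' y1' y2' y3' :: complex
  shows "7 * (x1 * x1' + x2 * x2' + x3 * x3') + 6 * (y1 * y1' + y2 * y2' + y3 * y3')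
      - 14 / 13 * ((x1 + x2 + x3 + y1 + y2 + y3) * (x1' + x2' + x3' + y1' + y2' + y3'))
    = 7 / 3 * ((x1 - x2) * (x1' - x2') + (x1 - x3) * (x1' - x3') + (x2 - x3) * (x2' - x3'))
      + 2 * ((y1 - y2) * (y1' - y2') + (y1 - y3) * (y1' - y3') + (y2 - y3) * (y2' - y3'))
      + 1 / 39 * ((7 * (x1 + x2 + x3) - 6 * (y1 + y2 + y3)) * (7 * (x1' + x2' + x3') - 6 * (y1' + y2' + y3')))"
  by (simp add: field_simps)

text \<open>The Szego kernel of the bidisc, with the terms of degree at least \<open>3\<close> grouped so that each group is visibly
  positive.\<close>

lemma szego_product_expansion:
  fixes t r s s' :: complex
  assumes "s * (1 - t) = 1" "s' * (1 - r) = 1"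
  shows "s * s' = 1 + t + r + (t\<^sup>2 + t * r + r\<^sup>2) + (t ^ 3 * s + t\<^sup>2 * r * s + t * r\<^sup>2 * s + r ^ 3 * s * s')"
  using assms by algebra

lemma vkernel_decomposition:
  fixes a b c a' b' c' :: complex
  assumes "a * a' \<noteq> 1" "b * b' \<noteq> 1" "c * c' \<noteq> 1"
  shows "(1 - a * a') * vkernel a b c a' b' c' - 1 = b * b' + c * c'
    + (7 / 3 * ((b\<^sup>2 - c\<^sup>2) * (b'\<^sup>2 - c'\<^sup>2) + (b\<^sup>2 + b * c) * (b'\<^sup>2 + b' * c') + (c\<^sup>2 + b * c) * (c'\<^sup>2 + b' * c'))
      + 2 * ((a\<^sup>2 + a * b) * (a'\<^sup>2 + a' * b') + (a\<^sup>2 + a * c) * (a'\<^sup>2 + a' * c') + (a * c - a * b) * (a' * c' - a' * b'))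
      + 1 / 39 * ((7 * (b\<^sup>2 + c\<^sup>2 - b * c) - 6 * (a\<^sup>2 - a * b - a * c)) * (7 * (b'\<^sup>2 + c'\<^sup>2 - b' * c') - 6 * (a'\<^sup>2 - a' * b' - a' * c'))))
    + 14 / 13 * ((a * vquad a b c) * (a' * vquad a' b' c'))
    + 7 * (b ^ 3 * b' ^ 3 / (1 - b * b') + (b\<^sup>2 * c) * (b'\<^sup>2 * c') / (1 - b * b') + (b * c\<^sup>2) * (b' * c'\<^sup>2) / (1 - b * b')
        + c ^ 3 * c' ^ 3 / (1 - b * b') / (1 - c * c'))"
proof -
  define s where "s = 1 / (1 - b * b')"
  define s' where "s' = 1 / (1 - c * c')"
  have s: "s * (1 - b * b') = 1" "s' * (1 - c * c') = 1" using assms by (simp_all add: s_def s'_def)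
  have div: "x / (1 - b * b') = x * s" "x / (1 - c * c') = x * s'" for x by (simp_all add: s_def s'_def)
  have cancel: "X * (7 / (X * Y * Z)) = 7 * (1 / Y * (1 / Z))" if "X \<noteq> 0" for X Y Z :: complex
    using that by simp
  have "1 - a * a' \<noteq> 0" using assms(1) by simp
  then have "(1 - a * a') * (7 / ((1 - a * a') * (1 - b * b') * (1 - c * c'))) = 7 * (s * s')"
    unfolding s_def s'_def by (rule cancel)
  then have "(1 - a * a') * vkernel a b c a' b' c' = 7 * (s * s')
      - (1 - a * a') * (6 * (1 + a * a' + b * b' + c * c') + 14 / 13 * (vquad a b c * vquad a' b' c'))"
    unfolding vkernel_def by (simp add: algebra_simps)
  also have "s * s' = 1 + b * b' + c * c' + ((b * b')\<^sup>2 + (b * b') * (c * c') + (c * c')\<^sup>2)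
     + ((b * b') ^ 3 * s + (b * b')\<^sup>2 * (c * c') * s + (b * b') * (c * c')\<^sup>2 * s + (c * c') ^ 3 * s * s')"
    by (rule szego_product_expansion[OF s])
  finally have 1: "(1 - a * a') * vkernel a b c a' b' c' - 1 = b * b' + c * c'
     + (7 * ((b * b')\<^sup>2 + (c * c')\<^sup>2 + (b * b') * (c * c')) + 6 * ((a * a')\<^sup>2 + (a * a') * (b * b') + (a * a') * (c * c'))
         - 14 / 13 * (vquad a b c * vquad a' b' c'))
     + 14 / 13 * ((a * vquad a b c) * (a' * vquad a' b' c'))
     + 7 * ((b * b') ^ 3 * s + (b * b')\<^sup>2 * (c * c') * s + (b * b') * (c * c')\<^sup>2 * s + (c * c') ^ 3 * s * s')"
    by (simp add: algebra_simps power2_eq_square diff_divide_distrib add_divide_distrib)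
  have q: "vquad a b c = b\<^sup>2 + c\<^sup>2 + (- (b * c)) + a\<^sup>2 + (- (a * b)) + (- (a * c))" for a b c
    by (simp add: vquad_def)
  have 2: "7 * ((b * b')\<^sup>2 + (c * c')\<^sup>2 + (b * b') * (c * c')) + 6 * ((a * a')\<^sup>2 + (a * a') * (b * b') + (a * a') * (c * c'))
         - 14 / 13 * (vquad a b c * vquad a' b' c')
     = 7 / 3 * ((b\<^sup>2 - c\<^sup>2) * (b'\<^sup>2 - c'\<^sup>2) + (b\<^sup>2 + b * c) * (b'\<^sup>2 + b' * c') + (c\<^sup>2 + b * c) * (c'\<^sup>2 + b' * c'))
      + 2 * ((a\<^sup>2 + a * b) * (a'\<^sup>2 + a' * b') + (a\<^sup>2 + a * c) * (a'\<^sup>2 + a' * c') + (a * c - a * b) * (a' * c' - a' * b'))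
      + 1 / 39 * ((7 * (b\<^sup>2 + c\<^sup>2 - b * c) - 6 * (a\<^sup>2 - a * b - a * c)) * (7 * (b'\<^sup>2 + c'\<^sup>2 - b' * c') - 6 * (a'\<^sup>2 - a' * b' - a' * c')))"
    using quadratic_sos[of "b\<^sup>2" "b'\<^sup>2" "c\<^sup>2" "c'\<^sup>2" "- (b * c)" "- (b' * c')" "a\<^sup>2" "a'\<^sup>2" "- (a * b)" "- (a' * b')" "- (a * c)" "- (a' * c')"]
    unfolding q by (simp add: power_mult_distrib mult_ac)
  show ?thesis unfolding 1 2 div by (simp add: power_mult_distrib mult_ac)
qed

lemma mult_cnj_neq_one:
  assumes "cmod x < 1" "cmod y < 1" shows "x * cnj y \<noteq> 1"
proof -
  have "cmod (x * cnj y) < 1 * 1"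
    unfolding norm_mult complex_mod_cnj using assms by (intro mult_strict_mono') auto
  then show ?thesis by auto
qed

abbreviation "vkernel_of u1 u2 u3 z w \<equiv>
  vkernel (u1 z) (u2 z) (u3 z) (cnj (u1 w)) (cnj (u2 w)) (cnj (u3 w))"

text \<open>In \<open>(1 - t\<^sub>1) \<cdot> vkernel\<close> the first variable disappears from the Szego kernel. The degree \<open>2\<close> part is the
  sum of squares of \<open>quadratic_sos\<close>, and all other parts are sums of positive kernels. The constant \<open>1\<close> is
  subtracted because \<open>vkernel - 1\<close> has to be positive as well.\<close>

lemma vkernel_defect_psd:
  assumes u: "\<And>z. z \<in> A \<Longrightarrow> cmod (u1 z) < 1" "\<And>z. z \<in> A \<Longrightarrow> cmod (u2 z) < 1" "\<And>z. z \<in> A \<Longrightarrow> cmod (u3 z) < 1"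
  shows "psd_on A (\<lambda>z w. (1 - u1 z * cnj (u1 w)) * vkernel_of u1 u2 u3 z w - 1)"
proof -
  define r :: "('a \<Rightarrow> complex) \<Rightarrow> 'a \<Rightarrow> 'a \<Rightarrow> complex" where "r g = (\<lambda>z w. g z * cnj (g w))" for g
  have r: "psd_on A (r g)" for g unfolding r_def by (rule psd_on_rank_one)
  define H where "H z w = r u2 z w + r u3 z w
    + (of_real (7 / 3) * (r (\<lambda>z. (u2 z)\<^sup>2 - (u3 z)\<^sup>2) z w + r (\<lambda>z. (u2 z)\<^sup>2 + u2 z * u3 z) z w
         + r (\<lambda>z. (u3 z)\<^sup>2 + u2 z * u3 z) z w)
      + of_real 2 * (r (\<lambda>z. (u1 z)\<^sup>2 + u1 z * u2 z) z w + r (\<lambda>z. (u1 z)\<^sup>2 + u1 z * u3 z) z w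
         + r (\<lambda>z. u1 z * u3 z - u1 z * u2 z) z w)
      + of_real (1 / 39) * r (\<lambda>z. 7 * ((u2 z)\<^sup>2 + (u3 z)\<^sup>2 - u2 z * u3 z) - 6 * ((u1 z)\<^sup>2 - u1 z * u2 z - u1 z * u3 z)) z w)
    + of_real (14 / 13) * r (\<lambda>z. u1 z * vquad (u1 z) (u2 z) (u3 z)) z w
    + of_real 7 * (r (\<lambda>z. u2 z ^ 3) z w / (1 - u2 z * cnj (u2 w)) + r (\<lambda>z. (u2 z)\<^sup>2 * u3 z) z w / (1 - u2 z * cnj (u2 w))
        + r (\<lambda>z. u2 z * (u3 z)\<^sup>2) z w / (1 - u2 z * cnj (u2 w))
        + r (\<lambda>z. u3 z ^ 3) z w / (1 - u2 z * cnj (u2 w)) / (1 - u3 z * cnj (u3 w)))" for z w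
  have "psd_on A (\<lambda>z w. H z w)"
    unfolding H_def by (intro psd_on_add psd_on_scale psd_on_szego r u) auto
  moreover have "(1 - u1 z * cnj (u1 w)) * vkernel_of u1 u2 u3 z w - 1 = H z w" if "z \<in> A" "w \<in> A" for z w
    unfolding H_def r_def using that u
    by (subst vkernel_decomposition) (simp_all add: mult_cnj_neq_one vquad_def)
  ultimately show ?thesis by (subst psd_on_cong[where H = "\<lambda>z w. H z w"]) auto
qed

lemma vkernel_psd:
  assumes u: "\<And>z. z \<in> A \<Longrightarrow> cmod (u1 z) < 1" "\<And>z. z \<in> A \<Longrightarrow> cmod (u2 z) < 1" "\<And>z. z \<in> A \<Longrightarrow> cmod (u3 z) < 1"
  shows "psd_on A (\<lambda>z w. vkernel_of u1 u2 u3 z w - 1)" "psd_on A (vkernel_of u1 u2 u3)"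
    "psd_on A (\<lambda>z w. (1 - u1 z * cnj (u1 w)) * vkernel_of u1 u2 u3 z w)"
    "psd_on A (\<lambda>z w. (1 - u2 z * cnj (u2 w)) * vkernel_of u1 u2 u3 z w)"
    "psd_on A (\<lambda>z w. (1 - u3 z * cnj (u3 w)) * vkernel_of u1 u2 u3 z w)"
proof -
  have defect: "psd_on A (\<lambda>z w. (1 - v1 z * cnj (v1 w)) * vkernel_of v1 v2 v3 z w)"
    if "\<And>z. z \<in> A \<Longrightarrow> cmod (v1 z) < 1" "\<And>z. z \<in> A \<Longrightarrow> cmod (v2 z) < 1" "\<And>z. z \<in> A \<Longrightarrow> cmod (v3 z) < 1" for v1 v2 v3
    using psd_on_add[OF vkernel_defect_psd[OF that] psd_on_one] by simp
  show "psd_on A (\<lambda>z w. (1 - u1 z * cnj (u1 w)) * vkernel_of u1 u2 u3 z w)" using defect[OF u] .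
  show "psd_on A (\<lambda>z w. (1 - u2 z * cnj (u2 w)) * vkernel_of u1 u2 u3 z w)"
    using defect[OF u(2) u(1) u(3)] unfolding vkernel_swap(1)[of "u1 _" "u2 _"] .
  show "psd_on A (\<lambda>z w. (1 - u3 z * cnj (u3 w)) * vkernel_of u1 u2 u3 z w)"
    using defect[OF u(3) u(2) u(1)] unfolding vkernel_swap(2)[of "u1 _" "u2 _"] .
  have "psd_on A (\<lambda>z w. (((1 - u1 z * cnj (u1 w)) * vkernel_of u1 u2 u3 z w - 1) + u1 z * cnj (u1 w)) / (1 - u1 z * cnj (u1 w)))"
    by (intro psd_on_szego psd_on_add vkernel_defect_psd psd_on_rank_one u)
  moreover have "(((1 - u1 z * cnj (u1 w)) * vkernel_of u1 u2 u3 z w - 1) + u1 z * cnj (u1 w)) / (1 - u1 z * cnj (u1 w))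
      = vkernel_of u1 u2 u3 z w - 1" if "z \<in> A" "w \<in> A" for z w
  proof -
    have "(((1 - P) * K - 1) + P) / (1 - P) = K - 1" if "P \<noteq> 1" for P K :: complex
    proof -
      have "((1 - P) * K - 1) + P = (1 - P) * (K - 1)" by (simp add: algebra_simps)
      then show ?thesis using that by simp
    qed
    then show ?thesis using mult_cnj_neq_one[OF u(1)[OF that(1)] u(1)[OF that(2)]] by blast
  qed
  ultimately show 1: "psd_on A (\<lambda>z w. vkernel_of u1 u2 u3 z w - 1)"
    by (subst (asm) psd_on_cong[where H = "\<lambda>z w. vkernel_of u1 u2 u3 z w - 1"]) auto
  show "psd_on A (vkernel_of u1 u2 u3)"
    using psd_on_add[OF 1 psd_on_one] by simp
qed

text \<open>The terms of degree at least \<open>3\<close> of the Szego kernel, at points scaled by \<open>\<tau>\<close>, are \<open>O(\<tau>\<^sup>3)\<close>.\<close>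

lemma szego_remainder_tendsto:
  fixes \<alpha> \<beta> \<gamma> :: real
  assumes "\<bar>\<alpha>\<bar> \<le> 1" "\<bar>\<beta>\<bar> \<le> 1" "\<bar>\<gamma>\<bar> \<le> 1"
  shows "((\<lambda>\<tau>. (1 / ((1 - \<tau> * \<alpha>) * (1 - \<tau> * \<beta>) * (1 - \<tau> * \<gamma>)) - 1 - \<tau> * (\<alpha> + \<beta> + \<gamma>)
      - \<tau>\<^sup>2 * (\<alpha>\<^sup>2 + \<beta>\<^sup>2 + \<gamma>\<^sup>2 + \<alpha> * \<beta> + \<alpha> * \<gamma> + \<beta> * \<gamma>)) / \<tau>\<^sup>2) \<longlongrightarrow> 0) (at_right 0)"
proof -
  define F where "F \<tau> = (\<alpha> ^ 3 / (1 - \<tau> * \<alpha>) + \<alpha>\<^sup>2 * \<beta> / (1 - \<tau> * \<alpha>) + \<alpha> * \<beta>\<^sup>2 / (1 - \<tau> * \<alpha>)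
      + \<beta> ^ 3 / ((1 - \<tau> * \<alpha>) * (1 - \<tau> * \<beta>))
      + \<gamma> * (\<alpha>\<^sup>2 / (1 - \<tau> * \<alpha>) + \<alpha> * \<beta> / (1 - \<tau> * \<alpha>) + \<beta>\<^sup>2 / ((1 - \<tau> * \<alpha>) * (1 - \<tau> * \<beta>)))
      + \<gamma>\<^sup>2 * (\<alpha> / (1 - \<tau> * \<alpha>) + \<beta> / ((1 - \<tau> * \<alpha>) * (1 - \<tau> * \<beta>)))
      + \<gamma> ^ 3 / ((1 - \<tau> * \<alpha>) * (1 - \<tau> * \<beta>) * (1 - \<tau> * \<gamma>)))" for \<tau>
  have "((\<lambda>\<tau>. \<tau> * F \<tau>) \<longlongrightarrow> 0 * F 0) (at_right 0)"
    unfolding F_def by (intro tendsto_intros) auto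
  moreover have "\<tau> * F \<tau> = (1 / ((1 - \<tau> * \<alpha>) * (1 - \<tau> * \<beta>) * (1 - \<tau> * \<gamma>)) - 1 - \<tau> * (\<alpha> + \<beta> + \<gamma>)
      - \<tau>\<^sup>2 * (\<alpha>\<^sup>2 + \<beta>\<^sup>2 + \<gamma>\<^sup>2 + \<alpha> * \<beta> + \<alpha> * \<gamma> + \<beta> * \<gamma>)) / \<tau>\<^sup>2" if \<tau>: "0 < \<tau>" "\<tau> < 1" for \<tau>
  proof -
    have ne: "1 - \<tau> * x \<noteq> 0" if "\<bar>x\<bar> \<le> 1" for x
    proof -
      have "\<tau> * x \<le> \<tau> * 1" using \<tau> that by (intro mult_left_mono) auto
      then show ?thesis using \<tau> by linarith
    qed
    define s1 s2 s3 where "s1 = 1 / (1 - \<tau> * \<alpha>)" "s2 = 1 / (1 - \<tau> * \<beta>)" "s3 = 1 / (1 - \<tau> * \<gamma>)"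
    note s_defs = this
    have s: "s1 * (1 - \<tau> * \<alpha>) = 1" "s2 * (1 - \<tau> * \<beta>) = 1" "s3 * (1 - \<tau> * \<gamma>) = 1"
      using ne[OF assms(1)] ne[OF assms(2)] ne[OF assms(3)] by (simp_all add: s_defs)
    have F: "F \<tau> = \<alpha> ^ 3 * s1 + \<alpha>\<^sup>2 * \<beta> * s1 + \<alpha> * \<beta>\<^sup>2 * s1 + \<beta> ^ 3 * s1 * s2
      + \<gamma> * (\<alpha>\<^sup>2 * s1 + \<alpha> * \<beta> * s1 + \<beta>\<^sup>2 * s1 * s2) + \<gamma>\<^sup>2 * (\<alpha> * s1 + \<beta> * s1 * s2) + \<gamma> ^ 3 * s1 * s2 * s3"
      by (simp add: F_def s_defs)
    have S: "1 / ((1 - \<tau> * \<alpha>) * (1 - \<tau> * \<beta>) * (1 - \<tau> * \<gamma>)) = s1 * s2 * s3" by (simp add: s_defs)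
    have "\<tau> ^ 3 * F \<tau> = s1 * s2 * s3 - 1 - \<tau> * (\<alpha> + \<beta> + \<gamma>)
      - \<tau>\<^sup>2 * (\<alpha>\<^sup>2 + \<beta>\<^sup>2 + \<gamma>\<^sup>2 + \<alpha> * \<beta> + \<alpha> * \<gamma> + \<beta> * \<gamma>)"
      unfolding F using s by algebra
    moreover have "\<tau> ^ 3 * F \<tau> / \<tau>\<^sup>2 = \<tau> * F \<tau>" using \<tau> by (simp add: power2_eq_square power3_eq_cube)
    ultimately show ?thesis unfolding S by simp
  qed
  then have "\<forall>\<^sub>F \<tau> in at_right 0. \<tau> * F \<tau> = (1 / ((1 - \<tau> * \<alpha>) * (1 - \<tau> * \<beta>) * (1 - \<tau> * \<gamma>)) - 1 - \<tau> * (\<alpha> + \<beta> + \<gamma>)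
      - \<tau>\<^sup>2 * (\<alpha>\<^sup>2 + \<beta>\<^sup>2 + \<gamma>\<^sup>2 + \<alpha> * \<beta> + \<alpha> * \<gamma> + \<beta> * \<gamma>)) / \<tau>\<^sup>2"
    by (rule eventually_mono[OF eventually_at_right_real[of 0 1], rotated]) auto
  ultimately show ?thesis using Lim_transform_eventually by fastforce
qed

lemma sum_product_square:
  fixes W g :: "nat \<Rightarrow> real"
  shows "(\<Sum>i<n. \<Sum>j<n. W i * W j * (g i * g j)) = (\<Sum>i<n. W i * g i)\<^sup>2"
  unfolding power2_eq_square sum_product by (simp add: mult_ac)

text \<open>If \<open>f = vpoly / 5\<close> were a contractive multiplier, then \<open>vkernel - f \<cdot> cnj f\<close> would be positive, because \<open>vkernel - 1\<close> is.
  Test it with twelve points, scaled by \<open>t\<close>, and weights that annihilate the polynomials of degree at most \<open>1\<close> and pair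
  with the squares to \<open>1\<close> and with the mixed products to \<open>- 1\<close>. The functional takes the values \<open>6\<close> on \<open>vquad\<close>
  and \<open>9\<close> on \<open>vpoly\<close>, so at order \<open>t\<^sup>4\<close> the kernel contributes \<open>7 \<cdot> 6 - 14/13 \<cdot> 36 = 42/13\<close> and the function
  \<open>81/25\<close>, which is larger.\<close>

lemma vkernel_not_multiplier:
  assumes points: "\<And>x y z :: real. \<bar>x\<bar> < 1 \<Longrightarrow> \<bar>y\<bar> < 1 \<Longrightarrow> \<bar>z\<bar> < 1 \<Longrightarrow>
      \<exists>p\<in>A. u1 p = of_real x \<and> u2 p = of_real y \<and> u3 p = of_real z"
    and u: "\<And>z. z \<in> A \<Longrightarrow> cmod (u1 z) < 1" "\<And>z. z \<in> A \<Longrightarrow> cmod (u2 z) < 1" "\<And>z. z \<in> A \<Longrightarrow> cmod (u3 z) < 1"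
    and f: "\<And>z. z \<in> A \<Longrightarrow> f z = vpoly (u1 z) (u2 z) (u3 z) / 5"
    and psd: "psd_on A (\<lambda>z w. (1 - f z * cnj (f w)) * vkernel_of u1 u2 u3 z w)"
  shows False
proof -
  have "psd_on A (\<lambda>z w. (1 - f z * cnj (f w)) * vkernel_of u1 u2 u3 z w + f z * cnj (f w) * (vkernel_of u1 u2 u3 z w - 1))"
    by (intro psd_on_add psd psd_on_conjugate vkernel_psd(1) u)
  then have psd': "psd_on A (\<lambda>z w. vkernel_of u1 u2 u3 z w - f z * cnj (f w))"
    by (simp add: algebra_simps)
  (* The points (X i, Y i, Z i): the permutations of (1, -1, 0) with weight 1/2 and
     the positive and negative unit vectors with weight -1/2. *)
  define X where "X i = [1, -1, 1, -1, 0, 0, 1, -1, 0, 0, 0, 0::real] ! i" for i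
  define Y where "Y i = [-1, 1, 0, 0, 1, -1, 0, 0, 1, -1, 0, 0::real] ! i" for i
  define Z where "Z i = [0, 0, -1, 1, -1, 1, 0, 0, 0, 0, 1, -1::real] ! i" for i
  define W where "W i = (if i < 6 then 1 / 2 else - 1 / 2 :: real)" for i :: nat
  have range: "\<bar>X i\<bar> \<le> 1" "\<bar>Y i\<bar> \<le> 1" "\<bar>Z i\<bar> \<le> 1" if "i < 12" for i
  proof -
    have "\<forall>i\<in>{..<12}. \<bar>X i\<bar> \<le> 1 \<and> \<bar>Y i\<bar> \<le> 1 \<and> \<bar>Z i\<bar> \<le> 1"
      by (simp add: numeral_eq_Suc lessThan_Suc X_def Y_def Z_def)
    then show "\<bar>X i\<bar> \<le> 1" "\<bar>Y i\<bar> \<le> 1" "\<bar>Z i\<bar> \<le> 1" using that by auto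
  qed
  have prod_range: "\<bar>g i * g j\<bar> \<le> 1" if "\<bar>g i\<bar> \<le> 1" "\<bar>g j\<bar> \<le> 1" for g :: "nat \<Rightarrow> real" and i j
    using that mult_mono[of "\<bar>g i\<bar>" 1 "\<bar>g j\<bar>" 1] by (simp add: abs_mult)
  define q where "q i = (X i)\<^sup>2 + (Y i)\<^sup>2 + (Z i)\<^sup>2 - X i * Y i - X i * Z i - Y i * Z i" for i
  define v where "v i = (X i)\<^sup>2 + (Y i)\<^sup>2 + (Z i)\<^sup>2 - 2 * X i * Y i - 2 * X i * Z i - 2 * Y i * Z i" for i
  define S where "S \<tau> i j = 1 / ((1 - \<tau> * (X i * X j)) * (1 - \<tau> * (Y i * Y j)) * (1 - \<tau> * (Z i * Z j)))" for \<tau> i j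
  define d where "d \<tau> i j = 7 * S \<tau> i j - 6 * (1 + \<tau> * (X i * X j + Y i * Y j + Z i * Z j))
      - \<tau>\<^sup>2 * (14 / 13 * (q i * q j) + v i * v j / 25)" for \<tau> i j
  have form: "0 \<le> (\<Sum>i<12. \<Sum>j<12. W i * W j * d (t\<^sup>2) i j)" if t: "0 < t" "t < 1" for t
  proof -
    have "\<exists>p\<in>A. u1 p = of_real (t * X i) \<and> u2 p = of_real (t * Y i) \<and> u3 p = of_real (t * Z i)" if "i < 12" for i
    proof -
      have "\<bar>t * g\<bar> < 1" if "\<bar>g\<bar> \<le> 1" for g
      proof -
        have "t * \<bar>g\<bar> \<le> t * 1" by (rule mult_left_mono) (use t that in auto)
        moreover have "\<bar>t * g\<bar> = t * \<bar>g\<bar>" using t by (simp add: abs_mult)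
        ultimately show ?thesis using t by linarith
      qed
      then show ?thesis using range[OF that] by (intro points) auto
    qed
    then obtain p where p: "\<And>i. i < 12 \<Longrightarrow> p i \<in> A" "\<And>i. i < 12 \<Longrightarrow> u1 (p i) = of_real (t * X i)"
       "\<And>i. i < 12 \<Longrightarrow> u2 (p i) = of_real (t * Y i)" "\<And>i. i < 12 \<Longrightarrow> u3 (p i) = of_real (t * Z i)"
      by metis
    let ?zs = "map p [0..<12]"
    have "set ?zs \<subseteq> A" using p(1) by auto
    from psd_onD[OF psd' this, of "\<lambda>i. of_real (W i)"]
    have "(\<Sum>i<12. \<Sum>j<12. of_real (W i) * (vkernel_of u1 u2 u3 (p i) (p j) - f (p i) * cnj (f (p j))) * of_real (W j)) \<in> \<real>\<^sub>\<ge>\<^sub>0"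
      by simp
    also have "(\<Sum>i<12. \<Sum>j<12. of_real (W i) * (vkernel_of u1 u2 u3 (p i) (p j) - f (p i) * cnj (f (p j))) * of_real (W j))
       = (\<Sum>i<12. \<Sum>j<12. complex_of_real (W i * W j * d (t\<^sup>2) i j))"
    proof (intro sum.cong refl)
      fix i j :: nat assume "i \<in> {..<12}" "j \<in> {..<12}"
      then have ij: "i < 12" "j < 12" by auto
      have "vkernel_of u1 u2 u3 (p i) (p j) - f (p i) * cnj (f (p j)) = complex_of_real (d (t\<^sup>2) i j)"
      proof -
        have vq: "vquad (of_real (t * X i)) (of_real (t * Y i)) (of_real (t * Z i)) = of_real (t\<^sup>2 * q i)" for i
          by (simp add: vquad_def q_def algebra_simps power2_eq_square)
        have vp: "vpoly (of_real (t * X i)) (of_real (t * Y i)) (of_real (t * Z i)) = of_real (t\<^sup>2 * v i)" for i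
          by (simp add: vpoly_def v_def algebra_simps power2_eq_square)
        have sq: "(t * g) * (t * h) = t\<^sup>2 * (g * h)" for g h by (simp add: power2_eq_square)
        have "vkernel_of u1 u2 u3 (p i) (p j) - f (p i) * cnj (f (p j))
          = of_real (7 / ((1 - (t * X i) * (t * X j)) * (1 - (t * Y i) * (t * Y j)) * (1 - (t * Z i) * (t * Z j)))
             - 6 * (1 + (t * X i) * (t * X j) + (t * Y i) * (t * Y j) + (t * Z i) * (t * Z j))
             - 14 / 13 * ((t\<^sup>2 * q i) * (t\<^sup>2 * q j)) - (t\<^sup>2 * v i) * (t\<^sup>2 * v j) / 25)"
          unfolding f[OF p(1)[OF ij(1)]] f[OF p(1)[OF ij(2)]] p(2-4)[OF ij(1)] p(2-4)[OF ij(2)]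
            vkernel_def complex_cnj_complex_of_real vq vp by simp
        also have "\<dots> = of_real (d (t\<^sup>2) i j)"
          unfolding sq d_def S_def by (simp add: algebra_simps power2_eq_square)
        finally show ?thesis .
      qed
      then show "of_real (W i) * (vkernel_of u1 u2 u3 (p i) (p j) - f (p i) * cnj (f (p j))) * of_real (W j)
          = complex_of_real (W i * W j * d (t\<^sup>2) i j)"
        by (simp only: of_real_mult mult_ac)
    qed
    finally show ?thesis by (simp only: of_real_sum[symmetric] nonneg_Reals_of_real_iff)
  qed
  define E where "E \<tau> i j = (S \<tau> i j - 1 - \<tau> * (X i * X j + Y i * Y j + Z i * Z j)
      - \<tau>\<^sup>2 * ((X i * X j)\<^sup>2 + (Y i * Y j)\<^sup>2 + (Z i * Z j)\<^sup>2 + X i * X j * (Y i * Y j) + X i * X j * (Z i * Z j)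
          + Y i * Y j * (Z i * Z j))) / \<tau>\<^sup>2" for \<tau> i j
  have E_lim: "((\<lambda>\<tau>. E \<tau> i j) \<longlongrightarrow> 0) (at_right 0)" if "i < 12" "j < 12" for i j
    unfolding E_def S_def using that range prod_range by (intro szego_remainder_tendsto) auto
  have "((\<lambda>\<tau>. \<Sum>i<12. \<Sum>j<12. W i * W j * E \<tau> i j) \<longlongrightarrow> (\<Sum>i<12. \<Sum>j<12. W i * W j * 0)) (at_right 0)"
    using E_lim by (intro tendsto_sum tendsto_mult tendsto_const) auto
  then have lim: "((\<lambda>\<tau>. \<Sum>i<12. \<Sum>j<12. W i * W j * E \<tau> i j) \<longlongrightarrow> 0) (at_right 0)" by simp
  have "3 / (325 * 7) \<le> (\<Sum>i<12. \<Sum>j<12. W i * W j * E \<tau> i j)" if \<tau>: "0 < \<tau>" "\<tau> < 1" for \<tau>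
  proof -
    have d: "d \<tau> i j = 1 * 1 + \<tau> * (X i * X j + Y i * Y j + Z i * Z j) + \<tau>\<^sup>2 * (7 * ((X i)\<^sup>2 * (X j)\<^sup>2 + (Y i)\<^sup>2 * (Y j)\<^sup>2
         + (Z i)\<^sup>2 * (Z j)\<^sup>2 + (X i * Y i) * (X j * Y j) + (X i * Z i) * (X j * Z j) + (Y i * Z i) * (Y j * Z j))
         - 14 / 13 * (q i * q j) - 1 / 25 * (v i * v j)) + 7 * \<tau>\<^sup>2 * E \<tau> i j" for i j
      using \<tau> by (simp add: d_def E_def field_simps)
    let ?B = "\<lambda>g. \<Sum>i<12. \<Sum>j<12. W i * W j * (g i * g j)"
    have sum_d: "(\<Sum>i<12. \<Sum>j<12. W i * W j * d \<tau> i j) = ?B (\<lambda>_. 1) + \<tau> * (?B X + ?B Y + ?B Z)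
       + \<tau>\<^sup>2 * (7 * (?B (\<lambda>i. (X i)\<^sup>2) + ?B (\<lambda>i. (Y i)\<^sup>2) + ?B (\<lambda>i. (Z i)\<^sup>2) + ?B (\<lambda>i. X i * Y i)
            + ?B (\<lambda>i. X i * Z i) + ?B (\<lambda>i. Y i * Z i)) - 14 / 13 * ?B q - 1 / 25 * ?B v)
       + 7 * \<tau>\<^sup>2 * (\<Sum>i<12. \<Sum>j<12. W i * W j * E \<tau> i j)"
      unfolding d sum_distrib_left sum.distrib[symmetric] sum_subtractf[symmetric]
      by (intro sum.cong refl) (simp only: algebra_simps)
    have vals: "?B (\<lambda>_. 1) = 0" "?B X = 0" "?B Y = 0" "?B Z = 0"
        "?B (\<lambda>i. (X i)\<^sup>2) = 1" "?B (\<lambda>i. (Y i)\<^sup>2) = 1" "?B (\<lambda>i. (Z i)\<^sup>2) = 1"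
        "?B (\<lambda>i. X i * Y i) = 1" "?B (\<lambda>i. X i * Z i) = 1" "?B (\<lambda>i. Y i * Z i) = 1" "?B q = 36" "?B v = 81"
      unfolding sum_product_square
      by (simp_all add: numeral_eq_Suc lessThan_Suc X_def Y_def Z_def W_def q_def v_def)
    define e where "e = (\<Sum>i<12. \<Sum>j<12. W i * W j * E \<tau> i j)"
    have "0 \<le> (\<Sum>i<12. \<Sum>j<12. W i * W j * d \<tau> i j)"
      using form[of "sqrt \<tau>"] \<tau> by simp
    also have "\<dots> = \<tau>\<^sup>2 * (7 * e - 3 / 325)"
      unfolding sum_d vals e_def[symmetric] by (simp add: field_simps)
    finally have "0 \<le> 7 * e - 3 / 325" using \<tau> by (simp add: zero_le_mult_iff)
    then show ?thesis unfolding e_def[symmetric] by simp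
  qed
  note lower = this
  have "\<forall>\<^sub>F \<tau> in at_right 0. (\<Sum>i<12. \<Sum>j<12. W i * W j * E \<tau> i j) < 3 / (325 * 7)"
    by (rule order_tendstoD(2)[OF lim]) simp
  moreover have "\<forall>\<^sub>F \<tau>::real in at_right 0. \<tau> \<in> {0<..<1}" by (rule eventually_at_right_real) simp
  ultimately have "\<forall>\<^sub>F \<tau>::real in at_right 0. False"
    by eventually_elim (use lower in \<open>auto simp: not_less[symmetric]\<close>)
  then show False by simp
qed

section \<open>The two-point estimate\<close>

lemma pseudohyperbolic_identity:
  assumes "cmod a < 1" "cmod b < 1"
  shows "(cmod (1 - a * cnj b))\<^sup>2 * (1 - (pseudohyperbolic_dist a b)\<^sup>2) = (1 - (cmod a)\<^sup>2) * (1 - (cmod b)\<^sup>2)"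
proof -
  have "1 - a * cnj b \<noteq> 0" using mult_cnj_neq_one[OF assms] by auto
  then have "(cmod (1 - a * cnj b))\<^sup>2 * (1 - (pseudohyperbolic_dist a b)\<^sup>2) = (cmod (1 - a * cnj b))\<^sup>2 - (cmod (a - b))\<^sup>2"
    by (simp add: pseudohyperbolic_dist_def norm_divide power_divide right_diff_distrib)
  also have "complex_of_real \<dots> = of_real ((1 - (cmod a)\<^sup>2) * (1 - (cmod b)\<^sup>2))"
    unfolding of_real_diff of_real_mult of_real_1 cmod_power2_eq_mult_cnj
    by (simp add: algebra_simps)
  finally show ?thesis by (simp only: of_real_eq_iff)
qed

lemma pseudohyperbolic_dist_nonneg: "pseudohyperbolic_dist a b \<ge> 0"
  by (simp add: pseudohyperbolic_dist_def)

lemma pseudohyperbolic_dist_less_one: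
  assumes "cmod a < 1" "cmod b < 1" shows "pseudohyperbolic_dist a b < 1"
proof -
  have "0 < (1 - (cmod a)\<^sup>2) * (1 - (cmod b)\<^sup>2)"
    using assms by (intro mult_pos_pos) (auto simp: power_less_one_iff)
  then have "0 < (cmod (1 - a * cnj b))\<^sup>2 * (1 - (pseudohyperbolic_dist a b)\<^sup>2)"
    unfolding pseudohyperbolic_identity[OF assms] .
  then have "(pseudohyperbolic_dist a b)\<^sup>2 < 1" by (simp add: zero_less_mult_iff)
  then show ?thesis using pseudohyperbolic_dist_nonneg[of a b] by (simp add: power_less_one_iff)
qed

lemma psd_on_two_pointsI:
  assumes "z \<noteq> w" and "G z z = of_real a" "G w w = of_real d" "a > 0" "G w z = cnj (G z w)"
    and le: "(cmod (G z w))\<^sup>2 \<le> a * d"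
  shows "psd_on {z, w} G"
proof -
  define g where "g x = G x z / of_real (sqrt a)" for x
  define h where "h x = (if x = w then complex_of_real (sqrt (d - (cmod (G z w))\<^sup>2 / a)) else 0)" for x
  have sqa: "complex_of_real (sqrt a) * of_real (sqrt a) = of_real a"
    using assms(4) by (simp flip: of_real_mult)
  have nn: "0 \<le> d - (cmod (G z w))\<^sup>2 / a" using le assms(4) by (simp add: field_simps)
  have sqd: "complex_of_real (sqrt (d - (cmod (G z w))\<^sup>2 / a)) * of_real (sqrt (d - (cmod (G z w))\<^sup>2 / a))
      = of_real d - G z w * cnj (G z w) / of_real a"
    unfolding of_real_mult[symmetric] real_sqrt_mult_self abs_of_nonneg[OF nn]
    unfolding of_real_diff of_real_divide cmod_power2_eq_mult_cnj by simp
  have "psd_on {z, w} (\<lambda>x y. g x * cnj (g y) + h x * cnj (h y))"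
    by (intro psd_on_add psd_on_rank_one)
  moreover have "g x * cnj (g y) + h x * cnj (h y) = G x y" if "x \<in> {z, w}" "y \<in> {z, w}" for x y
  proof -
    have gg: "g x * cnj (g y) = G x z * cnj (G y z) / of_real a"
      unfolding g_def sqa[symmetric] by simp
    show ?thesis
      using that assms(1-5) unfolding gg h_def
      by (auto simp: sqd mult.commute)
  qed
  ultimately show ?thesis by (subst (asm) psd_on_cong[where H = G]) auto
qed

lemma psd_on_two_pointsD:
  assumes psd: "psd_on {z, w} G" and "G z z = of_real a" "G w w = of_real d" "a > 0"
  shows "(cmod (G z w))\<^sup>2 \<le> a * d"
proof -
  have "psd_matrix (length [z, w]) (\<lambda>i j. G ([z, w] ! i) ([z, w] ! j))"
    using psd unfolding psd_on_iff_psd_matrix by (rule allE[of _ "[z, w]"]) simp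
  then have m: "psd_matrix 2 (\<lambda>i j. G ([z, w] ! i) ([z, w] ! j))" by (simp add: numeral_2_eq_2)
  have herm: "G w z = cnj (G z w)"
    using psd_matrix_hermitian[OF m, of 0 1] by simp
  have "cnj (- G z w) * G z z * (- G z w) + cnj (- G z w) * G z w * of_real a + cnj (of_real a) * G w z * (- G z w)
      + cnj (of_real a) * G w w * of_real a \<in> \<real>\<^sub>\<ge>\<^sub>0"
    using psd_matrix_two_points[OF m, of 0 1 "- G z w" "of_real a"] by simp
  also have "cnj (- G z w) * G z z * (- G z w) + cnj (- G z w) * G z w * of_real a + cnj (of_real a) * G w z * (- G z w)
      + cnj (of_real a) * G w w * of_real a = of_real a * (of_real a * of_real d - G z w * cnj (G z w))"
    unfolding herm assms(2,3) by (simp add: algebra_simps)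
  also have "\<dots> = of_real (a * (a * d - (cmod (G z w))\<^sup>2))"
    unfolding of_real_mult of_real_diff cmod_power2_eq_mult_cnj ..
  finally have "0 \<le> a * (a * d - (cmod (G z w))\<^sup>2)" by (simp only: nonneg_Reals_of_real_iff)
  then show ?thesis using assms(4) by (simp add: zero_le_mult_iff)
qed

text \<open>The kernel with diagonal entries \<open>1\<close> and off-diagonal entry \<open>t = sqrt (1 - \<tau>\<^sup>2)\<close> on two points is admissible
  exactly if the test functions move the two points apart by at most \<open>\<tau>\<close>, by the identity
  \<open>1 - m(a, b)\<^sup>2 = (1 - \<bar>a\<bar>\<^sup>2) (1 - \<bar>b\<bar>\<^sup>2) / \<bar>1 - a \<cdot> cnj b\<bar>\<^sup>2\<close>; the same identity translates the conclusion back.\<close>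

lemma schur_agler_two_points:
  assumes f: "f \<in> schur_agler_class \<Omega> \<Psi>" and zw: "z \<in> \<Omega>" "w \<in> \<Omega>"
    and f1: "cmod (f z) < 1" "cmod (f w) < 1"
    and \<Psi>: "\<And>\<psi>. \<psi> \<in> \<Psi> \<Longrightarrow> cmod (\<psi> z) < 1" "\<And>\<psi>. \<psi> \<in> \<Psi> \<Longrightarrow> cmod (\<psi> w) < 1"
    and \<tau>: "\<tau> \<ge> 0" "\<And>\<psi>. \<psi> \<in> \<Psi> \<Longrightarrow> pseudohyperbolic_dist (\<psi> z) (\<psi> w) \<le> \<tau>"
  shows "pseudohyperbolic_dist (f z) (f w) \<le> \<tau>"
proof -
  consider "\<tau> \<ge> 1" | "z = w" | "\<tau> < 1" "z \<noteq> w" by linarith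
  then show ?thesis
  proof cases
    case 1
    then show ?thesis using pseudohyperbolic_dist_less_one[OF f1] by simp
  next
    case 2
    then show ?thesis using \<tau> by (simp add: pseudohyperbolic_dist_def)
  next
    case 3
    define t where "t = sqrt (1 - \<tau>\<^sup>2)"
    have t2: "t\<^sup>2 = 1 - \<tau>\<^sup>2" using 3 \<tau>(1) by (simp add: t_def power_le_one)
    have t0: "t \<ge> 0" using 3 \<tau>(1) by (simp add: t_def power_le_one)
    define k where "k x y = (if x = y then 1 else complex_of_real t)" for x y :: 'a
    have one: "1 - x * cnj x = of_real (1 - (cmod x)\<^sup>2)" for x :: complex
      unfolding of_real_diff of_real_1 cmod_power2_eq_mult_cnj ..
    have pos: "0 < 1 - (cmod x)\<^sup>2" if "cmod x < 1" for x :: complex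
      using that by (simp add: power_less_one_iff)
    have "psd_on {z, w} (\<lambda>x y. (1 - f x * cnj (f y)) * k x y)"
    proof (rule schur_agler_psd_on_subset[OF f])
      show "psd_on {z, w} k"
        by (rule psd_on_two_pointsI[where a = 1 and d = 1]) (use 3 t2 in \<open>auto simp: k_def\<close>)
      fix \<psi> assume \<psi>: "\<psi> \<in> \<Psi>"
      show "psd_on {z, w} (\<lambda>x y. (1 - \<psi> x * cnj (\<psi> y)) * k x y)"
      proof (rule psd_on_two_pointsI[where a = "1 - (cmod (\<psi> z))\<^sup>2" and d = "1 - (cmod (\<psi> w))\<^sup>2"])
        have "(pseudohyperbolic_dist (\<psi> z) (\<psi> w))\<^sup>2 \<le> \<tau>\<^sup>2"
          using \<tau>(2)[OF \<psi>] pseudohyperbolic_dist_nonneg by (intro power_mono)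
        then have "(cmod (1 - \<psi> z * cnj (\<psi> w)))\<^sup>2 * t\<^sup>2
            \<le> (cmod (1 - \<psi> z * cnj (\<psi> w)))\<^sup>2 * (1 - (pseudohyperbolic_dist (\<psi> z) (\<psi> w))\<^sup>2)"
          unfolding t2 by (intro mult_left_mono) auto
        then show "(cmod ((1 - \<psi> z * cnj (\<psi> w)) * k z w))\<^sup>2 \<le> (1 - (cmod (\<psi> z))\<^sup>2) * (1 - (cmod (\<psi> w))\<^sup>2)"
          using 3 t0 unfolding pseudohyperbolic_identity[OF \<Psi>[OF \<psi> ]]
          by (simp add: k_def norm_mult power_mult_distrib)
      qed (use 3 pos[OF \<Psi>(1)[OF \<psi>]] one in \<open>auto simp: k_def\<close>)
    qed (use zw in auto)
    then have "(cmod ((1 - f z * cnj (f w)) * k z w))\<^sup>2 \<le> (1 - (cmod (f z))\<^sup>2) * (1 - (cmod (f w))\<^sup>2)"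
      by (rule psd_on_two_pointsD) (use pos[OF f1(1)] one in \<open>auto simp: k_def\<close>)
    then have "(cmod (1 - f z * cnj (f w)))\<^sup>2 * t\<^sup>2
        \<le> (cmod (1 - f z * cnj (f w)))\<^sup>2 * (1 - (pseudohyperbolic_dist (f z) (f w))\<^sup>2)"
      using 3 t0 unfolding pseudohyperbolic_identity[OF f1]
      by (simp add: k_def norm_mult power_mult_distrib)
    moreover have "(cmod (1 - f z * cnj (f w)))\<^sup>2 > 0"
      using mult_cnj_neq_one[OF f1] by simp
    ultimately have "(pseudohyperbolic_dist (f z) (f w))\<^sup>2 \<le> \<tau>\<^sup>2" by (simp add: t2)
    then show ?thesis using \<tau>(1) by (rule power2_le_imp_le)
  qed
qed

section \<open>Test functions and separation of points\<close>

lemma generated_algebra_values_eq: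
  assumes "g \<in> generated_algebra F \<Psi>" "z \<in> F" "w \<in> F" "\<And>\<psi>. \<psi> \<in> \<Psi> \<Longrightarrow> \<psi> z = \<psi> w"
  shows "g z = g w"
  using assms(1) by induction (use assms in auto)

lemma test_functions_separate:
  assumes "test_functions \<Omega> \<Psi>" "z \<in> \<Omega>" "w \<in> \<Omega>" "\<And>\<psi>. \<psi> \<in> \<Psi> \<Longrightarrow> \<psi> z = \<psi> w"
  shows "z = w"
proof (rule ccontr)
  assume "z \<noteq> w"
  define g where "g = (\<lambda>x\<in>{z, w}. if x = z then 1 else 0 :: complex)"
  have "generated_algebra {z, w} \<Psi> = {z, w} \<rightarrow>\<^sub>E UNIV"
    using assms(1-3) unfolding test_functions_def by simp
  then have "g \<in> generated_algebra {z, w} \<Psi>" by (simp add: g_def)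
  then have "g z = g w" by (rule generated_algebra_values_eq) (use assms in auto)
  then show False using \<open>z \<noteq> w\<close> by (simp add: g_def)
qed

lemma test_functions_less_one:
  assumes "test_functions \<Omega> \<Psi>" "z \<in> \<Omega>" "\<psi> \<in> \<Psi>"
  shows "cmod (\<psi> z) < 1"
proof -
  have "ennreal (cmod (\<psi> z)) \<le> (SUP \<psi>\<in>\<Psi>. ennreal (cmod (\<psi> z)))"
    using assms(3) by (rule SUP_upper)
  also have "\<dots> < 1" using assms unfolding test_functions_def by simp
  finally show ?thesis by simp
qed

lemma generated_algebra_sum:
  assumes "finite I" "\<And>i. i \<in> I \<Longrightarrow> g i \<in> generated_algebra F \<Psi>"
  shows "(\<lambda>z\<in>F. \<Sum>i\<in>I. g i z) \<in> generated_algebra F \<Psi>"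
  using assms
proof (induction I rule: finite_induct)
  case empty
  have "(\<lambda>z\<in>F. 0 * (\<lambda>z\<in>F. 1) z) \<in> generated_algebra F \<Psi>"
    by (intro generated_algebra.scale generated_algebra.const)
  then show ?case by (simp add: restrict_def cong: if_cong)
next
  case (insert i I)
  then have "(\<lambda>z\<in>F. g i z + (\<lambda>z\<in>F. \<Sum>i\<in>I. g i z) z) \<in> generated_algebra F \<Psi>"
    by (intro generated_algebra.add) auto
  then show ?case using insert by (simp add: restrict_def cong: if_cong)
qed

lemma generated_algebra_prod:
  assumes "finite I" "\<And>i. i \<in> I \<Longrightarrow> g i \<in> generated_algebra F \<Psi>"
  shows "(\<lambda>z\<in>F. \<Prod>i\<in>I. g i z) \<in> generated_algebra F \<Psi>"
  using assms
proof (induction I rule: finite_induct)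
  case empty
  show ?case using generated_algebra.const[of F \<Psi>] by (simp add: restrict_def)
next
  case (insert i I)
  then have "(\<lambda>z\<in>F. g i z * (\<lambda>z\<in>F. \<Prod>i\<in>I. g i z) z) \<in> generated_algebra F \<Psi>"
    by (intro generated_algebra.mult) auto
  then show ?case using insert by (simp add: restrict_def cong: if_cong)
qed

lemma generated_algebra_extensional:
  "g \<in> generated_algebra F \<Psi> \<Longrightarrow> g \<in> F \<rightarrow>\<^sub>E UNIV"
  by (induction rule: generated_algebra.induct) auto

text \<open>Lagrange interpolation: products of normalized differences \<open>\<psi> - \<psi>(w)\<close> give the indicator of each point.\<close>

lemma generated_algebra_separating:
  assumes "finite F" and sep: "\<And>z w. z \<in> F \<Longrightarrow> w \<in> F \<Longrightarrow> z \<noteq> w \<Longrightarrow> \<exists>\<psi>\<in>\<Psi>. \<psi> z \<noteq> \<psi> w"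
  shows "generated_algebra F \<Psi> = F \<rightarrow>\<^sub>E UNIV"
proof
  show "generated_algebra F \<Psi> \<subseteq> F \<rightarrow>\<^sub>E UNIV" using generated_algebra_extensional by blast
  show "F \<rightarrow>\<^sub>E UNIV \<subseteq> generated_algebra F \<Psi>"
  proof
    fix f :: "'a \<Rightarrow> complex" assume f: "f \<in> F \<rightarrow>\<^sub>E UNIV"
    have bump: "\<exists>g\<in>generated_algebra F \<Psi>. g w = 0 \<and> g z = 1" if "z \<in> F" "w \<in> F" "z \<noteq> w" for z w
    proof -
      obtain \<psi> where \<psi>: "\<psi> \<in> \<Psi>" "\<psi> z \<noteq> \<psi> w" using sep[OF \<open>z \<in> F\<close> \<open>w \<in> F\<close> \<open>z \<noteq> w\<close>] by blast
      define g where "g = (\<lambda>x\<in>F. (1 / (\<psi> z - \<psi> w)) * (\<lambda>x\<in>F. restrict \<psi> F x + (\<lambda>x\<in>F. - \<psi> w * (\<lambda>x\<in>F. 1) x) x) x)"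
      have "g \<in> generated_algebra F \<Psi>"
        unfolding g_def
        by (rule generated_algebra.scale[OF generated_algebra.add[OF generated_algebra.gen[OF \<psi>(1)]
          generated_algebra.scale[OF generated_algebra.const]]])
      moreover have "g w = 0" "g z = 1" using that \<psi>(2) by (simp_all add: g_def)
      ultimately show ?thesis by blast
    qed
    have "\<exists>\<delta>\<in>generated_algebra F \<Psi>. \<delta> z = 1 \<and> (\<forall>w\<in>F - {z}. \<delta> w = 0)" if zF: "z \<in> F" for z
    proof -
      obtain g where g: "\<And>w. w \<in> F - {z} \<Longrightarrow> g w \<in> generated_algebra F \<Psi> \<and> g w w = 0 \<and> g w z = 1"
        using bump[OF zF] by (metis Diff_iff insertI1)
      define \<delta> where "\<delta> = (\<lambda>x\<in>F. \<Prod>w\<in>F - {z}. g w x)"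
      have "\<delta> \<in> generated_algebra F \<Psi>"
        unfolding \<delta>_def using g \<open>finite F\<close> by (intro generated_algebra_prod) auto
      moreover have "\<delta> z = 1" using g zF by (simp add: \<delta>_def)
      moreover have "\<delta> w = 0" if "w \<in> F - {z}" for w
        using g[OF that] that \<open>finite F\<close> by (auto simp: \<delta>_def intro!: prod_zero bexI[of _ w])
      ultimately show ?thesis by blast
    qed
    then obtain \<delta> where \<delta>: "\<And>z. z \<in> F \<Longrightarrow> \<delta> z \<in> generated_algebra F \<Psi>" "\<And>z. z \<in> F \<Longrightarrow> \<delta> z z = 1"
       "\<And>z w. z \<in> F \<Longrightarrow> w \<in> F \<Longrightarrow> w \<noteq> z \<Longrightarrow> \<delta> z w = 0"
      by (metis Diff_iff singletonD)
    have "(\<lambda>x\<in>F. \<Sum>z\<in>F. (\<lambda>x\<in>F. f z * \<delta> z x) x) \<in> generated_algebra F \<Psi>"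
      using \<delta>(1) \<open>finite F\<close> by (intro generated_algebra_sum generated_algebra.scale)
    also have "(\<lambda>x\<in>F. \<Sum>z\<in>F. (\<lambda>x\<in>F. f z * \<delta> z x) x) = f"
    proof (rule extensionalityI)
      fix x assume x: "x \<in> F"
      have "(\<Sum>z\<in>F. (\<lambda>x\<in>F. f z * \<delta> z x) x) = (\<Sum>z\<in>F. if z = x then f x else 0)"
        using x \<delta>(2,3) by (intro sum.cong refl) auto
      then show "(\<lambda>x\<in>F. \<Sum>z\<in>F. (\<lambda>x\<in>F. f z * \<delta> z x) x) x = f x"
        using x \<open>finite F\<close> by simp
    qed (use f in \<open>auto simp: PiE_def\<close>)
    finally show "f \<in> generated_algebra F \<Psi>" .
  qed
qed

section \<open>Domains on which all Schur functions are Schur-Agler\<close>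

lemma mholomorphic_on_const: "(\<lambda>z. c) mholomorphic_on \<Omega>"
  by (rule mholomorphic_onI) (auto intro!: exI[of _ "\<lambda>_. 0"])

lemma mholomorphic_on_add:
  assumes "f mholomorphic_on \<Omega>" "g mholomorphic_on \<Omega>"
  shows "(\<lambda>z. f z + g z) mholomorphic_on \<Omega>"
proof (rule mholomorphic_onI)
  fix z assume z: "z \<in> \<Omega>"
  obtain f' where f': "(f has_derivative f') (at z)" "\<And>c X. f' (c *s X) = c * f' X"
    by (rule mholomorphic_onE[OF assms(1) z]) blast
  obtain g' where g': "(g has_derivative g') (at z)" "\<And>c X. g' (c *s X) = c * g' X"
    by (rule mholomorphic_onE[OF assms(2) z]) blast
  have "((\<lambda>z. f z + g z) has_derivative (\<lambda>X. f' X + g' X)) (at z)"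
    by (rule has_derivative_add[OF f'(1) g'(1)])
  then show "\<exists>D. ((\<lambda>z. f z + g z) has_derivative D) (at z) \<and> (\<forall>c X. D (c *s X) = c * D X)"
    by (intro exI[of _ "\<lambda>X. f' X + g' X"]) (simp add: f'(2) g'(2) distrib_left)
qed

lemma mholomorphic_on_mult:
  assumes "f mholomorphic_on \<Omega>" "g mholomorphic_on \<Omega>"
  shows "(\<lambda>z. f z * g z) mholomorphic_on \<Omega>"
proof (rule mholomorphic_onI)
  fix z assume z: "z \<in> \<Omega>"
  obtain f' where f': "(f has_derivative f') (at z)" "\<And>c X. f' (c *s X) = c * f' X"
    by (rule mholomorphic_onE[OF assms(1) z]) blast
  obtain g' where g': "(g has_derivative g') (at z)" "\<And>c X. g' (c *s X) = c * g' X"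
    by (rule mholomorphic_onE[OF assms(2) z]) blast
  have "((\<lambda>z. f z * g z) has_derivative (\<lambda>X. f z * g' X + f' X * g z)) (at z)"
    by (rule has_derivative_mult[OF f'(1) g'(1)])
  then show "\<exists>D. ((\<lambda>z. f z * g z) has_derivative D) (at z) \<and> (\<forall>c X. D (c *s X) = c * D X)"
    by (intro exI[of _ "\<lambda>X. f z * g' X + f' X * g z"]) (simp add: f'(2) g'(2) algebra_simps)
qed

lemma mholomorphic_components_has_derivative:
  fixes G :: "complex ^ 'm \<Rightarrow> complex ^ 'n"
  assumes G: "\<And>j. (\<lambda>y. G y $ j) mholomorphic_on V" and y: "y \<in> V"
  shows "\<exists>G'. (G has_derivative G') (at y) \<and> (\<forall>c X. G' (c *s X) = c *s G' X)"
proof -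
  have "\<forall>j. \<exists>D. ((\<lambda>y. G y $ j) has_derivative D) (at y) \<and> (\<forall>c X. D (c *s X) = c * D X)"
    using bspec[OF G[unfolded mholomorphic_on_def] y] by (rule allI)
  from choice[OF this] obtain D
    where D': "\<forall>j. ((\<lambda>y. G y $ j) has_derivative D j) (at y) \<and> (\<forall>c X. D j (c *s X) = c * D j X)"
    by (elim exE)
  have D: "((\<lambda>y. G y $ j) has_derivative D j) (at y)" "D j (c *s X) = c * D j X" for j c X
    using D' by blast+
  define G' where "G' X = (\<chi> j. D j X)" for X
  have "(G has_derivative G') (at y)"
    unfolding has_derivative_componentwise_within[of G] Basis_vec_def G'_def[abs_def]
    by (auto simp: inner_axis intro!: has_derivative_inner_left D(1))
  moreover have "\<forall>c X. G' (c *s X) = c *s G' X" by (simp add: G'_def vec_eq_iff D(2))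
  ultimately show ?thesis by blast
qed

lemma vpoly_mholomorphic:
  assumes "f mholomorphic_on \<Omega>" "g mholomorphic_on \<Omega>" "h mholomorphic_on \<Omega>"
  shows "(\<lambda>z. vpoly (f z) (g z) (h z) / 5) mholomorphic_on \<Omega>"
proof -
  have "vpoly x y z / 5 = 1 / 5 * (x * x + (y * y + (z * z + (- 2) * (x * y + (x * z + y * z)))))" for x y z
    by (simp add: vpoly_def power2_eq_square algebra_simps diff_divide_distrib add_divide_distrib)
  then show ?thesis
    by (simp only:) (intro mholomorphic_on_mult mholomorphic_on_add mholomorphic_on_const assms)
qed

text \<open>Passing to moduli turns the two-point estimate into an inequality between directional derivatives.\<close>

lemma directional_quotient_tendsto:
  fixes f :: "complex ^ 'n \<Rightarrow> complex"
  assumes "(f has_derivative f') (at z)"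
  shows "((\<lambda>t. cmod (f (z + t *\<^sub>R X) - f z) / t) \<longlongrightarrow> cmod (f' X)) (at_right 0)"
proof -
  have g1: "((\<lambda>t. z + t *\<^sub>R X) has_derivative (\<lambda>t. t *\<^sub>R X)) (at 0)"
    by (auto intro!: derivative_eq_intros)
  have g2: "(f has_derivative f') (at (z + 0 *\<^sub>R X))" using assms by simp
  have "((\<lambda>t. f (z + t *\<^sub>R X)) has_derivative (\<lambda>t. f' (t *\<^sub>R X))) (at 0)"
    by (rule has_derivative_compose[OF g1 g2])
  then have "((\<lambda>t. cmod (f (z + t *\<^sub>R X) - f z - f' (t *\<^sub>R X)) / \<bar>t\<bar>) \<longlongrightarrow> 0) (at 0)"
    unfolding has_derivative_iff_norm by simp
  then have lim: "((\<lambda>t. cmod (f (z + t *\<^sub>R X) - f z - f' (t *\<^sub>R X)) / \<bar>t\<bar>) \<longlongrightarrow> 0) (at_right 0)"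
    by (rule tendsto_mono[OF at_le[OF subset_UNIV]])
  have "((\<lambda>t. cmod (f (z + t *\<^sub>R X) - f z) / t - cmod (f' X)) \<longlongrightarrow> 0) (at_right 0)"
  proof (rule Lim_null_comparison[OF _ lim])
    have "norm (cmod (f (z + t *\<^sub>R X) - f z) / t - cmod (f' X)) \<le> cmod (f (z + t *\<^sub>R X) - f z - f' (t *\<^sub>R X)) / \<bar>t\<bar>"
      if "t > 0" for t
    proof -
      have "cmod (f' (t *\<^sub>R X)) = t * cmod (f' X)"
        using linear_cmul[OF has_derivative_linear[OF assms], of t X] that by simp
      moreover have "\<bar>cmod (f (z + t *\<^sub>R X) - f z) - cmod (f' (t *\<^sub>R X))\<bar> \<le> cmod (f (z + t *\<^sub>R X) - f z - f' (t *\<^sub>R X))"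
        by (rule norm_triangle_ineq3)
      moreover have "cmod (f (z + t *\<^sub>R X) - f z) / t - cmod (f' X) = (cmod (f (z + t *\<^sub>R X) - f z) - t * cmod (f' X)) / t"
        using that by (simp add: field_simps)
      ultimately show ?thesis using that by (simp add: divide_right_mono)
    qed
    then show "\<forall>\<^sub>F t in at_right 0. norm (cmod (f (z + t *\<^sub>R X) - f z) / t - cmod (f' X))
        \<le> cmod (f (z + t *\<^sub>R X) - f z - f' (t *\<^sub>R X)) / \<bar>t\<bar>"
      using eventually_at_right_less[of "0::real"] by (rule eventually_mono[rotated])
  qed
  then show ?thesis by (subst (asm) Lim_null[symmetric])
qed

lemma schur_classI:
  assumes "open \<Omega>" "f mholomorphic_on \<Omega>" "\<And>z. z \<in> \<Omega> \<Longrightarrow> cmod (f z) \<le> 1"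
  shows "restrict f \<Omega> \<in> schur_class \<Omega>"
  unfolding schur_class_def
  using mholomorphic_on_cong[OF assms(1) _ assms(2), of "restrict f \<Omega>"] assms(3) by auto

definition vec_map :: "('m::finite \<Rightarrow> 'a \<Rightarrow> complex) \<Rightarrow> 'a \<Rightarrow> complex ^ 'm" where
  "vec_map e z = (\<chi> i. e i z)"

lemma vec_map_nth [simp]: "vec_map e z $ i = e i z" by (simp add: vec_map_def)

lemma polydisc_iff: "y \<in> polydisc \<longleftrightarrow> (\<forall>i. cmod (y $ i) < 1)"
  by (simp add: polydisc_def)

lemma open_polydisc: "open (polydisc :: (complex ^ 'm) set)"
proof -
  have eq: "polydisc = (\<Inter>i. {y :: complex ^ 'm. cmod (y $ i) < 1})" by (auto simp: polydisc_iff)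
  show ?thesis
    unfolding eq by (intro open_INT finite ballI open_Collect_less continuous_intros)
qed

lemma connected_polydisc: "connected (polydisc :: (complex ^ 'm) set)"
proof (rule convex_connected)
  show "convex (polydisc :: (complex ^ 'm) set)"
    unfolding convex_def
  proof (intro ballI allI impI)
    fix x y :: "complex ^ 'm" and u v :: real
    assume xy: "x \<in> polydisc" "y \<in> polydisc" and uv: "0 \<le> u" "0 \<le> v" "u + v = 1"
    have "u *\<^sub>R (x $ i) + v *\<^sub>R (y $ i) \<in> ball 0 1" for i
      using xy uv by (intro convexD[OF convex_ball]) (auto simp: polydisc_iff)
    then show "u *\<^sub>R x + v *\<^sub>R y \<in> polydisc" by (simp add: polydisc_iff)
  qed
qed

locale schur_agler_coordinates =
  fixes \<Omega> :: "(complex ^ 'n) set" and e :: "'m::finite \<Rightarrow> complex ^ 'n \<Rightarrow> complex" and w\<^sub>0 :: "complex ^ 'n"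
  assumes domain: "complex_domain \<Omega>" and gamma: "gamma_hyperbolic \<Omega>"
    and finitely_compact: "caratheodory_finitely_compact \<Omega>"
    and test: "test_functions \<Omega> (range e)" and e_schur: "\<And>i. e i \<in> schur_class \<Omega>"
    and w0: "w\<^sub>0 \<in> \<Omega>" "\<And>i. e i w\<^sub>0 = 0"
    and SA: "schur_agler_class \<Omega> (range e) = schur_class \<Omega>"
    and dim: "CARD('n) = CARD('m)"
begin

abbreviation "F \<equiv> vec_map e :: complex ^ 'n \<Rightarrow> complex ^ 'm"

lemma open_\<Omega>: "open \<Omega>" using domain by (simp add: complex_domain_def)

lemma e_holo: "e i mholomorphic_on \<Omega>" using e_schur unfolding schur_class_def by blast

lemma e_less: "z \<in> \<Omega> \<Longrightarrow> cmod (e i z) < 1"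
  by (rule test_functions_less_one[OF test]) auto

lemma continuous_F: "continuous_on \<Omega> F"
  unfolding vec_map_def by (intro continuous_on_vec_lambda mholomorphic_on_continuous e_holo)

lemma inj_F: "inj_on F \<Omega>"
proof (rule inj_onI)
  fix z w assume zw: "z \<in> \<Omega>" "w \<in> \<Omega>" "F z = F w"
  then have "e i z = e i w" for i by (metis vec_map_nth)
  then show "z = w" by (intro test_functions_separate[OF test zw(1,2)]) auto
qed

lemma F_polydisc: "F ` \<Omega> \<subseteq> polydisc" by (auto simp: polydisc_iff e_less)

lemma two_points:
  assumes f: "f mholomorphic_on \<Omega>" "f ` \<Omega> \<subseteq> unit_disc" and zw: "z \<in> \<Omega>" "w \<in> \<Omega>"
    and \<tau>: "\<tau> \<ge> 0" "\<And>i. pseudohyperbolic_dist (e i z) (e i w) \<le> \<tau>"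
  shows "pseudohyperbolic_dist (f z) (f w) \<le> \<tau>"
proof -
  have f1: "cmod (f z) < 1" if "z \<in> \<Omega>" for z using f(2) that by auto
  have "restrict f \<Omega> \<in> schur_agler_class \<Omega> (range e)"
    unfolding SA by (rule schur_classI[OF open_\<Omega> f(1)]) (use f1 in \<open>auto intro: less_imp_le\<close>)
  then have "pseudohyperbolic_dist (restrict f \<Omega> z) (restrict f \<Omega> w) \<le> \<tau>"
    by (rule schur_agler_two_points[OF _ zw]) (use zw f1 e_less \<tau> in auto)
  then show ?thesis using zw by simp
qed

lemma caratheodory_dist_le:
  assumes "z \<in> \<Omega>" "r \<ge> 0" "\<And>i. cmod (e i z) \<le> r"
  shows "caratheodory_dist \<Omega> w\<^sub>0 z \<le> r"
  unfolding caratheodory_dist_def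
proof (rule cSUP_least)
  have "restrict (\<lambda>_. 0) \<Omega> \<in> schur_class \<Omega>"
    by (rule schur_classI[OF open_\<Omega> mholomorphic_on_const]) simp
  then show "{f \<in> schur_class \<Omega>. f ` \<Omega> \<subseteq> unit_disc} \<noteq> {}" by fastforce
  fix f assume "f \<in> {f \<in> schur_class \<Omega>. f ` \<Omega> \<subseteq> unit_disc}"
  then have f: "f mholomorphic_on \<Omega>" "f ` \<Omega> \<subseteq> unit_disc" by (auto simp: schur_class_def)
  show "pseudohyperbolic_dist (f w\<^sub>0) (f z) \<le> r"
    by (rule two_points[OF f w0(1) assms(1,2)]) (simp add: w0 pseudohyperbolic_dist_def assms(3))
qed

text \<open>The sublevel set lies in a ball of the Caratheodory distance about \<open>w\<^sub>0\<close>, which is relatively compact, and it is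
  closed in the closure of that ball.\<close>

lemma compact_sublevel:
  assumes "0 \<le> r" "r < 1"
  shows "compact {z \<in> \<Omega>. \<forall>i. cmod (e i z) \<le> r}"
proof -
  define B where "B = {w \<in> \<Omega>. caratheodory_dist \<Omega> w\<^sub>0 w < (1 + r) / 2}"
  have "(1 + r) / 2 \<in> {0<..<1}" using assms by auto
  from bspec[OF bspec[OF finitely_compact[unfolded caratheodory_finitely_compact_def] w0(1)] this]
  have "compact (closure B) \<and> closure B \<subseteq> \<Omega>"
    unfolding B_def Let_def .
  then have B: "compact (closure B)" "closure B \<subseteq> \<Omega>" by auto
  define T where "T = (\<Inter>i. {y :: complex ^ 'm. cmod (y $ i) \<le> r})"
  have "closed T" unfolding T_def by (intro closed_INT ballI closed_Collect_le continuous_intros)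
  then have "closed (closure B \<inter> F -` T)"
    by (intro continuous_closed_preimage continuous_on_subset[OF continuous_F B(2)] closed_closure)
  then have "compact (closure B \<inter> (closure B \<inter> F -` T))" by (rule compact_Int_closed[OF B(1)])
  moreover have "{z \<in> \<Omega>. \<forall>i. cmod (e i z) \<le> r} = closure B \<inter> (closure B \<inter> F -` T)"
  proof (intro equalityI subsetI)
    fix z assume z: "z \<in> {z \<in> \<Omega>. \<forall>i. cmod (e i z) \<le> r}"
    then have "caratheodory_dist \<Omega> w\<^sub>0 z \<le> r" using assms by (intro caratheodory_dist_le) auto
    then have "z \<in> B" using z assms by (auto simp: B_def)
    then show "z \<in> closure B \<inter> (closure B \<inter> F -` T)" using z closure_subset by (auto simp: T_def)
  qed (use B(2) in \<open>auto simp: T_def\<close>)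
  ultimately show ?thesis by simp
qed

lemma open_image_F: "open (F ` \<Omega>)"
  by (rule invariance_of_domain_gen[OF open_\<Omega> continuous_F inj_F]) (simp add: dim)

text \<open>The image is open, and it is closed in the polydisc since its intersection with every smaller closed
  polydisc is compact; the polydisc is connected.\<close>

lemma image_F: "F ` \<Omega> = polydisc"
proof -
  have "open (polydisc - F ` \<Omega>)"
  proof (subst open_subopen, intro ballI)
    fix y :: "complex ^ 'm" assume y: "y \<in> polydisc - F ` \<Omega>"
    define M where "M = Max (range (\<lambda>i. cmod (y $ i)))"
    define r where "r = (1 + M) / 2"
    have "M < 1" using y unfolding M_def by (subst Max_less_iff) (auto simp: polydisc_iff)
    moreover have M_ge: "cmod (y $ i) \<le> M" for i unfolding M_def by (rule Max_ge) auto
    moreover have "0 \<le> M" using M_ge norm_ge_zero order_trans by blast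
    ultimately have r: "0 \<le> r" "r < 1" by (auto simp: r_def)
    have "M < r" using \<open>M < 1\<close> by (simp add: r_def)
    then have yr: "cmod (y $ i) < r" for i using M_ge by (rule le_less_trans[rotated])
    define K where "K = F ` {z \<in> \<Omega>. \<forall>i. cmod (e i z) \<le> r}"
    have "compact K" unfolding K_def
      by (rule compact_continuous_image[OF continuous_on_subset[OF continuous_F] compact_sublevel[OF r(1,2)]]) auto
    then have "closed K" by (rule compact_imp_closed)
    define U where "U = (\<Inter>i. {x :: complex ^ 'm. cmod (x $ i) < r}) - K"
    have "open U" unfolding U_def
      by (intro open_Diff \<open>closed K\<close> open_INT finite ballI open_Collect_less continuous_intros)
    moreover have "y \<in> U" using y yr by (auto simp: U_def K_def)
    moreover have "U \<subseteq> polydisc - F ` \<Omega>"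
    proof
      fix x assume x: "x \<in> U"
      then have xr: "cmod (x $ i) < r" for i by (auto simp: U_def)
      have "x \<notin> F ` \<Omega>"
      proof
        assume "x \<in> F ` \<Omega>"
        then obtain z where z: "z \<in> \<Omega>" "x = F z" by blast
        then have "x \<in> K" using xr by (auto simp: K_def intro!: imageI less_imp_le)
        then show False using x by (simp add: U_def)
      qed
      moreover have "x \<in> polydisc" unfolding polydisc_iff using xr r(2) by (meson less_trans)
      ultimately show "x \<in> polydisc - F ` \<Omega>" by blast
    qed
    ultimately show "\<exists>T. open T \<and> y \<in> T \<and> T \<subseteq> polydisc - F ` \<Omega>" by blast
  qed
  then have "F ` \<Omega> \<inter> polydisc = {} \<or> (polydisc - F ` \<Omega>) \<inter> polydisc = {}"
    using connectedD[OF connected_polydisc open_image_F, of "polydisc - F ` \<Omega>"] by blast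
  then show ?thesis using F_polydisc w0(1) by blast
qed

text \<open>If all \<open>\<psi>\<^sub>j'\<close> vanish in direction \<open>X\<close>, the two-point estimate at \<open>z\<close> and \<open>z + t X\<close>, divided by \<open>t\<close>, forces \<open>f'\<close> to
  vanish in direction \<open>X\<close> for each \<open>f\<close> that competes in the Caratheodory-Reiffen metric. The sum of the distances replaces
  their maximum, because it has a limit at once.\<close>

lemma derivative_injective:
  assumes z: "z \<in> \<Omega>" and D: "\<And>i. (e i has_derivative D i) (at z)" and X: "\<And>i. D i X = 0"
  shows "X = 0"
proof (rule ccontr)
  assume "X \<noteq> 0"
  then have "0 < caratheodory_reiffen \<Omega> z X" using gamma z unfolding gamma_hyperbolic_def by blast
  then obtain f where f: "f mholomorphic_on \<Omega>" "f ` \<Omega> \<subseteq> unit_disc" "f z = 0"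
    and pos: "0 < ennreal (cmod (frechet_derivative f (at z) X))"
    unfolding caratheodory_reiffen_def less_SUP_iff by blast
  obtain f' where f': "(f has_derivative f') (at z)" by (rule mholomorphic_onE[OF f(1) z]) blast
  have "frechet_derivative f (at z) = f'" using frechet_derivative_at[OF f'] by simp
  then have ne: "cmod (f' X) > 0" using pos by simp
  define \<tau> where "\<tau> t = (\<Sum>i\<in>UNIV. pseudohyperbolic_dist (e i z) (e i (z + t *\<^sub>R X)))" for t
  have in\<Omega>: "\<forall>\<^sub>F t in at_right 0. z + t *\<^sub>R X \<in> \<Omega>"
  proof -
    have "((\<lambda>t. z + t *\<^sub>R X) \<longlongrightarrow> z + 0 *\<^sub>R X) (at_right 0)" by (intro tendsto_intros)
    then show ?thesis using topological_tendstoD[OF _ open_\<Omega>] z by fastforce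
  qed
  have le: "\<forall>\<^sub>F t in at_right 0. cmod (f (z + t *\<^sub>R X) - f z) / t \<le> \<tau> t / t"
    using in\<Omega> eventually_at_right_less[of "0::real"]
  proof eventually_elim
    case (elim t)
    have "pseudohyperbolic_dist (f z) (f (z + t *\<^sub>R X)) \<le> \<tau> t"
    proof (rule two_points[OF f(1,2) z elim(1)])
      show "0 \<le> \<tau> t" unfolding \<tau>_def by (intro sum_nonneg pseudohyperbolic_dist_nonneg)
      show "pseudohyperbolic_dist (e i z) (e i (z + t *\<^sub>R X)) \<le> \<tau> t" for i
        unfolding \<tau>_def by (rule member_le_sum) (auto simp: pseudohyperbolic_dist_nonneg)
    qed
    then show ?case using elim(2) by (simp add: pseudohyperbolic_dist_def f(3) divide_right_mono)
  qed
  have "((\<lambda>t. \<Sum>i\<in>UNIV. (cmod (e i (z + t *\<^sub>R X) - e i z) / t) / cmod (1 - e i z * cnj (e i (z + t *\<^sub>R X))))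
      \<longlongrightarrow> (\<Sum>i\<in>UNIV. cmod (D i X) / cmod (1 - e i z * cnj (e i z)))) (at_right 0)"
  proof (intro tendsto_sum tendsto_divide directional_quotient_tendsto D)
    fix i
    have "isCont (e i) z" using has_derivative_continuous[OF D] .
    moreover have "((\<lambda>t. z + t *\<^sub>R X) \<longlongrightarrow> z + 0 *\<^sub>R X) (at_right 0)" by (intro tendsto_intros)
    ultimately have "((\<lambda>t. e i (z + t *\<^sub>R X)) \<longlongrightarrow> e i z) (at_right 0)"
      by (intro isCont_tendsto_compose[of z "e i"]) auto
    then show "((\<lambda>t. cmod (1 - e i z * cnj (e i (z + t *\<^sub>R X)))) \<longlongrightarrow> cmod (1 - e i z * cnj (e i z))) (at_right 0)"
      by (intro tendsto_intros)
    show "cmod (1 - e i z * cnj (e i z)) \<noteq> 0"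
      using mult_cnj_neq_one[OF e_less[OF z] e_less[OF z]] by simp
  qed
  moreover have "\<tau> t / t = (\<Sum>i\<in>UNIV. (cmod (e i (z + t *\<^sub>R X) - e i z) / t) / cmod (1 - e i z * cnj (e i (z + t *\<^sub>R X))))" for t
    unfolding \<tau>_def sum_divide_distrib
    by (intro sum.cong refl) (simp add: pseudohyperbolic_dist_def norm_divide norm_minus_commute)
  ultimately have lim: "((\<lambda>t. \<tau> t / t) \<longlongrightarrow> 0) (at_right 0)" by (simp add: X)
  have "cmod (f' X) \<le> 0"
    by (rule tendsto_le[OF _ lim directional_quotient_tendsto[OF f'] le]) simp
  then show False using ne by simp
qed

lemma biholomorphic_polydisc: "biholomorphic \<Omega> (polydisc :: (complex ^ 'm) set)"
proof -
  define G where "G = inv_into \<Omega> F"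
  have GF: "G (F z) = z" if "z \<in> \<Omega>" for z using that inj_F by (simp add: G_def)
  have FG: "F (G y) = y" if "y \<in> polydisc" for y
    using that unfolding G_def image_F[symmetric] by (rule f_inv_into_f)
  have G_in: "G y \<in> \<Omega>" if "y \<in> polydisc" for y
    using that unfolding G_def image_F[symmetric] by (rule inv_into_into)
  have img: "G ` polydisc = \<Omega>"
  proof
    show "\<Omega> \<subseteq> G ` polydisc" using GF F_polydisc by (metis image_subset_iff rev_image_eqI subsetI)
  qed (use G_in in auto)
  have contG: "continuous_on polydisc G"
  proof -
    obtain g where g: "homeomorphism \<Omega> (F ` \<Omega>) F g"
      using invariance_of_domain_homeomorphism[OF open_\<Omega> continuous_F _ inj_F] dim by auto
    then have "continuous_on polydisc g" by (simp add: homeomorphism_def image_F)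
    moreover have "g y = G y" if "y \<in> polydisc" for y
      using g FG[OF that] G_in[OF that] unfolding homeomorphism_def by metis
    ultimately show ?thesis by (simp cong: continuous_on_cong)
  qed
  have G_holo: "(\<lambda>y. G y $ j) mholomorphic_on polydisc" for j
  proof (rule mholomorphic_onI)
    fix y :: "complex ^ 'm" assume y: "y \<in> polydisc"
    let ?z = "G y"
    have z: "?z \<in> \<Omega>" by (rule G_in[OF y])
    obtain F' where F': "(F has_derivative F') (at ?z)" and clin: "\<And>c X. F' (c *s X) = c *s F' X"
      using mholomorphic_components_has_derivative[of F, OF _ z] e_holo by auto
    have lin: "linear F'" by (rule has_derivative_linear[OF F'])
    have D: "(e i has_derivative (\<lambda>X. F' X $ i)) (at ?z)" for i
      using bounded_linear.has_derivative[OF bounded_linear_vec_nth F', of i] by simp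
    have inj: "inj F'"
      unfolding linear_injective_0[OF lin]
    proof (intro allI impI)
      fix X assume "F' X = 0"
      then have "F' X $ i = 0" for i by simp
      then show "X = 0" by (rule derivative_injective[OF z D])
    qed
    have surj: "surj F'"
    proof -
      have "dim (range F') = DIM(complex ^ 'm)"
        using dim_image_eq[OF lin, of UNIV] inj dim by simp
      then have "span (range F') = UNIV" by (simp only: dim_eq_full)
      then show ?thesis using span_linear_image[OF lin, of UNIV] by simp
    qed
    obtain G' where G': "linear G'" "G' \<circ> F' = id"
      using linear_injective_left_inverse[OF lin inj] by blast
    have "(G has_derivative G') (at y)"
    proof (rule has_derivative_inverse_basic[OF F' _ G'(2) _ open_polydisc y FG])
      show "bounded_linear G'" using G'(1) by (rule linear_conv_bounded_linear[THEN iffD1])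
      show "continuous (at y) G"
        using continuous_on_eq_continuous_at[OF open_polydisc] contG y by blast
    qed
    then have "((\<lambda>y. G y $ j) has_derivative (\<lambda>Y. G' Y $ j)) (at y)"
      by (rule bounded_linear.has_derivative[OF bounded_linear_vec_nth])
    moreover have "G' (c *s Y) $ j = c * G' Y $ j" for c Y
    proof -
      obtain X where X: "Y = F' X" using surj by (metis surjD)
      have inv: "G' (F' X) = X" for X using G'(2) by (metis comp_apply id_apply)
      show ?thesis unfolding X clin[symmetric] inv by simp
    qed
    ultimately show "\<exists>D. ((\<lambda>y. G y $ j) has_derivative D) (at y) \<and> (\<forall>c X. D (c *s X) = c * D X)"
      by (intro exI[of _ "\<lambda>Y. G' Y $ j"]) auto
  qed
  show ?thesis unfolding biholomorphic_def
  proof (intro exI[of _ F] exI[of _ G] conjI ballI allI)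
    show "(\<lambda>z. F z $ i) mholomorphic_on \<Omega>" for i using e_holo by simp
  qed (use image_F img GF FG G_holo in auto)
qed

text \<open>On the common zero set of all but three coordinates the remaining factors \<open>1 - \<psi> \<cdot> cnj \<psi>\<close> are \<open>1\<close>, so the kernel of
  the tridisc is admissible there.\<close>

lemma card_le_2: "CARD('m) \<le> 2"
proof (rule ccontr)
  assume "\<not> CARD('m) \<le> 2"
  then have "3 \<le> card (UNIV :: 'm set)" by simp
  then obtain S :: "'m set" where S: "card S = 3" by (meson obtain_subset_with_card_n)
  then obtain i1 i2 i3 where i: "S = {i1, i2, i3}" "i1 \<noteq> i2" "i2 \<noteq> i3" "i1 \<noteq> i3"
    unfolding card_3_iff by blast
  define A where "A = {z \<in> \<Omega>. \<forall>i. i \<notin> {i1, i2, i3} \<longrightarrow> e i z = 0}"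
  have A: "A \<subseteq> \<Omega>" by (auto simp: A_def)
  define f where "f = restrict (\<lambda>z. vpoly (e i1 z) (e i2 z) (e i3 z) / 5) \<Omega>"
  have "f \<in> schur_class \<Omega>" unfolding f_def
  proof (rule schur_classI[OF open_\<Omega> vpoly_mholomorphic[OF e_holo e_holo e_holo]])
    fix z assume "z \<in> \<Omega>"
    then have "cmod (vpoly (e i1 z) (e i2 z) (e i3 z)) \<le> 5"
      by (intro norm_vpoly_le less_imp_le e_less)
    then show "cmod (vpoly (e i1 z) (e i2 z) (e i3 z) / 5) \<le> 1" by (simp add: norm_divide)
  qed
  then have f: "f \<in> schur_agler_class \<Omega> (range e)" by (simp add: SA)
  have less: "cmod (e i z) < 1" if "z \<in> A" for i z using that A e_less by blast
  note k_psd = vkernel_psd[where A = A and ?u1.0 = "e i1" and ?u2.0 = "e i2" and ?u3.0 = "e i3", OF less less less]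
  have psd: "psd_on A (\<lambda>z w. (1 - f z * cnj (f w)) * vkernel_of (e i1) (e i2) (e i3) z w)"
  proof (rule schur_agler_psd_on_subset[OF f A k_psd(2)])
    fix \<psi> assume "\<psi> \<in> range e"
    then obtain i where \<psi>: "\<psi> = e i" by blast
    show "psd_on A (\<lambda>z w. (1 - \<psi> z * cnj (\<psi> w)) * vkernel_of (e i1) (e i2) (e i3) z w)"
    proof (cases "i \<in> {i1, i2, i3}")
      case True
      then show ?thesis unfolding \<psi> using k_psd(3-5) by blast
    next
      case False
      show ?thesis unfolding \<psi>
        by (rule psd_on_one_minus_const[OF k_psd(2), of 0]) (use False in \<open>auto simp: A_def\<close>)
    qed
  qed
  have f_eq: "f z = vpoly (e i1 z) (e i2 z) (e i3 z) / 5" if "z \<in> A" for z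
    using that A by (auto simp: f_def)
  have points: "\<exists>p\<in>A. e i1 p = of_real x \<and> e i2 p = of_real y \<and> e i3 p = of_real z"
    if xyz: "\<bar>x\<bar> < 1" "\<bar>y\<bar> < 1" "\<bar>z\<bar> < 1" for x y z :: real
  proof -
    define Y :: "complex ^ 'm" where "Y = (\<chi> i. if i = i1 then of_real x else if i = i2 then of_real y
      else if i = i3 then of_real z else 0)"
    have "cmod (Y $ i) < 1" for i using xyz by (simp add: Y_def)
    then have "Y \<in> F ` \<Omega>" unfolding image_F polydisc_iff by blast
    then obtain p where p: "Y = F p" "p \<in> \<Omega>" by (rule imageE)
    have e_p: "e i p = Y $ i" for i unfolding p(1) by simp
    have "p \<in> A" using p(2) by (simp add: A_def e_p) (simp add: Y_def)
    moreover have "e i1 p = of_real x" "e i2 p = of_real y" "e i3 p = of_real z"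
      unfolding e_p using i(2-4) by (simp_all add: Y_def)
    ultimately show ?thesis by blast
  qed
  show False by (rule vkernel_not_multiplier[OF points less less less f_eq psd])
qed

end

section \<open>Domains biholomorphic to the disc or the bidisc\<close>

lemma mholomorphic_on_compose:
  fixes G :: "complex ^ 'm \<Rightarrow> complex ^ 'n"
  assumes f: "f mholomorphic_on U" and G: "\<And>j. (\<lambda>y. G y $ j) mholomorphic_on V" "G ` V \<subseteq> U"
  shows "(\<lambda>y. f (G y)) mholomorphic_on V"
proof (rule mholomorphic_onI)
  fix y assume y: "y \<in> V"
  obtain G' where G': "(G has_derivative G') (at y)" "\<And>c X. G' (c *s X) = c *s G' X"
    using mholomorphic_components_has_derivative[OF G(1) y] by blast
  have "G y \<in> U" using G(2) y by blast
  then obtain f' where f': "(f has_derivative f') (at (G y))" "\<And>c X. f' (c *s X) = c * f' X"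
    by (rule mholomorphic_onE[OF f]) blast
  have "((\<lambda>y. f (G y)) has_derivative (\<lambda>X. f' (G' X))) (at y)"
    by (rule has_derivative_compose[OF G'(1) f'(1)])
  then show "\<exists>D. ((\<lambda>y. f (G y)) has_derivative D) (at y) \<and> (\<forall>c X. D (c *s X) = c * D X)"
    by (intro exI[of _ "\<lambda>X. f' (G' X)"]) (simp add: f'(2) G'(2))
qed

lemma mholomorphic_on_line:
  fixes h :: "complex ^ 'm \<Rightarrow> complex"
  assumes h: "h mholomorphic_on V" and line: "\<And>a. a \<in> S \<Longrightarrow> (\<chi> i. if i \<in> J then a else c i) \<in> V" and "open S"
  shows "(\<lambda>a. h (\<chi> i. if i \<in> J then a else c i)) holomorphic_on S"
  unfolding holomorphic_on_open[OF \<open>open S\<close>]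
proof
  fix a assume a: "a \<in> S"
  obtain h' where h': "(h has_derivative h') (at (\<chi> i. if i \<in> J then a else c i))" "\<And>c X. h' (c *s X) = c * h' X"
    by (rule mholomorphic_onE[OF h line[OF a]]) blast
  define v :: "complex ^ 'm" where "v = (\<chi> i. if i \<in> J then 1 else 0)"
  have comp: "((\<lambda>a. if j \<in> J then a else c j) has_derivative (\<lambda>t. if j \<in> J then t else 0)) (at a)" for j
    by (cases "j \<in> J") simp_all
  have "((\<lambda>a. \<chi> i. if i \<in> J then a else c i) has_derivative (\<lambda>t. \<chi> i. if i \<in> J then t else 0)) (at a)"
    unfolding has_derivative_componentwise_within[of "\<lambda>a. \<chi> i. if i \<in> J then a else c i"] Basis_vec_def
    by (auto simp: inner_axis intro!: has_derivative_inner_left comp)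
  from has_derivative_compose[OF this h'(1)]
  have "((\<lambda>a. h (\<chi> i. if i \<in> J then a else c i)) has_derivative (\<lambda>t. h' (\<chi> i. if i \<in> J then t else 0))) (at a)" .
  moreover have "h' (\<chi> i. if i \<in> J then t else 0) = h' v * t" for t
  proof -
    have "(\<chi> i. if i \<in> J then t else 0) = t *s v" by (simp add: v_def vec_eq_iff)
    then show ?thesis by (simp add: h'(2))
  qed
  ultimately have "((\<lambda>a. h (\<chi> i. if i \<in> J then a else c i)) has_field_derivative h' v) (at a)"
    by (simp add: has_field_derivative_def)
  then show "\<exists>f'. ((\<lambda>a. h (\<chi> i. if i \<in> J then a else c i)) has_field_derivative f') (at a)" by blast
qed

lemma schur_agler_norm_le_one:
  assumes f: "f \<in> schur_agler_class \<Omega> \<Psi>" and z: "z \<in> \<Omega>" and \<Psi>: "\<And>\<psi>. \<psi> \<in> \<Psi> \<Longrightarrow> cmod (\<psi> z) \<le> 1"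
  shows "cmod (f z) \<le> 1"
proof -
  have "psd_on {z} (\<lambda>z w. (1 - f z * cnj (f w)) * 1)"
  proof (rule schur_agler_psd_on_subset[OF f _ psd_on_one])
    fix \<psi> assume "\<psi> \<in> \<Psi>"
    then show "psd_on {z} (\<lambda>z w. (1 - \<psi> z * cnj (\<psi> w)) * 1)"
      by (intro psd_on_one_minus_const[OF psd_on_one \<Psi>]) auto
  qed (use z in auto)
  then have "(\<Sum>i<length [z]. \<Sum>j<length [z]. cnj 1 * ((1 - f ([z] ! i) * cnj (f ([z] ! j))) * 1) * 1) \<in> \<real>\<^sub>\<ge>\<^sub>0"
    by (rule psd_onD) simp
  then have "1 - f z * cnj (f z) \<in> \<real>\<^sub>\<ge>\<^sub>0" by simp
  also have "1 - f z * cnj (f z) = complex_of_real (1 - (cmod (f z))\<^sup>2)"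
    unfolding of_real_diff of_real_1 cmod_power2_eq_mult_cnj ..
  finally have "(cmod (f z))\<^sup>2 \<le> 1" unfolding nonneg_Reals_of_real_iff by simp
  then show ?thesis using abs_square_le_1[of "cmod (f z)"] by simp
qed

text \<open>The indices \<open>i1\<close> and \<open>i2\<close> may coincide; this is how the disc is included.\<close>

locale bidisc_coordinates =
  fixes \<Omega> :: "(complex ^ 'n) set" and F :: "complex ^ 'n \<Rightarrow> complex ^ 'm" and G :: "complex ^ 'm \<Rightarrow> complex ^ 'n"
    and i1 i2 :: 'm
  assumes domain: "complex_domain \<Omega>"
    and image_F: "F ` \<Omega> = polydisc" and image_G: "G ` polydisc = \<Omega>"
    and GF: "\<And>z. z \<in> \<Omega> \<Longrightarrow> G (F z) = z" and FG: "\<And>y. y \<in> polydisc \<Longrightarrow> F (G y) = y"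
    and F_holo: "\<And>i. (\<lambda>z. F z $ i) mholomorphic_on \<Omega>" and G_holo: "\<And>j. (\<lambda>y. G y $ j) mholomorphic_on polydisc"
    and UNIV_eq: "UNIV = {i1, i2}"
begin

definition e :: "'m \<Rightarrow> complex ^ 'n \<Rightarrow> complex" where "e i = restrict (\<lambda>z. F z $ i) \<Omega>"

lemma open_\<Omega>: "open \<Omega>" using domain by (simp add: complex_domain_def)

lemma F_less: "z \<in> \<Omega> \<Longrightarrow> cmod (F z $ i) < 1"
  using image_F polydisc_iff by blast

lemma G_in: "y \<in> polydisc \<Longrightarrow> G y \<in> \<Omega>" using image_G by blast

definition point :: "complex \<Rightarrow> complex \<Rightarrow> complex ^ 'm" where
  "point a b = (\<chi> i. if i = i1 then a else b)"

lemma point_in: "a \<in> ball 0 1 \<Longrightarrow> b \<in> ball 0 1 \<Longrightarrow> point a b \<in> polydisc"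
  by (simp add: polydisc_iff point_def)

lemma point_F: "point (F z $ i1) (F z $ i2) = F z"
proof -
  have "i = i1 \<or> i = i2" for i using UNIV_eq by auto
  then show ?thesis by (auto simp: point_def vec_eq_iff)
qed

lemma e_G_point: "a \<in> ball 0 1 \<Longrightarrow> b \<in> ball 0 1 \<Longrightarrow> e i (G (point a b)) = (if i = i1 then a else b)"
  by (simp add: e_def G_in point_in FG) (simp add: point_def)

lemma holomorphic_in_coordinates:
  assumes "\<And>a b. a \<in> ball 0 1 \<Longrightarrow> b \<in> ball 0 1 \<Longrightarrow> cmod (f (G (point a b))) \<le> 1"
    and "\<And>b. b \<in> ball 0 1 \<Longrightarrow> (\<lambda>a. f (G (point a b))) holomorphic_on ball 0 1"
    and "\<And>a. a \<in> ball 0 1 \<Longrightarrow> (\<lambda>b. f (G (point a b))) holomorphic_on ball 0 1"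
  shows "f mholomorphic_on \<Omega>"
proof (rule mholomorphic_on_cong[OF open_\<Omega>])
  show "(\<lambda>z. f (G (point (F z $ i1) (F z $ i2)))) mholomorphic_on \<Omega>"
    by (rule mholomorphic_on_compose_bidisc[of _ _ _ "\<lambda>a b. f (G (point a b))", OF F_holo _ F_holo _ assms(2,3,1)])
      (auto simp: F_less)
  show "f (G (point (F z $ i1) (F z $ i2))) = f z" if "z \<in> \<Omega>" for z
    using that by (simp add: point_F GF)
qed

lemma e_le_one: "z \<in> \<Omega> \<Longrightarrow> cmod (e i z) \<le> 1"
  using F_less[of z i] by (simp add: e_def)

text \<open>On a coordinate disc one test function is the coordinate and every other one is constant.\<close>

lemma schur_agler_subset: "schur_agler_class \<Omega> (range e) \<subseteq> schur_class \<Omega>"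
proof
  fix f assume f: "f \<in> schur_agler_class \<Omega> (range e)"
  have le: "cmod (f z) \<le> 1" if "z \<in> \<Omega>" for z
    by (rule schur_agler_norm_le_one[OF f that]) (use e_le_one[OF that] in auto)
  have "f mholomorphic_on \<Omega>"
  proof (rule holomorphic_in_coordinates)
    show "cmod (f (G (point a b))) \<le> 1" if "a \<in> ball 0 1" "b \<in> ball 0 1" for a b
      by (rule le[OF G_in[OF point_in[OF that]]])
    show "(\<lambda>a. f (G (point a b))) holomorphic_on ball 0 1" if b: "b \<in> ball 0 1" for b
    proof (rule hardy_functional_holomorphic, rule schur_agler_slice[OF f, where u = "e i1"])
      fix \<psi> assume "\<psi> \<in> range e"
      then obtain i where \<psi>: "\<psi> = e i" by blast
      show "(\<forall>a\<in>ball 0 1. \<psi> (G (point a b)) = a) \<or> (\<exists>c. cmod c \<le> 1 \<and> (\<forall>a\<in>ball 0 1. \<psi> (G (point a b)) = c))"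
        using b e_G_point[OF _ b, of _ i] unfolding \<psi> by (cases "i = i1") (auto intro!: exI[of _ b])
    next
      show "G (point a b) \<in> \<Omega>" "e i1 (G (point a b)) = a" if "a \<in> ball 0 1" for a
        using G_in[OF point_in[OF that b]] e_G_point[OF that b] by auto
    qed
    show "(\<lambda>b. f (G (point a b))) holomorphic_on ball 0 1" if a: "a \<in> ball 0 1" for a
    proof (cases "i1 = i2")
      case True
      then have "i = i1" for i :: 'm using UNIV_eq by auto
      then have "point a b = (\<chi> i. a)" for b by (simp add: point_def vec_eq_iff)
      then show ?thesis by simp
    next
      case False
      show ?thesis
      proof (rule hardy_functional_holomorphic, rule schur_agler_slice[OF f, where u = "e i2"])
        fix \<psi> assume "\<psi> \<in> range e"
        then obtain i where \<psi>: "\<psi> = e i" by blast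
        show "(\<forall>b\<in>ball 0 1. \<psi> (G (point a b)) = b) \<or> (\<exists>c. cmod c \<le> 1 \<and> (\<forall>b\<in>ball 0 1. \<psi> (G (point a b)) = c))"
          using a e_G_point[OF a, of _ i] unfolding \<psi> by (cases "i = i1") (auto intro!: exI[of _ a])
      next
        show "G (point a b) \<in> \<Omega>" "e i2 (G (point a b)) = b" if "b \<in> ball 0 1" for b
          using G_in[OF point_in[OF a that]] e_G_point[OF a that] False by auto
      qed
    qed
  qed
  moreover have "f \<in> \<Omega> \<rightarrow>\<^sub>E UNIV" using f unfolding schur_agler_class_def by blast
  ultimately show "f \<in> schur_class \<Omega>" unfolding schur_class_def using le by blast
qed

text \<open>On the points of a finite list, the two coordinates supply the numbers \<open>a\<^sub>i\<close>, \<open>b\<^sub>i\<close> in Agler's theorem on the bidisc.\<close>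

lemma schur_subset: "schur_class \<Omega> \<subseteq> schur_agler_class \<Omega> (range e)"
proof
  fix f assume "f \<in> schur_class \<Omega>"
  then have f: "f \<in> \<Omega> \<rightarrow>\<^sub>E UNIV" "f mholomorphic_on \<Omega>" "\<And>z. z \<in> \<Omega> \<Longrightarrow> cmod (f z) \<le> 1"
    unfolding schur_class_def by auto
  have h: "(\<lambda>y. f (G y)) mholomorphic_on polydisc"
    by (rule mholomorphic_on_compose[OF f(2) G_holo]) (use image_G in auto)
  have holo1: "(\<lambda>a. f (G (point a b))) holomorphic_on ball 0 1" if "b \<in> ball 0 1" for b
    using mholomorphic_on_line[OF h, of "ball 0 1" "{i1}" "\<lambda>_. b"] point_in[OF _ that] by (simp add: point_def)
  have holo2: "(\<lambda>b. f (G (point a b))) holomorphic_on ball 0 1" if "a \<in> ball 0 1" for a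
  proof -
    have eq: "point a b = (\<chi> i. if i \<in> - {i1} then b else a)" for b by (simp add: point_def vec_eq_iff)
    show ?thesis
      unfolding eq by (rule mholomorphic_on_line[OF h, of "ball 0 1" "- {i1}" "\<lambda>_. a"])
        (use point_in[OF that] in \<open>simp_all only: eq open_ball\<close>)
  qed
  have cont: "continuous_on (ball 0 1 \<times> ball 0 1) (\<lambda>x. f (G (point (fst x) (snd x))))"
  proof (rule continuous_on_compose2[OF mholomorphic_on_continuous[OF h]])
    have "continuous_on (ball 0 1 \<times> ball 0 1) (\<lambda>x. if i = i1 then fst x else snd x :: complex)" for i
      by (cases "i = i1") (auto intro!: continuous_intros)
    then show "continuous_on (ball 0 1 \<times> ball 0 1) (\<lambda>x. point (fst x) (snd x))"
      unfolding point_def by (rule continuous_on_vec_lambda)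
  qed (use point_in in auto)
  have "psd_on \<Omega> (\<lambda>z w. (1 - f z * cnj (f w)) * k z w)" if k: "k \<in> admissible_kernels \<Omega> (range e)" for k
    unfolding psd_on_iff_psd_matrix
  proof (intro allI impI)
    fix zs assume zs: "set zs \<subseteq> \<Omega>"
    let ?n = "length zs"
    have in\<Omega>: "zs ! i \<in> \<Omega>" if "i < ?n" for i using zs that nth_mem by blast
    have ek: "psd_matrix ?n (\<lambda>i j. (1 - F (zs ! i) $ l * cnj (F (zs ! j) $ l)) * k (zs ! i) (zs ! j))" for l
    proof -
      have "psd_on \<Omega> (\<lambda>z w. (1 - e l z * cnj (e l w)) * k z w)"
        using k unfolding admissible_kernels_def by blast
      then have "psd_matrix ?n (\<lambda>i j. (1 - e l (zs ! i) * cnj (e l (zs ! j))) * k (zs ! i) (zs ! j))"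
        unfolding psd_on_iff_psd_matrix using zs by blast
      then show ?thesis
        by (rule iffD1[OF psd_matrix_cong, rotated]) (simp add: e_def in\<Omega>)
    qed
    have "psd_on \<Omega> k" using k unfolding admissible_kernels_def by blast
    then have kk: "psd_matrix ?n (\<lambda>i j. k (zs ! i) (zs ! j))"
      unfolding psd_on_iff_psd_matrix using zs by blast
    have "psd_matrix ?n (\<lambda>i j. (1 - f (G (point (F (zs ! i) $ i1) (F (zs ! i) $ i2)))
        * cnj (f (G (point (F (zs ! j) $ i1) (F (zs ! j) $ i2))))) * k (zs ! i) (zs ! j))"
    proof (rule agler_bidisc[where f = "\<lambda>a b. f (G (point a b))" and a = "\<lambda>i. F (zs ! i) $ i1"
          and b = "\<lambda>i. F (zs ! i) $ i2", OF _ _ _ cont _ _ kk ek ek])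
      show "(\<lambda>a. f (G (point a b))) holomorphic_on ball 0 1" if "b \<in> ball 0 1" for b by (rule holo1[OF that])
      show "(\<lambda>b. f (G (point a b))) holomorphic_on ball 0 1" if "a \<in> ball 0 1" for a by (rule holo2[OF that])
      show "cmod (f (G (point a b))) \<le> 1" if "a \<in> ball 0 1" "b \<in> ball 0 1" for a b
        by (rule f(3)[OF G_in[OF point_in[OF that]]])
      show "F (zs ! i) $ i1 \<in> ball 0 1" "F (zs ! i) $ i2 \<in> ball 0 1" if "i < ?n" for i
        using F_less[OF in\<Omega>[OF that]] by simp_all
    qed
    then show "psd_matrix ?n (\<lambda>i j. (1 - f (zs ! i) * cnj (f (zs ! j))) * k (zs ! i) (zs ! j))"
      by (rule iffD1[OF psd_matrix_cong, rotated]) (simp add: point_F GF in\<Omega>)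
  qed
  then show "f \<in> schur_agler_class \<Omega> (range e)"
    unfolding schur_agler_class_def using f(1) by blast
qed

lemma test_functions_e: "test_functions \<Omega> (range e)"
  unfolding test_functions_def
proof (intro conjI ballI allI impI)
  show "range e \<subseteq> \<Omega> \<rightarrow>\<^sub>E UNIV" by (auto simp: e_def)
  fix z assume z: "z \<in> \<Omega>"
  have "Max ((\<lambda>\<psi>. ennreal (cmod (\<psi> z))) ` range e) < 1"
    by (subst Max_less_iff) (use z F_less in \<open>auto simp: e_def\<close>)
  then show "(SUP \<psi>\<in>range e. ennreal (cmod (\<psi> z))) < 1"
    by (subst (asm) Max_Sup) auto
next
  fix A assume A: "finite A \<and> A \<subseteq> \<Omega>"
  show "generated_algebra A (range e) = A \<rightarrow>\<^sub>E UNIV"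
  proof (rule generated_algebra_separating)
    fix z w assume zw: "z \<in> A" "w \<in> A" "z \<noteq> w"
    then have "z \<in> \<Omega>" "w \<in> \<Omega>" using A by auto
    then have "F z \<noteq> F w" using GF zw(3) by metis
    then obtain i where "F z $ i \<noteq> F w $ i" by (auto simp: vec_eq_iff)
    then show "\<exists>\<psi>\<in>range e. \<psi> z \<noteq> \<psi> w"
      using \<open>z \<in> \<Omega>\<close> \<open>w \<in> \<Omega>\<close> by (intro bexI[of _ "e i"]) (auto simp: e_def)
  qed (use A in auto)
qed

lemma inj_e: "inj e"
proof (rule injI, rule ccontr)
  fix i j assume eq: "e i = e j" and "i \<noteq> j"
  define y :: "complex ^ 'm" where "y = (\<chi> l. if l = i then 1 / 2 else 0)"
  have y: "y \<in> polydisc" by (simp add: polydisc_iff y_def)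
  have e_y: "e l (G y) = y $ l" for l by (simp add: e_def G_in[OF y] FG[OF y])
  have "y $ i = y $ j" unfolding e_y[symmetric] by (simp only: eq)
  then show False using \<open>i \<noteq> j\<close> by (simp add: y_def)
qed

lemma test_functions_exist:
  "\<exists>\<Psi>. test_functions \<Omega> \<Psi> \<and> \<Psi> \<subseteq> schur_class \<Omega> \<and> finite \<Psi> \<and> card \<Psi> = CARD('m) \<and>
     (\<exists>w\<^sub>0\<in>\<Omega>. \<forall>\<psi>\<in>\<Psi>. \<psi> w\<^sub>0 = 0) \<and> schur_agler_class \<Omega> \<Psi> = schur_class \<Omega>"
proof (intro exI[of _ "range e"] conjI)
  show "range e \<subseteq> schur_class \<Omega>"
  proof
    fix \<psi> assume "\<psi> \<in> range e"
    then obtain i where \<psi>: "\<psi> = e i" by blast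
    show "\<psi> \<in> schur_class \<Omega>"
      unfolding \<psi> e_def by (rule schur_classI[OF open_\<Omega> F_holo]) (rule less_imp_le[OF F_less])
  qed
  have 0: "(0 :: complex ^ 'm) \<in> polydisc" by (simp add: polydisc_iff)
  show "\<exists>w\<^sub>0\<in>\<Omega>. \<forall>\<psi>\<in>range e. \<psi> w\<^sub>0 = 0"
    by (rule bexI[OF _ G_in[OF 0]]) (auto simp: e_def G_in[OF 0] FG[OF 0])
  show "schur_agler_class \<Omega> (range e) = schur_class \<Omega>"
    using schur_agler_subset schur_subset by blast
qed (simp_all add: test_functions_e card_image inj_e)

end

lemma biholomorphic_imp_card_eq:
  fixes U :: "(complex ^ 'n) set" and V :: "(complex ^ 'm) set"
  assumes bih: "biholomorphic U V" and U: "open U" "U \<noteq> {}" and V: "open V"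
  shows "CARD('n) = CARD('m)"
proof -
  obtain F :: "complex ^ 'n \<Rightarrow> complex ^ 'm" and G :: "complex ^ 'm \<Rightarrow> complex ^ 'n"
    where FG: "F ` U = V" "G ` V = U" "\<forall>z\<in>U. G (F z) = z" "\<forall>w\<in>V. F (G w) = w"
      "\<forall>i. (\<lambda>z. F z $ i) mholomorphic_on U" "\<forall>i. (\<lambda>w. G w $ i) mholomorphic_on V"
    using bih unfolding biholomorphic_def by blast
  have "continuous_on U (\<lambda>z. \<chi> i. F z $ i)" "continuous_on V (\<lambda>z. \<chi> i. G z $ i)"
    by (rule continuous_on_vec_lambda, rule mholomorphic_on_continuous, use FG(5,6) in blast)+
  then have cont: "continuous_on U F" "continuous_on V G" by simp_all
  have inj: "inj_on F U" "inj_on G V" using FG(3,4) by (metis inj_on_inverseI)+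
  have "DIM(complex ^ 'n) \<le> DIM(complex ^ 'm)"
    by (rule invariance_of_dimension[OF cont(1) U(1) inj(1) U(2)])
  moreover have "DIM(complex ^ 'm) \<le> DIM(complex ^ 'n)"
    by (rule invariance_of_dimension[OF cont(2) V inj(2)]) (use FG(1) U(2) in auto)
  ultimately show ?thesis by simp
qed

theorem theorem2p7:
  fixes \<Omega> :: "(complex ^ 'n) set" and m :: nat
  assumes "m \<ge> 1" and "CARD('m::finite) = m"
    and "complex_domain \<Omega>"
    and "caratheodory_hyperbolic \<Omega>"
    and "gamma_hyperbolic \<Omega>"
    and "caratheodory_finitely_compact \<Omega>"
  shows "(CARD('n) = m \<and>
          (\<exists>\<Psi>. test_functions \<Omega> \<Psi> \<and> \<Psi> \<subseteq> schur_class \<Omega> \<and> finite \<Psi> \<and> card \<Psi> = m \<and>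
               (\<exists>w\<^sub>0\<in>\<Omega>. \<forall>\<psi>\<in>\<Psi>. \<psi> w\<^sub>0 = 0) \<and>
               schur_agler_class \<Omega> \<Psi> = schur_class \<Omega>))
     \<longleftrightarrow> ((m = 1 \<or> m = 2) \<and> biholomorphic \<Omega> (polydisc :: (complex ^ 'm) set))"
proof (intro iffI; elim conjE exE)
  fix \<Psi> :: "(complex ^ 'n \<Rightarrow> complex) set"
  assume dim: "CARD('n) = m" and \<Psi>: "test_functions \<Omega> \<Psi>" "\<Psi> \<subseteq> schur_class \<Omega>" "finite \<Psi>" "card \<Psi> = m"
    and w0: "\<exists>w\<^sub>0\<in>\<Omega>. \<forall>\<psi>\<in>\<Psi>. \<psi> w\<^sub>0 = 0" and SA: "schur_agler_class \<Omega> \<Psi> = schur_class \<Omega>"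
  have "\<exists>e. bij_betw e (UNIV :: 'm set) \<Psi>"
    using \<Psi>(3,4) assms(2) by (subst bij_betw_iff_card) auto
  then obtain e :: "'m \<Rightarrow> complex ^ 'n \<Rightarrow> complex" where e: "range e = \<Psi>"
    unfolding bij_betw_def by blast
  from w0 obtain w\<^sub>0 where w0: "w\<^sub>0 \<in> \<Omega>" "\<forall>\<psi>\<in>\<Psi>. \<psi> w\<^sub>0 = 0" by blast
  interpret schur_agler_coordinates \<Omega> e w\<^sub>0
    by unfold_locales (use assms \<Psi> w0 SA dim e in auto)
  show "(m = 1 \<or> m = 2) \<and> biholomorphic \<Omega> (polydisc :: (complex ^ 'm) set)"
  proof
    have "m \<le> 2" using card_le_2 assms(2) by simp
    then show "m = 1 \<or> m = 2" using assms(1) by linarith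
  qed (rule biholomorphic_polydisc)
next
  assume m: "m = 1 \<or> m = 2" and bih: "biholomorphic \<Omega> (polydisc :: (complex ^ 'm) set)"
  have \<Omega>: "open \<Omega>" "\<Omega> \<noteq> {}" using assms(3) by (auto simp: complex_domain_def)
  have dim: "CARD('n) = m"
    using biholomorphic_imp_card_eq[OF bih \<Omega> open_polydisc] assms(2) by simp
  obtain i1 i2 :: 'm where i: "UNIV = {i1, i2}"
    using m
  proof
    assume "m = 1"
    then obtain i :: 'm where "UNIV = {i}" using assms(2) by (metis card_1_singletonE)
    then show ?thesis using that[of i i] by simp
  next
    assume "m = 2"
    then obtain x y :: 'm where "UNIV = {x, y}"
      using assms(2) card_2_iff[of "UNIV :: 'm set"] by auto
    then show ?thesis by (rule that)
  qed
  obtain F :: "complex ^ 'n \<Rightarrow> complex ^ 'm" and G :: "complex ^ 'm \<Rightarrow> complex ^ 'n"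
    where FG: "F ` \<Omega> = polydisc" "G ` polydisc = \<Omega>"
      "\<forall>z\<in>\<Omega>. G (F z) = z" "\<forall>w\<in>polydisc. F (G w) = w"
      "\<forall>i. (\<lambda>z. F z $ i) mholomorphic_on \<Omega>" "\<forall>i. (\<lambda>w. G w $ i) mholomorphic_on polydisc"
    using bih unfolding biholomorphic_def by blast
  have GF: "G (F z) = z" if "z \<in> \<Omega>" for z using FG(3) that by blast
  have FG': "F (G w) = w" if "w \<in> polydisc" for w using FG(4) that by blast
  have F_holo: "(\<lambda>z. F z $ i) mholomorphic_on \<Omega>" for i using FG(5) by blast
  have G_holo: "(\<lambda>w. G w $ i) mholomorphic_on polydisc" for i using FG(6) by blast
  interpret bidisc_coordinates \<Omega> F G i1 i2
    by (rule bidisc_coordinates.intro[OF assms(3) FG(1,2) GF FG' F_holo G_holo i])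
  show "CARD('n) = m \<and> (\<exists>\<Psi>. test_functions \<Omega> \<Psi> \<and> \<Psi> \<subseteq> schur_class \<Omega> \<and> finite \<Psi> \<and> card \<Psi> = m \<and>
               (\<exists>w\<^sub>0\<in>\<Omega>. \<forall>\<psi>\<in>\<Psi>. \<psi> w\<^sub>0 = 0) \<and>
               schur_agler_class \<Omega> \<Psi> = schur_class \<Omega>)"
    using dim test_functions_exist unfolding assms(2) by blast
qed

end
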